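(* Let $\mathfrak M$ be an R-regular weight matrix and $U\in\mathscr D(\mathbb{R}^n)$. Then a function $f:U\to\mathbb R$ belongs to $\mathcal B^{\{\mathfrak M\}}(U)$ if and only if $f$ is $\{\mathfrak M\}$-almost analytically extendable.
   Context: A weight sequence is $\mathbf M=(M_k)_{k\in\mathbb N}$ with $M_0=1$, $\mu_k:=M_k/M_{k-1}$ satisfying $1\le\mu_1\le\mu_2\le\cdots$, and $M_k^{1/k}\to\infty$; write $m_k=M_k/k!$ (similarly $\mathbf N\leftrightarrow\mathbf n$). A weight matrix is a family of weight sequences totally ordered by the pointwise order. For a positive sequence $\mathbf m$ with $m_0=1$, $m_k^{1/k}\to\infty$ and $m_{k+1}/m_k\to\infty$ define $h_{\mathbf m}(t)=\inf_k m_kt^k$ ($t>0$), $h_{\mathbf m}(0)=0$, $\overline\Gamma_{\mathbf m}(t)=\min\{k:h_{\mathbf m}(t)=m_kt^k\}$, $\underline\Gamma_{\mathbf m}(t)=\min\{k:m_{k+1}/m_k\ge1/t\}$. A weight matrix $\mathfrak M$ is R-regular if: (0) $m_k^{1/k}\to\infty$ for all $\mathbf M\in\mathfrak M$; (1) for all $\mathbf M\in\mathfrak M$ there are $\mathbf N\in\mathfrak M$ and $C\ge1$ with $M_{j+1}\le C^{j+1}N_j$ for all $j$; (2) for all $\mathbf M\in\mathfrak M$ there are $\mathbf N\in\mathfrak M$ and $C\ge1$ with $\overline\Gamma_{\mathbf n}(Ct)\le\underline\Gamma_{\mathbf m}(t)$ for all $t>0$. $\mathscr D(\mathbb R^n)$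 is the set of non-empty bounded open quasiconvex $U\subseteq\mathbb R^n$: there is $C$ such that any $x,y\in U$ can be joined by a rectifiable path in $U$ of length $\le C|x-y|$. $\mathcal B^{\{\mathfrak M\}}(U)$ is the set of $f\in C^\infty(U)$ for which there exist $\mathbf M\in\mathfrak M$, $\rho>0$ with $\sup_{x\in U,\alpha\in\mathbb N^n}|\partial^\alpha f(x)|/(\rho^{|\alpha|}M_{|\alpha|})<\infty$. $f:U\to\mathbb R$ has an $(h,\rho)$-almost analytic extension if there are $F\in C^1_c(\mathbb C^n)$ and $C\ge1$ with $F|_U=f$ and $|\overline\partial F(z)|\le C\,h(\rho\,d(z,\overline U))$ for $z\in\mathbb C^n$, $d(z,\overline U)=\inf_{x\in\overline U}|z-x|$. $f$ is $\{\mathfrak M\}$-almost analytically extendable if it has an $(h_{\mathbf m},\rho)$-almost analytic extension for some $\mathbf M\in\mathfrak M$ and some $\rho>0$. *)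

theory Defs
  imports "HOL-Analysis.Analysis"
begin

definition quot_seq :: "(nat \<Rightarrow> real) \<Rightarrow> nat \<Rightarrow> real" where
  "quot_seq M k = M k / M (k - 1)"

definition weight_sequence :: "(nat \<Rightarrow> real) \<Rightarrow> bool" where
  "weight_sequence M \<longleftrightarrow>
     M 0 = 1 \<and> (\<forall>k. M k > 0) \<and>
     1 \<le> quot_seq M 1 \<and> (\<forall>k\<ge>1. quot_seq M k \<le> quot_seq M (Suc k)) \<and>
     filterlim (\<lambda>k. root k (M k)) at_top sequentially"

definition small_seq :: "(nat \<Rightarrow> real) \<Rightarrow> nat \<Rightarrow> real" where
  "small_seq M k = M k / fact k"

definition weight_matrix :: "(nat \<Rightarrow> real) set \<Rightarrow> bool" where
  "weight_matrix \<MM> \<longleftrightarrow> \<MM> \<noteq> {} \<and> (\<forall>M\<in>\<MM>. weight_sequence M) \<and>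
     (\<forall>M\<in>\<MM>. \<forall>N\<in>\<MM>. (\<forall>k. M k \<le> N k) \<or> (\<forall>k. N k \<le> M k))"

definition h_fun :: "(nat \<Rightarrow> real) \<Rightarrow> real \<Rightarrow> real" where
  "h_fun m t = (if t = 0 then 0 else (INF k. m k * t ^ k))"

definition Gamma_upper :: "(nat \<Rightarrow> real) \<Rightarrow> real \<Rightarrow> nat" where
  "Gamma_upper m t = (LEAST k. h_fun m t = m k * t ^ k)"

definition Gamma_lower :: "(nat \<Rightarrow> real) \<Rightarrow> real \<Rightarrow> nat" where
  "Gamma_lower m t = (LEAST k. m (Suc k) / m k \<ge> 1 / t)"

definition R_regular :: "(nat \<Rightarrow> real) set \<Rightarrow> bool" where
  "R_regular \<MM> \<longleftrightarrow> weight_matrix \<MM> \<and>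
     (\<forall>M\<in>\<MM>. filterlim (\<lambda>k. root k (small_seq M k)) at_top sequentially) \<and>
     (\<forall>M\<in>\<MM>. \<exists>N\<in>\<MM>. \<exists>C\<ge>1. \<forall>j. M (Suc j) \<le> C ^ (Suc j) * N j) \<and>
     (\<forall>M\<in>\<MM>. \<exists>N\<in>\<MM>. \<exists>C\<ge>1. \<forall>t>0.
        Gamma_upper (small_seq N) (C * t) \<le> Gamma_lower (small_seq M) t)"

definition length_le :: "(real \<Rightarrow> 'a::metric_space) \<Rightarrow> real \<Rightarrow> bool" where
  "length_le g L \<longleftrightarrow> (\<forall>ts::real list. sorted ts \<and> set ts \<subseteq> {0..1} \<longrightarrow>
      (\<Sum>i<length ts - 1. dist (g (ts ! i)) (g (ts ! Suc i))) \<le> L)"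

definition quasiconvex_domain :: "(real^'n) set \<Rightarrow> bool" where
  "quasiconvex_domain U \<longleftrightarrow> U \<noteq> {} \<and> bounded U \<and> open U \<and>
     (\<exists>C. \<forall>x\<in>U. \<forall>y\<in>U. \<exists>g. path g \<and> path_image g \<subseteq> U \<and>
         pathstart g = x \<and> pathfinish g = y \<and> length_le g (C * dist x y))"

fun dpart :: "'n list \<Rightarrow> (real^'n \<Rightarrow> real) \<Rightarrow> real^'n \<Rightarrow> real" where
  "dpart [] f = f"
| "dpart (i # is) f = (\<lambda>x. frechet_derivative (dpart is f) (at x) (axis i 1))"

definition smooth_on :: "(real^'n) set \<Rightarrow> (real^'n \<Rightarrow> real) \<Rightarrow> bool" where
  "smooth_on U f \<longleftrightarrow> (\<forall>is. \<forall>x\<in>U. dpart is f differentiable (at x))"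

(* sup over multi-indices alpha is taken over all lists of coordinate directions (same set of
   derivatives, since partials of smooth functions commute); |alpha| = length *)
definition B_roumieu :: "(nat \<Rightarrow> real) set \<Rightarrow> (real^'n) set \<Rightarrow> (real^'n \<Rightarrow> real) set" where
  "B_roumieu \<MM> U = {f. smooth_on U f \<and> (\<exists>M\<in>\<MM>. \<exists>\<rho>>0. \<exists>B. \<forall>x\<in>U. \<forall>is.
       \<bar>dpart is f x\<bar> / (\<rho> ^ length is * M (length is)) \<le> B)}"

definition cemb :: "real^'n \<Rightarrow> complex^'n" where
  "cemb x = (\<chi> j. complex_of_real (x $ j))"

(* dbar F = (dF/d zbar_j)_j with d/d zbar_j = (d/dx_j + i d/dy_j)/2 *)
definition dbar :: "(complex^'n \<Rightarrow> complex) \<Rightarrow> complex^'n \<Rightarrow> complex^'n" where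
  "dbar F z = (\<chi> j. (frechet_derivative F (at z) (axis j 1)
                     + \<i> * frechet_derivative F (at z) (axis j \<i>)) / 2)"

definition C1c :: "(complex^'n \<Rightarrow> complex) \<Rightarrow> bool" where
  "C1c F \<longleftrightarrow> (\<exists>F'. (\<forall>z. (F has_derivative blinfun_apply (F' z)) (at z)) \<and> continuous_on UNIV F')
             \<and> compact (closure {z. F z \<noteq> 0})"

definition almost_analytic_ext ::
  "(real \<Rightarrow> real) \<Rightarrow> real \<Rightarrow> (real^'n) set \<Rightarrow> (real^'n \<Rightarrow> real) \<Rightarrow> bool" where
  "almost_analytic_ext h \<rho> U f \<longleftrightarrow> (\<exists>F C. C1c F \<and> C \<ge> 1 \<and>
      (\<forall>x\<in>U. F (cemb x) = complex_of_real (f x)) \<and>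
      (\<forall>z. norm (dbar F z) \<le> C * h (\<rho> * infdist z (cemb ` closure U))))"

definition almost_analytic_extendable :: "(nat \<Rightarrow> real) set \<Rightarrow> (real^'n) set \<Rightarrow> (real^'n \<Rightarrow> real) \<Rightarrow> bool" where
  "almost_analytic_extendable \<MM> U f \<longleftrightarrow>
     (\<exists>M\<in>\<MM>. \<exists>\<rho>>0. almost_analytic_ext (h_fun (small_seq M)) \<rho> U f)"

end

theory Submission
  imports Defs
begin

text \<open>
  Let \<open>F\<close> be an almost analytic extension of \<open>f\<close>. The Bochner--Martinelli formula represents \<open>f\<close>
  on \<open>U\<close> as an integral of \<open>dbar F\<close> against a kernel homogeneous of degree \<open>1 - 2n\<close> in \<open>w - x\<close>.
  Since \<open>norm (dbar F w)\<close> is at most a constant times \<open>small_seq M k * (\<rho> * norm (w - x)) ^ k\<close> for every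
  \<open>k\<close> and every \<open>x \<in> U\<close>, one may differentiate under the integral, and the choice \<open>k = \<bar>\<alpha>\<bar> + 2n - 1\<close>
  makes the integrand bounded; the index shift is absorbed by the regularity condition (1).

  Conversely, Taylor polynomials of \<open>f\<close> at points of \<open>U\<close>, regarded as holomorphic polynomials, are
  glued by a partition of unity at the dyadic scales \<open>\<delta> k\<close>, the degree at scale \<open>\<delta> k\<close> being
  \<open>Gamma_lower m (t k) - 1\<close> with \<open>t k\<close> proportional to \<open>\<delta> k\<close>. The derivative of a Taylor polynomial
  with respect to its base point contains only the derivatives of \<open>f\<close> of highest order, so by quasiconvexity
  two polynomials at scale \<open>\<delta> k\<close> differ by at most a constant times \<open>m q * t k ^ q\<close> with
  \<open>q = Gamma_lower m (t k)\<close>. By regularity condition (2) this is bounded by the associated function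
  of another sequence of the matrix, and the factor \<open>1 / \<delta> k\<close> coming from the derivative of the partition of
  unity is absorbed by condition (1).
\<close>

section \<open>Associated functions of weight sequences\<close>

text \<open>Log-convexity is assumed of \<open>M\<close>, not of \<open>small_seq M\<close>. So
  \<open>m k * t ^ k\<close> may descend up to \<open>Gamma_lower m t\<close>, rise, and reach its
  minimum further right: the quantity \<open>m q * t ^ q\<close> produced by the Taylor polynomials
  can exceed \<open>h_fun m t\<close>. Condition (2) compares indices;
  \<open>Gamma_domination\<close> turns it into a comparison of values.

  In the other direction, k derivatives of the kernel cost a factor of order k! times a geometric
  one. This k! is what separates \<open>M\<close> from \<open>small_seq M\<close>, hence the
  bookkeeping of constants in \<open>hom_kernel\<close>.

  The extension has to be C^1 across the embedded closure of \<open>U\<close>, where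
  \<open>h_fun\<close> is 0 and \<open>dbar\<close> must vanish. Instead of cutting off by the
  distance, the functions glued at successive scales are joined by a series that telescopes near
  this set. Its terms are C^1 on the whole space and built from differences of Taylor polynomials,
  so it converges together with its first derivatives.\<close>

lemma small_seq_pos: "weight_sequence M \<Longrightarrow> small_seq M k > 0"
  by (simp add: weight_sequence_def small_seq_def)

lemma small_seq_0: "weight_sequence M \<Longrightarrow> small_seq M 0 = 1"
  by (simp add: weight_sequence_def small_seq_def)

text \<open>The property of \<open>small_seq M\<close> that makes the infimum in
  \<open>h_fun\<close> a minimum: the terms eventually dominate every geometric sequence.\<close>

definition root_divergent :: "(nat \<Rightarrow> real) \<Rightarrow> bool" where
  "root_divergent m \<longleftrightarrow> (\<forall>k. m k > 0) \<and> m 0 = 1 \<and>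
     filterlim (\<lambda>k. root k (m k)) at_top sequentially"

lemma root_divergentD:
  assumes "root_divergent m"
  shows "m k > 0" "m 0 = 1"
  using assms by (auto simp: root_divergent_def)

lemma eventually_power_le_root_divergent:
  assumes "root_divergent m" "C \<ge> 0"
  shows "eventually (\<lambda>k. C ^ k \<le> m k) sequentially"
proof -
  have "eventually (\<lambda>k. root k (m k) \<ge> C) sequentially"
    using assms by (simp add: root_divergent_def filterlim_at_top)
  with eventually_gt_at_top[of 0] show ?thesis
  proof eventually_elim
    case (elim k)
    then have "C ^ k \<le> root k (m k) ^ k"
      using assms(2) by (intro power_mono) auto
    also have "\<dots> = m k"
      using elim root_divergentD(1)[OF assms(1), of k] by (intro real_root_pow_pos2) auto
    finally show ?case .
  qed
qed

text \<open>From some index \<open>K\<close> on the terms are at least 1, the value of the term of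
  index 0, so the infimum is a minimum over the finitely many indices up to
  \<open>K\<close>.\<close>

lemma h_fun_attained:
  assumes m: "root_divergent m" and t: "t > 0"
  obtains k where "h_fun m t = m k * t ^ k" "\<And>j. m k * t ^ k \<le> m j * t ^ j"
proof -
  have "eventually (\<lambda>k. (1/t) ^ k \<le> m k) sequentially"
    using m t by (intro eventually_power_le_root_divergent) auto
  then obtain K where K: "\<And>k. k \<ge> K \<Longrightarrow> (1/t) ^ k \<le> m k"
    by (auto simp: eventually_sequentially)
  have ge1: "m k * t ^ k \<ge> 1" if "k \<ge> K" for k
    using K[OF that] t by (simp add: field_simps power_divide)
  define S where "S = (\<lambda>k. m k * t ^ k) ` {..K}"
  have "finite S" "S \<noteq> {}" by (auto simp: S_def)
  then have "Min S \<in> S" by (rule Min_in)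
  then obtain k where k: "k \<le> K" "Min S = m k * t ^ k" unfolding S_def by (elim imageE) auto
  have 0: "m 0 * t ^ 0 \<in> S" unfolding S_def by (rule image_eqI[of _ _ 0]) auto
  have le: "m k * t ^ k \<le> m j * t ^ j" for j
  proof (cases "j \<le> K")
    case True
    then show ?thesis using \<open>finite S\<close> k Min_le[of S "m j * t ^ j"] by (auto simp: S_def)
  next
    case False
    have "m k * t ^ k \<le> m 0 * t ^ 0"
      using Min_le[OF \<open>finite S\<close> 0] k by simp
    also have "\<dots> = 1" using root_divergentD[OF m] by simp
    also have "\<dots> \<le> m j * t ^ j" using ge1[of j] False by simp
    finally show ?thesis .
  qed
  have "h_fun m t = m k * t ^ k"
  proof -
    have "(INF j. m j * t ^ j) = m k * t ^ k"
      using le by (intro cInf_eq_minimum) auto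
    then show ?thesis using t by (simp add: h_fun_def)
  qed
  with le that show ?thesis by blast
qed

lemma h_fun_le:
  assumes "root_divergent m" "t \<ge> 0"
  shows "h_fun m t \<le> m k * t ^ k"
proof (cases "t = 0")
  case True
  then show ?thesis using root_divergentD(1)[OF assms(1), of k] by (simp add: h_fun_def)
next
  case False
  with assms(2) have "t > 0" by simp
  from h_fun_attained[OF assms(1) this] show ?thesis by metis
qed

lemma h_fun_pos:
  assumes "root_divergent m" "t > 0"
  shows "h_fun m t > 0"
  using h_fun_attained[OF assms] root_divergentD[OF assms(1)] assms(2)
  by (metis mult_pos_pos zero_less_power)

lemma h_fun_ge:
  assumes "root_divergent m" "t > 0" "\<And>k. c \<le> m k * t ^ k"
  shows "c \<le> h_fun m t"
  using h_fun_attained[OF assms(1,2)] assms(3) by metis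

lemma h_fun_nonneg:
  assumes "root_divergent m" "t \<ge> 0"
  shows "h_fun m t \<ge> 0"
  using h_fun_pos[OF assms(1), of t] assms(2) by (cases "t = 0") (auto simp: h_fun_def)

lemma h_fun_mono:
  assumes "root_divergent m" "0 \<le> s" "s \<le> t"
  shows "h_fun m s \<le> h_fun m t"
proof (cases "s = 0")
  case True
  then show ?thesis using h_fun_nonneg[OF assms(1), of t] assms by (simp add: h_fun_def)
next
  case False
  then have "t > 0" using assms by simp
  show ?thesis
  proof (rule h_fun_ge[OF assms(1) \<open>t > 0\<close>])
    fix k
    have "h_fun m s \<le> m k * s ^ k" using assms by (intro h_fun_le)
    also have "\<dots> \<le> m k * t ^ k"
      using assms root_divergentD(1)[OF assms(1), of k] by (intro mult_left_mono power_mono) auto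
    finally show "h_fun m s \<le> m k * t ^ k" .
  qed
qed

text \<open>Quotients below \<open>1 / t\<close> throughout would bound \<open>m k\<close> by the
  geometric sequence \<open>(1 / t) ^ k\<close>. This gives meaning to the \<open>LEAST\<close> in
  \<open>Gamma_lower\<close>.\<close>

lemma Gamma_lower_exists:
  assumes m: "root_divergent m" and t: "t > 0"
  shows "\<exists>k. m (Suc k) / m k \<ge> 1 / t"
proof (rule ccontr)
  assume "\<not> ?thesis"
  then have "m (Suc k) / m k < 1 / t" for k by (auto simp: not_le)
  then have lt: "m (Suc k) < (1 / t) * m k" for k
    by (metis root_divergentD(1)[OF m] pos_divide_less_eq)
  have le: "m k \<le> (1 / t) ^ k" for k
  proof (induction k)
    case 0
    then show ?case using root_divergentD[OF m] by simp
  next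
    case (Suc k)
    have "m (Suc k) \<le> (1 / t) * m k" using lt[of k] by simp
    also have "\<dots> \<le> (1 / t) * (1 / t) ^ k" using Suc t by (intro mult_left_mono) auto
    finally show ?case by simp
  qed
  have "eventually (\<lambda>k. (2 / t) ^ k \<le> m k) sequentially"
    using m t by (intro eventually_power_le_root_divergent) auto
  then obtain k where k: "k > 0" "(2 / t) ^ k \<le> m k"
    using eventually_conj[OF _ eventually_gt_at_top[of 0]] eventually_happens
    by (metis (no_types, lifting) eventually_sequentially le_add2 less_Suc_eq_le plus_1_eq_Suc
        nat_le_linear order_le_less_trans zero_less_Suc)
  then have "(2 / t) ^ k \<le> (1 / t) ^ k" using le[of k] by simp
  then have "(2::real) ^ k \<le> 1" using t by (simp add: power_divide field_simps)
  moreover have "(2::real) ^ k > 1" using k by (intro one_less_power) auto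
  ultimately show False by simp
qed

lemma Gamma_lower_less:
  assumes m: "root_divergent m" and t: "t > 0" and "j < Gamma_lower m t"
  shows "m (Suc j) * t < m j"
  using not_less_Least[of j "\<lambda>k. m (Suc k) / m k \<ge> 1 / t"] assms(3) root_divergentD(1)[OF m, of j] t
  unfolding Gamma_lower_def by (auto simp: not_le field_simps)

lemma Gamma_lower_antimono:
  assumes m: "root_divergent m" and "0 < s" "s \<le> t"
  shows "Gamma_lower m t \<le> Gamma_lower m s"
  unfolding Gamma_lower_def
proof (rule Least_le)
  have "1 / s \<le> m (Suc (LEAST k. 1 / s \<le> m (Suc k) / m k)) / m (LEAST k. 1 / s \<le> m (Suc k) / m k)"
    using Gamma_lower_exists[OF m assms(2)] by (rule LeastI_ex)
  moreover have "1 / t \<le> 1 / s" using assms by (simp add: frac_le)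
  ultimately show "1 / t \<le> m (Suc (LEAST k. 1 / s \<le> m (Suc k) / m k)) / m (LEAST k. 1 / s \<le> m (Suc k) / m k)"
    by linarith
qed

text \<open>Below \<open>Gamma_lower m t\<close> every quotient of consecutive terms is less than 1.
  Beyond that index nothing is claimed, since the quotients of \<open>m\<close> need not be
  monotone.\<close>

lemma Gamma_lower_terms_antimono:
  assumes m: "root_divergent m" and t: "t > 0" and "i \<le> j" "j \<le> Gamma_lower m t"
  shows "m j * t ^ j \<le> m i * t ^ i"
  using assms(3,4)
proof (induction rule: dec_induct)
  case (step j)
  have "m (Suc j) * t ^ Suc j = (m (Suc j) * t) * t ^ j" by simp
  also have "\<dots> \<le> m j * t ^ j"
    using Gamma_lower_less[OF m t, of j] step t by (intro mult_right_mono) auto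
  finally show ?case using step by simp
qed simp

text \<open>The quotients of index below \<open>K\<close> are finitely many, hence bounded, and
  \<open>1 / t\<close> exceeds them for small \<open>t\<close>. The case \<open>K = 3\<close> leaves
  room for Taylor polynomials of degree at least 2 and for a comparison with the term of order
  2.\<close>

lemma Gamma_lower_large:
  assumes m: "root_divergent m"
  shows "\<exists>t0>0. \<forall>t. 0 < t \<and> t \<le> t0 \<longrightarrow> K \<le> Gamma_lower m t"
proof -
  define S where "S = insert 1 ((\<lambda>j. m (Suc j) / m j) ` {..<K})"
  have S: "finite S" "S \<noteq> {}" by (auto simp: S_def)
  then have pos: "Max S \<ge> 1" by (auto simp: S_def Max_ge)
  have *: "K \<le> Gamma_lower m t" if t: "0 < t" "t \<le> 1 / (Max S + 1)" for t
  proof (rule ccontr)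
    assume "\<not> ?thesis"
    then have lt: "Gamma_lower m t < K" by simp
    have "1 / t \<le> m (Suc (Gamma_lower m t)) / m (Gamma_lower m t)"
      unfolding Gamma_lower_def by (rule LeastI_ex) (rule Gamma_lower_exists[OF m t(1)])
    also have "\<dots> \<le> Max S" using lt S by (intro Max_ge) (auto simp: S_def)
    also have "\<dots> < Max S + 1" by simp
    also have "\<dots> \<le> 1 / t" using t pos by (simp add: field_simps)
    finally show False by simp
  qed
  show ?thesis by (rule exI[of _ "1 / (Max S + 1)"]) (use pos * in auto)
qed

lemma Gamma_upper_minimizer:
  assumes "root_divergent m" "t > 0"
  shows "m (Gamma_upper m t) * t ^ Gamma_upper m t = h_fun m t"
proof -
  have "\<exists>k. h_fun m t = m k * t ^ k" using h_fun_attained[OF assms] by metis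
  from LeastI_ex[OF this] show ?thesis unfolding Gamma_upper_def by simp
qed

text \<open>The indices \<open>k = Gamma_upper n t\<close> are the vertices of the Newton polygon of \<open>n\<close>.
  The induction passes from a vertex \<open>k\<close> to the preceding vertex \<open>k'\<close>, along the edge of slope
  \<open>s'\<close> joining them; the regularity condition controls \<open>m\<close> along that edge.\<close>

lemma Gamma_domination_vertex:
  assumes m: "root_divergent m" and n: "root_divergent n" and C: "C \<ge> 1"
    and Gam: "\<And>t. t > 0 \<Longrightarrow> Gamma_upper n (C * t) \<le> Gamma_lower m t"
  shows "s > 0 \<Longrightarrow> Gamma_upper n s = k \<Longrightarrow> m k \<le> C ^ k * n k"
proof (induction k arbitrary: s rule: less_induct)
  case (less k)
  note mpos = root_divergentD[OF m] and npos = root_divergentD[OF n]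
  show ?case
  proof (cases "k = 0")
    case True
    then show ?thesis using mpos npos by simp
  next
    case False
    \<comment> \<open>\<open>P j\<close> is the abscissa where the terms of index \<open>j\<close>
      and \<open>k\<close> coincide; to its left the term of index \<open>k\<close> is the smaller
      one. So \<open>s'\<close> is the last parameter at which \<open>k\<close> is still a
      minimiser.\<close>
    define P where "P = (\<lambda>j. (n j / n k) powr (1 / (k - j)))"
    define s' where "s' = Min (P ` {..<k})"
    have fin: "finite (P ` {..<k})" "P ` {..<k} \<noteq> {}" using False by auto
    have Ppos: "P j > 0" for j using npos by (auto simp: P_def less_imp_neq[symmetric])
    have s'pos: "s' > 0" using fin Ppos by (auto simp: s'_def)
    have s'le: "s' \<le> P j" if "j < k" for j using fin that by (auto simp: s'_def)
    have Ppow: "P j ^ (k - j) = n j / n k" if "j < k" for j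
    proof -
      have "P j ^ (k - j) = P j powr (k - j)" using Ppos by (simp add: powr_realpow)
      also have "\<dots> = n j / n k" using that npos(1)[of j] npos(1)[of k]
        by (auto simp: P_def powr_powr of_nat_diff intro!: powr_one less_imp_le)
      finally show ?thesis .
    qed
    have split: "u ^ k = u ^ j * u ^ (k - j)" if "j < k" for j and u :: real
      using that by (simp flip: power_add)
    have minim: "n k * u ^ k < n j * u ^ j" if "0 < u" "u < P j" "j < k" for u j
    proof -
      have "u ^ (k - j) < P j ^ (k - j)" using that by (intro power_strict_mono) auto
      then have "n k * u ^ (k - j) < n j" using npos(1)[of k] that by (simp add: Ppow field_simps)
      then show ?thesis using that split[of j u] by (simp add: mult.assoc mult.left_commute)
    qed
    have eqP: "n k * u ^ k = n j * u ^ j" if "u = P j" "j < k" for u j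
      using that split[of j u] npos(1)[of k] by (simp add: Ppow field_simps)
    \<comment> \<open>\<open>Gamma_upper\<close> picks the least minimiser, so the least index that
      ties with \<open>k\<close> at \<open>s'\<close> has to be taken.\<close>
    define k' where "k' = (LEAST j. j < k \<and> P j = s')"
    have "s' \<in> P ` {..<k}" unfolding s'_def using fin by (rule Min_in)
    then have "\<exists>j. j < k \<and> P j = s'" by auto
    from LeastI_ex[OF this] have k': "k' < k" "P k' = s'" by (auto simp: k'_def)
    have k'least: "P j \<noteq> s'" if "j < k'" for j
      using not_less_Least[of j "\<lambda>j. j < k \<and> P j = s'"] that k' unfolding k'_def by auto
    have k'val: "n k * s' ^ k = n k' * s' ^ k'" using eqP k' by auto
    have s_min: "n k * s ^ k \<le> n i * s ^ i" for i
      using Gamma_upper_minimizer[OF n less.prems(1)] less.prems(2) h_fun_le[OF n, of s i] less.prems(1)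
      by simp
    have "s \<le> s'"
    proof -
      have "s \<le> P j" if "j < k" for j
      proof (rule ccontr)
        assume "\<not> ?thesis"
        then have "P j ^ (k - j) < s ^ (k - j)" using that Ppos[of j] by (intro power_strict_mono) auto
        then have "n j < n k * s ^ (k - j)" using npos(1)[of k] that by (simp add: Ppow field_simps)
        then have "n j * s ^ j < n k * s ^ k"
          using that split[of j s] less.prems(1) by (simp add: mult.assoc mult.left_commute)
        then show False using s_min[of j] by simp
      qed
      then show ?thesis using fin by (auto simp: s'_def)
    qed
    have min': "n k' * s' ^ k' \<le> n i * s' ^ i" for i
    proof (cases "i < k")
      case True
      have "n k * s' ^ k \<le> n i * s' ^ i"
        using minim[of s' i] eqP[of s' i] s'le[OF True] True s'pos by fastforce
      then show ?thesis using k'val by simp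
    next
      case False
      \<comment> \<open>For exponents \<open>i \<ge> k\<close> minimality at \<open>s\<close>
        persists: the factor \<open>s' / s\<close> is at least 1, so raising the parameter favours
        the smaller exponent.\<close>
      have "n k * s' ^ k = (n k * s ^ k) * (s' / s) ^ k"
        using less.prems(1) by (simp add: power_divide)
      also have "\<dots> \<le> (n i * s ^ i) * (s' / s) ^ k"
        using s_min[of i] s'pos less.prems(1) by (intro mult_right_mono) auto
      also have "\<dots> \<le> (n i * s ^ i) * (s' / s) ^ i"
        using npos(1)[of i] less.prems(1) \<open>s \<le> s'\<close> False
        by (intro mult_left_mono power_increasing) auto
      also have "\<dots> = n i * s' ^ i" using less.prems(1) by (simp add: power_divide)
      finally show ?thesis using k'val by simp
    qed
    have h': "h_fun n s' = n k' * s' ^ k'"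
      using h_fun_ge[OF n s'pos min'] h_fun_le[OF n, of s' k'] s'pos by simp
    have Gk': "Gamma_upper n s' = k'"
      unfolding Gamma_upper_def
    proof (rule Least_equality)
      show "h_fun n s' = n k' * s' ^ k'" by (rule h')
      fix j assume j: "h_fun n s' = n j * s' ^ j"
      show "k' \<le> j"
      proof (rule ccontr)
        assume "\<not> k' \<le> j"
        then have "j < k'" by simp
        then have "s' < P j" using s'le[of j] k'least[of j] k' by fastforce
        then have "n k * s' ^ k < n j * s' ^ j" using minim[of s' j] s'pos \<open>j < k'\<close> k' by simp
        then show False using j h' k'val by simp
      qed
    qed
    have IH: "m k' \<le> C ^ k' * n k'" using less.IH[OF k'(1) s'pos Gk'] .
    \<comment> \<open>For \<open>u < s'\<close> every minimiser of \<open>n\<close> has index at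
      least \<open>k\<close>; the regularity condition at \<open>u / C\<close> then puts
      \<open>j\<close> below \<open>Gamma_lower\<close>, which bounds the quotient of
      \<open>m\<close> at \<open>j\<close> by \<open>C / u\<close>.\<close>
    have step: "m (Suc j) * s' \<le> C * m j" if "j < k" for j
    proof -
      have ev: "m (Suc j) * u \<le> C * m j" if u: "0 < u" "u < s'" for u
      proof -
        have "k \<le> Gamma_upper n u"
        proof (rule ccontr)
          assume "\<not> ?thesis"
          then have lt: "Gamma_upper n u < k" by simp
          have "n k * u ^ k < h_fun n u"
            using minim[OF u(1) _ lt] s'le[OF lt] u Gamma_upper_minimizer[OF n u(1)] by simp
          then show False using h_fun_le[OF n, of u k] u by simp
        qed
        also have "\<dots> \<le> Gamma_lower m (u / C)" using Gam[of "u / C"] u C by simp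
        finally have "j < Gamma_lower m (u / C)" using \<open>j < k\<close> by simp
        from Gamma_lower_less[OF m _ this] u C show ?thesis by (simp add: field_simps)
      qed
      show ?thesis
      \<comment> \<open>At \<open>s'\<close> itself \<open>Gamma_upper n\<close> has dropped to
        \<open>k'\<close>, so the bound there is obtained as a limit from the left.\<close>
      proof (rule tendsto_upperbound)
        show "((\<lambda>u. m (Suc j) * u) \<longlongrightarrow> m (Suc j) * s') (at_left s')"
          by (intro tendsto_intros)
        show "eventually (\<lambda>u. m (Suc j) * u \<le> C * m j) (at_left s')"
          using eventually_at_left_real[OF s'pos] by eventually_elim (use ev in auto)
      qed simp
    qed
    \<comment> \<open>The quotient bounds are multiplied along the edge from \<open>k'\<close> to
      \<open>k\<close>; the tie \<open>k'val\<close> then converts \<open>n k'\<close> into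
      \<open>n k\<close>.\<close>
    have "m (k' + i) * s' ^ i \<le> C ^ i * m k'" if "k' + i \<le> k" for i
      using that
    proof (induction i)
      case (Suc i)
      have "m (k' + Suc i) * s' ^ Suc i = (m (Suc (k' + i)) * s') * s' ^ i" by simp
      also have "\<dots> \<le> (C * m (k' + i)) * s' ^ i"
        using step[of "k' + i"] Suc s'pos by (intro mult_right_mono) auto
      also have "\<dots> = C * (m (k' + i) * s' ^ i)" by simp
      also have "\<dots> \<le> C * (C ^ i * m k')" using Suc C by (intro mult_left_mono) auto
      finally show ?case by simp
    qed simp
    from this[of "k - k'"] k'(1) have "m k * s' ^ (k - k') \<le> C ^ (k - k') * m k'" by simp
    also have "\<dots> \<le> C ^ (k - k') * (C ^ k' * n k')" using IH C by (intro mult_left_mono) auto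
    also have "\<dots> = C ^ k * n k'" using k'(1) by (simp flip: power_add mult.assoc)
    also have "n k' = n k * s' ^ (k - k')"
      using k'val split[OF k'(1), of s'] s'pos by simp
    finally show ?thesis using s'pos by simp
  qed
qed

text \<open>The comparison passes through the index \<open>Gamma_upper n (C * t)\<close>: by
  \<open>Gam\<close> it is at most \<open>Gamma_lower m t\<close>, so the terms of \<open>m\<close>
  descend from it, and at this vertex \<open>m\<close> is dominated by \<open>C ^ k * n k\<close>.
  An inequality between indices becomes one between values.\<close>

lemma Gamma_domination:
  assumes m: "root_divergent m" and n: "root_divergent n" and C: "C \<ge> 1"
    and Gam: "\<And>t. t > 0 \<Longrightarrow> Gamma_upper n (C * t) \<le> Gamma_lower m t" and t: "t > 0"
  shows "m (Gamma_lower m t) * t ^ Gamma_lower m t \<le> h_fun n (C * t)"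
proof -
  let ?k = "Gamma_upper n (C * t)"
  have Ct: "C * t > 0" using C t by simp
  have "m (Gamma_lower m t) * t ^ Gamma_lower m t \<le> m ?k * t ^ ?k"
    using Gam[OF t] by (intro Gamma_lower_terms_antimono[OF m t]) auto
  also have "\<dots> \<le> (C ^ ?k * n ?k) * t ^ ?k"
    using Gamma_domination_vertex[OF m n C Gam Ct refl] t by (intro mult_right_mono) auto
  also have "\<dots> = n ?k * (C * t) ^ ?k" by (simp add: power_mult_distrib)
  also have "\<dots> = h_fun n (C * t)" by (rule Gamma_upper_minimizer[OF n Ct])
  finally show ?thesis .
qed

text \<open>Testing the infimum for \<open>n\<close> at index \<open>k + 1\<close> gains one power
  of \<open>t\<close>, which pays for the division. This absorbs the factor
  \<open>1 / \<delta> k\<close> from derivatives of bumps.\<close>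

lemma h_fun_divide_le:
  assumes n: "root_divergent n" and n': "root_divergent n'" and C: "C \<ge> 1"
    and le: "\<And>j. n (Suc j) \<le> C ^ Suc j * n' j" and t: "t > 0"
  shows "h_fun n t / t \<le> C * h_fun n' (C * t)"
proof -
  have "h_fun n t / t / C \<le> h_fun n' (C * t)"
  proof (rule h_fun_ge[OF n'])
    fix k
    have "h_fun n t \<le> n (Suc k) * t ^ Suc k" using n t by (intro h_fun_le) auto
    also have "\<dots> \<le> (C ^ Suc k * n' k) * t ^ Suc k" using le t by (intro mult_right_mono) auto
    finally show "h_fun n t / t / C \<le> n' k * (C * t) ^ k"
      using C t by (simp add: field_simps power_mult_distrib)
  qed (use C t in auto)
  then have "C * (h_fun n t / t / C) \<le> C * h_fun n' (C * t)" using C by (intro mult_left_mono) auto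
  then show ?thesis using C by simp
qed

section \<open>Consequences of R-regularity\<close>

lemma R_regular_root_divergent:
  "R_regular \<MM> \<Longrightarrow> M \<in> \<MM> \<Longrightarrow> root_divergent (small_seq M)"
  by (auto simp: R_regular_def weight_matrix_def root_divergent_def small_seq_pos small_seq_0)

text \<open>Condition (1) is iterated. It is applied with \<open>r = 2 * n - 1\<close>, the order of
  the Bochner--Martinelli singularity.\<close>

lemma R_regular_shift:
  assumes R: "R_regular \<MM>" and M: "M \<in> \<MM>"
  shows "\<exists>N\<in>\<MM>. \<exists>C\<ge>1. \<forall>j. M (j + r) \<le> C ^ Suc j * N j"
proof (induction r)
  case 0
  have "\<forall>j. M (j + 0) \<le> 1 ^ Suc j * M j" by simp
  then show ?case using M by (intro bexI[of _ M] exI[of _ 1]) auto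
next
  case (Suc r)
  then obtain N C where N: "N \<in> \<MM>" "C \<ge> 1" "\<And>j. M (j + r) \<le> C ^ Suc j * N j" by auto
  from R N obtain N' C' where N': "N' \<in> \<MM>" "C' \<ge> 1" "\<And>j. N (Suc j) \<le> C' ^ Suc j * N' j"
    unfolding R_regular_def by metis
  have pos: "N' j \<ge> 0" for j
    using R N'(1) by (auto simp: R_regular_def weight_matrix_def weight_sequence_def less_imp_le)
  have "M (j + Suc r) \<le> (C\<^sup>2 * C') ^ Suc j * N' j" for j
  proof -
    have "M (j + Suc r) = M (Suc j + r)" by simp
    also have "\<dots> \<le> C ^ Suc (Suc j) * N (Suc j)" by (rule N)
    also have "\<dots> \<le> C ^ Suc (Suc j) * (C' ^ Suc j * N' j)"
      using N N' by (intro mult_left_mono) auto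
    \<comment> \<open>The exponent \<open>j + 2\<close> is enlarged to twice \<open>j + 1\<close>,
      hence the square on \<open>C\<close> in the new constant.\<close>
    also have "\<dots> \<le> C ^ (2 * Suc j) * (C' ^ Suc j * N' j)"
      using N N' pos by (intro mult_right_mono power_increasing) auto
    finally show ?thesis by (simp only: power_mult power_mult_distrib mult.assoc)
  qed
  moreover have "C\<^sup>2 * C' \<ge> 1"
    using N N' mult_mono[of 1 "C\<^sup>2" 1 C'] by (simp add: one_le_power)
  ultimately show ?case using N' by blast
qed

section \<open>Taylor polynomials and change of base point\<close>

text \<open>The mean value theorem in the direction \<open>u\<close> is applied to the increment of
  \<open>f\<close> in the direction \<open>v\<close>. The resulting difference of
  \<open>\<lambda>y. f' y u\<close> at two points is evaluated by its linearisation at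
  \<open>x\<close>, so differentiability at this single point suffices.\<close>

lemma second_difference_limit:
  fixes f :: "'a::real_normed_vector \<Rightarrow> real"
  assumes S: "open S" "x \<in> S"
    and f': "\<And>y. y \<in> S \<Longrightarrow> (f has_derivative f' y) (at y)"
    and A: "((\<lambda>y. f' y u) has_derivative A) (at x)"
  shows "((\<lambda>t. (f (x + t *\<^sub>R u + t *\<^sub>R v) - f (x + t *\<^sub>R u) - f (x + t *\<^sub>R v) + f x) / t\<^sup>2)
           \<longlongrightarrow> A v) (at_right 0)"
proof (rule tendstoI)
  fix e :: real assume e: "e > 0"
  \<comment> \<open>The two points compared lie within \<open>t * (norm u + norm v)\<close> and
    \<open>t * norm u\<close> of \<open>x\<close>; \<open>c\<close> bounds the sum of these
    distances divided by \<open>t\<close>, and the 1 keeps it positive.\<close>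
  define c where "c = 2 * norm u + norm v + 1"
  have c: "c \<ge> 1" by (simp add: c_def)
  interpret A: bounded_linear A by (rule has_derivative_bounded_linear[OF A])
  have "e / (2 * c) > 0" using e c by simp
  from A[unfolded has_derivative_at_alt, THEN conjunct2, rule_format, OF this]
  obtain d where d: "d > 0" and
    dA: "\<And>y. norm (y - x) < d \<Longrightarrow> \<bar>f' y u - f' x u - A (y - x)\<bar> \<le> e / (2 * c) * norm (y - x)"
    by auto
  obtain r where r: "r > 0" "ball x r \<subseteq> S" using S open_contains_ball by blast
  define t0 where "t0 = min d r / c"
  have t0: "t0 > 0" using d r c by (simp add: t0_def)
  have ev: "eventually (\<lambda>t. t \<in> {0<..<t0}) (at_right 0)"
    by (rule eventually_at_right_real[OF t0])
  then show "\<forall>\<^sub>F t in at_right 0.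
     dist ((f (x + t *\<^sub>R u + t *\<^sub>R v) - f (x + t *\<^sub>R u) - f (x + t *\<^sub>R v) + f x) / t\<^sup>2) (A v) < e"
  proof eventually_elim
    case (elim t)
    then have t: "0 < t" "t * c < min d r" using c by (auto simp: t0_def field_simps)
    have nrm: "norm (s *\<^sub>R u + t' *\<^sub>R v) \<le> t * (norm u + norm v)"
      if "0 \<le> s" "s \<le> t" "0 \<le> t'" "t' \<le> t" for s t'
    proof -
      have "norm (s *\<^sub>R u + t' *\<^sub>R v) \<le> s * norm u + t' * norm v"
        using norm_triangle_ineq[of "s *\<^sub>R u" "t' *\<^sub>R v"] that by simp
      also have "\<dots> \<le> t * norm u + t * norm v"
        using that by (intro add_mono mult_right_mono) auto
      finally show ?thesis by (simp add: algebra_simps)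
    qed
    have small: "t * (norm u + norm v) < min d r"
    proof -
      have "t * (norm u + norm v) \<le> t * c" using t by (intro mult_left_mono) (auto simp: c_def)
      then show ?thesis using t by linarith
    qed
    have inS: "x + s *\<^sub>R u + t' *\<^sub>R v \<in> S" if "0 \<le> s" "s \<le> t" "0 \<le> t'" "t' \<le> t" for s t'
    proof -
      have "norm (s *\<^sub>R u + t' *\<^sub>R v) < r" using nrm[OF that] small by simp
      then have "dist x (x + s *\<^sub>R u + t' *\<^sub>R v) < r"
        by (metis add.assoc add_diff_cancel_left' dist_commute dist_norm)
      then show ?thesis using r by (auto simp: subset_eq)
    qed
    define \<phi> where "\<phi> s = f (x + s *\<^sub>R u + t *\<^sub>R v) - f (x + s *\<^sub>R u + 0 *\<^sub>R v)" for s
    have der: "(\<phi> has_real_derivative (f' (x + s *\<^sub>R u + t *\<^sub>R v) u - f' (x + s *\<^sub>R u + 0 *\<^sub>R v) u)) (at s)"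
      if "0 \<le> s" "s \<le> t" for s
    proof -
      have *: "((\<lambda>s. f (x + s *\<^sub>R u + t' *\<^sub>R v)) has_real_derivative f' (x + s *\<^sub>R u + t' *\<^sub>R v) u) (at s)"
        if t': "0 \<le> t'" "t' \<le> t" for t'
      proof -
        have "((\<lambda>s. x + s *\<^sub>R u + t' *\<^sub>R v) has_derivative (\<lambda>h. h *\<^sub>R u)) (at s)"
          by (auto intro!: derivative_eq_intros)
        from has_derivative_compose[OF this f'[OF inS[OF \<open>0 \<le> s\<close> \<open>s \<le> t\<close> t']]]
        have "((\<lambda>s. f (x + s *\<^sub>R u + t' *\<^sub>R v)) has_derivative
                (\<lambda>h. f' (x + s *\<^sub>R u + t' *\<^sub>R v) (h *\<^sub>R u))) (at s)" .
        moreover have "(\<lambda>h. f' (x + s *\<^sub>R u + t' *\<^sub>R v) (h *\<^sub>R u)) = (*) (f' (x + s *\<^sub>R u + t' *\<^sub>R v) u)"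
          using has_derivative_linear[OF f'[OF inS[OF \<open>0 \<le> s\<close> \<open>s \<le> t\<close> t']]]
          by (auto simp: linear_scale fun_eq_iff)
        ultimately show ?thesis by (simp add: has_field_derivative_def)
      qed
      show ?thesis unfolding \<phi>_def using *[of t] *[of 0] t by (intro DERIV_diff) auto
    qed
    obtain \<xi> where \<xi>: "0 < \<xi>" "\<xi> < t" and
      mv: "\<phi> t - \<phi> 0 = (t - 0) * (f' (x + \<xi> *\<^sub>R u + t *\<^sub>R v) u - f' (x + \<xi> *\<^sub>R u + 0 *\<^sub>R v) u)"
      using MVT2[OF t(1) der] by auto
    define y1 where "y1 = x + \<xi> *\<^sub>R u + t *\<^sub>R v"
    define y0 where "y0 = x + \<xi> *\<^sub>R u + 0 *\<^sub>R v"
    have n1: "norm (y1 - x) \<le> t * (norm u + norm v)"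
      using nrm[of \<xi> t] \<xi> by (simp add: y1_def add.assoc)
    have n0: "norm (y0 - x) \<le> t * norm u"
      using \<xi> by (auto simp: y0_def intro!: mult_right_mono)
    have n0': "norm (y0 - x) \<le> t * (norm u + norm v)"
      using n0 t by (simp add: algebra_simps add_increasing2)
    have Av: "A (y1 - x) - A (y0 - x) = t * A v"
      by (simp add: y1_def y0_def A.add A.scaleR add.assoc)
    have "\<bar>f' y1 u - f' y0 u - t * A v\<bar> =
        \<bar>(f' y1 u - f' x u - A (y1 - x)) - (f' y0 u - f' x u - A (y0 - x))\<bar>"
      using Av by simp
    also have "\<dots> \<le> e / (2 * c) * norm (y1 - x) + e / (2 * c) * norm (y0 - x)"
      using dA[of y1] dA[of y0] n1 n0' small by linarith
    also have "\<dots> \<le> e / (2 * c) * (t * (norm u + norm v)) + e / (2 * c) * (t * norm u)"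
      using e c n1 n0 by (intro add_mono mult_left_mono) auto
    also have "\<dots> = e / (2 * c) * (t * (2 * norm u + norm v))" by (simp add: algebra_simps)
    also have "\<dots> \<le> e / (2 * c) * (t * c)"
      using e c t by (intro mult_left_mono) (auto simp: c_def)
    also have "\<dots> = t * (e / 2)" using c by simp
    finally have main: "\<bar>f' y1 u - f' y0 u - t * A v\<bar> \<le> t * (e / 2)" .
    have \<phi>_diff: "\<phi> t - \<phi> 0 = f (x + t *\<^sub>R u + t *\<^sub>R v) - f (x + t *\<^sub>R u) - f (x + t *\<^sub>R v) + f x"
      by (simp add: \<phi>_def)
    have "(\<phi> t - \<phi> 0) / t\<^sup>2 - A v = (f' y1 u - f' y0 u - t * A v) / t"
    proof -
      have "t * X / t\<^sup>2 - A v = (X - t * A v) / t" for X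
        using t by (simp add: power2_eq_square field_simps)
      then show ?thesis using mv by (simp add: y1_def y0_def)
    qed
    with main have "\<bar>(\<phi> t - \<phi> 0) / t\<^sup>2 - A v\<bar> \<le> e / 2"
      using t by (simp only: abs_divide) (simp add: pos_divide_le_eq mult.commute)
    then have "\<bar>(f (x + t *\<^sub>R u + t *\<^sub>R v) - f (x + t *\<^sub>R u) - f (x + t *\<^sub>R v) + f x) / t\<^sup>2 - A v\<bar> \<le> e / 2"
      by (simp only: \<phi>_diff)
    then show ?case using e by (simp add: dist_real_def)
  qed
qed

text \<open>The second difference is symmetric in \<open>u\<close> and \<open>v\<close>, so the two
  limits coincide. This form of the symmetry theorem suits \<open>smooth_on\<close>, which speaks of
  differentiability of all iterated partials.\<close>

lemma symmetric_second_derivative: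
  fixes f :: "'a::real_normed_vector \<Rightarrow> real"
  assumes S: "open S" "x \<in> S"
    and f': "\<And>y. y \<in> S \<Longrightarrow> (f has_derivative f' y) (at y)"
    and A: "((\<lambda>y. f' y u) has_derivative A) (at x)"
    and B: "((\<lambda>y. f' y v) has_derivative B) (at x)"
  shows "A v = B u"
proof -
  note 1 = second_difference_limit[OF S f' A, of v] and 2 = second_difference_limit[OF S f' B, of u]
  have "((\<lambda>t. (f (x + t *\<^sub>R u + t *\<^sub>R v) - f (x + t *\<^sub>R u) - f (x + t *\<^sub>R v) + f x) / t\<^sup>2)
           \<longlongrightarrow> B u) (at_right 0)"
    using 2 by (simp add: algebra_simps)
  with 1 show ?thesis using tendsto_unique[OF trivial_limit_at_right_real] by blast
qed

section \<open>Iterated partial derivatives on open sets\<close>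

lemma frechet_derivative_cong:
  assumes "open U" "x \<in> U" "\<And>y. y \<in> U \<Longrightarrow> f y = g y"
  shows "frechet_derivative f (at x) = frechet_derivative g (at x)"
proof -
  have "(f has_derivative D) (at x) \<longleftrightarrow> (g has_derivative D) (at x)" for D
    using has_derivative_transform_within_open[OF _ assms(1,2)] assms(3) by metis
  then show ?thesis by (simp add: frechet_derivative_def)
qed

lemma differentiable_cong:
  assumes "open U" "x \<in> U" "\<And>y. y \<in> U \<Longrightarrow> f y = g y"
  shows "f differentiable at x \<longleftrightarrow> g differentiable at x"
  unfolding differentiable_def
  using has_derivative_transform_within_open[OF _ assms(1,2)] assms(3) by metis

lemma dpart_cong:
  assumes "open U" "\<And>y. y \<in> U \<Longrightarrow> f y = g y" "x \<in> U"
  shows "dpart is f x = dpart is g x"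
  using assms(3)
proof (induction "is" arbitrary: x)
  case (Cons i "is")
  then show ?case using frechet_derivative_cong[OF assms(1) Cons.prems, of "dpart is f" "dpart is g"] by simp
qed (use assms in auto)

lemma dpart_append: "dpart (xs @ ys) f = dpart xs (dpart ys f)"
  by (induction xs) auto

lemma vec_eq_sum_axis: "(h::real^'n) = (\<Sum>l\<in>UNIV. (h $ l) *\<^sub>R axis l 1)"
  using basis_expansion[of h] by (simp add: scalar_mult_eq_scaleR)

lemma smooth_on_has_derivative:
  assumes "smooth_on U f" "x \<in> U"
  shows "(dpart is f has_derivative (\<lambda>h. \<Sum>l\<in>UNIV. h $ l * dpart (l # is) f x)) (at x)"
proof -
  have d: "(dpart is f has_derivative frechet_derivative (dpart is f) (at x)) (at x)"
    using assms by (simp add: smooth_on_def frechet_derivative_works[THEN iffD1])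
  interpret bounded_linear "frechet_derivative (dpart is f) (at x)"
    by (rule has_derivative_bounded_linear[OF d])
  have "frechet_derivative (dpart is f) (at x) h = (\<Sum>l\<in>UNIV. h $ l * dpart (l # is) f x)" for h
    by (subst vec_eq_sum_axis[of h]) (simp add: sum scaleR)
  then have "frechet_derivative (dpart is f) (at x) = (\<lambda>h. \<Sum>l\<in>UNIV. h $ l * dpart (l # is) f x)" ..
  with d show ?thesis by (simp only:)
qed

text \<open>Symmetry of second derivatives gives an identity on the open set \<open>U\<close>, where
  it may be differentiated further along \<open>xs\<close>. Lists of directions can thus play the
  role of multi-indices.\<close>

lemma dpart_swap:
  assumes U: "open U" and f: "smooth_on U f" and x: "x \<in> U"
  shows "dpart (xs @ i # j # is) f x = dpart (xs @ j # i # is) f x"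
proof -
  have *: "dpart (i # j # is) f x = dpart (j # i # is) f x" if x: "x \<in> U" for x
  proof -
    let ?g = "dpart is f"
    have d: "\<And>y. y \<in> U \<Longrightarrow> (?g has_derivative frechet_derivative ?g (at y)) (at y)"
      using f by (simp add: smooth_on_def frechet_derivative_works[THEN iffD1])
    have d2: "((\<lambda>y. frechet_derivative ?g (at y) (axis l 1)) has_derivative
               frechet_derivative (dpart (l # is) f) (at x)) (at x)" for l
      using f x unfolding smooth_on_def dpart.simps(2)[symmetric]
      by (intro frechet_derivative_works[THEN iffD1]) blast
    have "frechet_derivative (dpart (j # is) f) (at x) (axis i 1) =
          frechet_derivative (dpart (i # is) f) (at x) (axis j 1)"
      by (rule symmetric_second_derivative[OF U x d d2 d2])
    then show ?thesis by simp
  qed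
  then show ?thesis unfolding dpart_append using dpart_cong[OF U _ x, of "dpart (i # j # is) f"] by blast
qed

text \<open>\<open>hom_taylor f a z k is\<close> is the \<open>k\<close>-th differential of \<open>dpart is f\<close> at \<open>a\<close>, extended complex
  multilinearly and evaluated at \<open>(z - a, \<dots>, z - a)\<close>; no multi-index factorials occur because one sums over
  lists of directions.\<close>

primrec hom_taylor :: "(real^'n \<Rightarrow> real) \<Rightarrow> real^'n \<Rightarrow> complex^'n \<Rightarrow> nat \<Rightarrow> 'n list \<Rightarrow> complex" where
  "hom_taylor f a z 0 is = complex_of_real (dpart is f a)"
| "hom_taylor f a z (Suc k) is =
     (\<Sum>i\<in>UNIV. (z $ i - complex_of_real (a $ i)) * hom_taylor f a z k (i # is))"

lemma hom_taylor_swap: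
  assumes "open U" "smooth_on U f" "a \<in> U"
  shows "hom_taylor f a z k (xs @ i # j # is) = hom_taylor f a z k (xs @ j # i # is)"
proof (induction k arbitrary: xs)
  case 0
  then show ?case using dpart_swap[OF assms] by simp
next
  case (Suc k)
  have "hom_taylor f a z k (l # xs @ i # j # is) = hom_taylor f a z k (l # xs @ j # i # is)" for l
    using Suc[of "l # xs"] by simp
  then show ?case by simp
qed

lemmas hom_taylor_swap0 = hom_taylor_swap[where xs = "[]", simplified]

text \<open>Product rule: a derivative falling on the coefficients adds the direction
  \<open>l\<close>, one falling on a factor \<open>z - a\<close> removes that factor with a minus
  sign, and by symmetry all \<open>k\<close> removals agree. For \<open>k = 0\<close> the index
  \<open>k - 1\<close> is harmless because of the factor \<open>of_nat k\<close>.\<close>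

lemma hom_taylor_has_derivative_base:
  assumes U: "open U" and f: "smooth_on U f" and a: "a \<in> U"
  shows "((\<lambda>a. hom_taylor f a z k is) has_derivative
     (\<lambda>h. \<Sum>l\<in>UNIV. complex_of_real (h $ l) *
            (hom_taylor f a z k (l # is) - of_nat k * hom_taylor f a z (k - 1) (l # is)))) (at a)"
proof (induction k arbitrary: "is")
  case 0
  have "((\<lambda>a. complex_of_real (dpart is f a)) has_derivative
      (\<lambda>h. complex_of_real (\<Sum>l\<in>UNIV. h $ l * dpart (l # is) f a))) (at a)"
    by (rule has_derivative_of_real[OF smooth_on_has_derivative[OF f a]])
  then show ?case by simp
next
  case (Suc k)
  have lin: "((\<lambda>a. z $ i - complex_of_real (a $ i)) has_derivative
      (\<lambda>h. - complex_of_real (h $ i))) (at a)" for i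
    by (auto intro!: derivative_eq_intros has_derivative_of_real
        bounded_linear.has_derivative[OF bounded_linear_vec_nth])
  have "((\<lambda>a. hom_taylor f a z (Suc k) is) has_derivative
     (\<lambda>h. \<Sum>i\<in>UNIV. (z $ i - complex_of_real (a $ i)) *
           (\<Sum>l\<in>UNIV. complex_of_real (h $ l) *
            (hom_taylor f a z k (l # i # is) - of_nat k * hom_taylor f a z (k - 1) (l # i # is)))
        + - complex_of_real (h $ i) * hom_taylor f a z k (i # is))) (at a)"
    unfolding hom_taylor.simps(2) by (intro has_derivative_sum has_derivative_mult lin Suc)
  moreover have "(\<Sum>i\<in>UNIV. (z $ i - complex_of_real (a $ i)) *
           (\<Sum>l\<in>UNIV. complex_of_real (h $ l) *
            (hom_taylor f a z k (l # i # is) - of_nat k * hom_taylor f a z (k - 1) (l # i # is)))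
        + - complex_of_real (h $ i) * hom_taylor f a z k (i # is)) =
     (\<Sum>l\<in>UNIV. complex_of_real (h $ l) *
            (hom_taylor f a z (Suc k) (l # is) - of_nat (Suc k) * hom_taylor f a z (Suc k - 1) (l # is)))" for h
  proof -
    have sw: "hom_taylor f a z k (l # i # is) = hom_taylor f a z k (i # l # is)" for l i k
      by (rule hom_taylor_swap0[OF U f a])
    have k: "(\<Sum>i\<in>UNIV. (z $ i - complex_of_real (a $ i)) * (of_nat k * hom_taylor f a z (k - 1) (i # l # is)))
        = of_nat k * hom_taylor f a z k (l # is)" for l
      by (cases k) (simp_all add: sum_distrib_left mult_ac)
    have "(\<Sum>i\<in>UNIV. (z $ i - complex_of_real (a $ i)) *
           (\<Sum>l\<in>UNIV. complex_of_real (h $ l) *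
            (hom_taylor f a z k (l # i # is) - of_nat k * hom_taylor f a z (k - 1) (l # i # is))))
       = (\<Sum>l\<in>UNIV. complex_of_real (h $ l) * (\<Sum>i\<in>UNIV. (z $ i - complex_of_real (a $ i)) *
            (hom_taylor f a z k (i # l # is) - of_nat k * hom_taylor f a z (k - 1) (i # l # is))))"
      unfolding sum_distrib_left by (subst sum.swap) (simp add: sw mult_ac)
    also have "\<dots> = (\<Sum>l\<in>UNIV. complex_of_real (h $ l) *
        (hom_taylor f a z (Suc k) (l # is) - of_nat k * hom_taylor f a z k (l # is)))"
      by (simp only: right_diff_distrib sum_subtractf k hom_taylor.simps)
    finally show ?thesis
      by (simp add: sum.distrib sum_subtractf sum_negf algebra_simps)
  qed
  ultimately show ?case by simp
qed

text \<open>The derivative depends on \<open>v\<close> through complex multiples of its components: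
  the terms are holomorphic in \<open>z\<close>, whence the Cauchy--Riemann property of the
  patches.\<close>

lemma hom_taylor_has_derivative:
  assumes U: "open U" and f: "smooth_on U f" and a: "a \<in> U"
  shows "((\<lambda>z. hom_taylor f a z k is) has_derivative
     (\<lambda>v. \<Sum>l\<in>UNIV. v $ l * (of_nat k * hom_taylor f a z (k - 1) (l # is)))) (at z)"
proof (induction k arbitrary: "is")
  case (Suc k)
  have lin: "((\<lambda>z. z $ i - complex_of_real (a $ i)) has_derivative (\<lambda>v. v $ i)) (at z)" for i
    by (auto intro!: derivative_eq_intros bounded_linear.has_derivative[OF bounded_linear_vec_nth])
  have "((\<lambda>z. hom_taylor f a z (Suc k) is) has_derivative
     (\<lambda>v. \<Sum>i\<in>UNIV. (z $ i - complex_of_real (a $ i)) *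
           (\<Sum>l\<in>UNIV. v $ l * (of_nat k * hom_taylor f a z (k - 1) (l # i # is)))
        + v $ i * hom_taylor f a z k (i # is))) (at z)"
    unfolding hom_taylor.simps(2) by (intro has_derivative_sum has_derivative_mult lin Suc)
  moreover have "(\<Sum>i\<in>UNIV. (z $ i - complex_of_real (a $ i)) *
           (\<Sum>l\<in>UNIV. v $ l * (of_nat k * hom_taylor f a z (k - 1) (l # i # is)))
        + v $ i * hom_taylor f a z k (i # is)) =
     (\<Sum>l\<in>UNIV. v $ l * (of_nat (Suc k) * hom_taylor f a z (Suc k - 1) (l # is)))" for v
  proof -
    have sw: "hom_taylor f a z k (l # i # is) = hom_taylor f a z k (i # l # is)" for l i k
      by (rule hom_taylor_swap0[OF U f a])
    have k: "(\<Sum>i\<in>UNIV. (z $ i - complex_of_real (a $ i)) * (of_nat k * hom_taylor f a z (k - 1) (i # l # is)))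
        = of_nat k * hom_taylor f a z k (l # is)" for l
      by (cases k) (simp_all add: sum_distrib_left mult_ac)
    have "(\<Sum>i\<in>UNIV. (z $ i - complex_of_real (a $ i)) *
           (\<Sum>l\<in>UNIV. v $ l * (of_nat k * hom_taylor f a z (k - 1) (l # i # is))))
       = (\<Sum>l\<in>UNIV. v $ l * (\<Sum>i\<in>UNIV. (z $ i - complex_of_real (a $ i)) *
            (of_nat k * hom_taylor f a z (k - 1) (i # l # is))))"
      unfolding sum_distrib_left by (subst sum.swap) (simp add: sw mult_ac)
    then show ?thesis
      by (simp only: k sum.distrib) (simp add: algebra_simps flip: sum.distrib)
  qed
  ultimately show ?case by simp
qed simp

lemma cemb_diff: "cemb x - cemb y = cemb (x - y)"
  by (simp add: cemb_def vec_eq_iff)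

lemma norm_cemb: "norm (cemb x) = norm x"
  by (simp add: cemb_def norm_vec_def)

lemma dist_cemb: "dist (cemb x) (cemb y) = dist x y"
  by (simp add: dist_norm cemb_diff norm_cemb)

text \<open>Each of the \<open>k\<close> nested sums runs over all coordinates, which yields the
  power of \<open>CARD('n)\<close>.\<close>

lemma hom_taylor_bound:
  assumes "\<And>js. length js = k + length is \<Longrightarrow> \<bar>dpart js f a\<bar> \<le> K"
  shows "norm (hom_taylor f a z k (is::('n::finite) list)) \<le> (real CARD('n) * norm (z - cemb a)) ^ k * K"
  using assms
proof (induction k arbitrary: "is")
  case (Suc k)
  let ?n = "real CARD('n)" and ?R = "norm (z - cemb a)"
  have "norm (hom_taylor f a z k (i # is)) \<le> (?n * ?R) ^ k * K" for i
    using Suc.prems by (intro Suc.IH) auto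
  moreover have "norm (z $ i - complex_of_real (a $ i)) \<le> ?R" for i
    using Finite_Cartesian_Product.norm_nth_le[of "z - cemb a" i]
    by (simp add: cemb_def)
  ultimately have "norm ((z $ i - complex_of_real (a $ i)) * hom_taylor f a z k (i # is)) \<le> ?R * ((?n * ?R) ^ k * K)" for i
    unfolding norm_mult by (intro mult_mono) auto
  then have "norm (hom_taylor f a z (Suc k) is) \<le> (\<Sum>i\<in>(UNIV::'n set). ?R * ((?n * ?R) ^ k * K))"
    unfolding hom_taylor.simps by (intro sum_norm_le) auto
  then show ?case by (simp add: mult_ac)
qed simp

definition taylor :: "(real^'n \<Rightarrow> real) \<Rightarrow> real^'n \<Rightarrow> complex^'n \<Rightarrow> nat \<Rightarrow> 'n list \<Rightarrow> complex" where
  "taylor f a z p is = (\<Sum>k\<le>p. hom_taylor f a z k is / fact k)"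

lemma taylor_has_derivative_base:
  assumes U: "open U" and f: "smooth_on U f" and a: "a \<in> U"
  shows "((\<lambda>a. taylor f a z p is) has_derivative
     (\<lambda>h. \<Sum>l\<in>UNIV. complex_of_real (h $ l) * (hom_taylor f a z p (l # is) / fact p))) (at a)"
proof -
  have "((\<lambda>a. taylor f a z p is) has_derivative
     (\<lambda>h. \<Sum>k\<le>p. (\<Sum>l\<in>UNIV. complex_of_real (h $ l) *
            (hom_taylor f a z k (l # is) - of_nat k * hom_taylor f a z (k - 1) (l # is))) / fact k)) (at a)"
    unfolding taylor_def divide_inverse
    by (intro has_derivative_sum has_derivative_mult_left hom_taylor_has_derivative_base[OF assms])
  \<comment> \<open>Since \<open>k / fact k\<close> is \<open>1 / fact (k - 1)\<close>, the negative
    part of term \<open>k\<close> cancels the positive part of term \<open>k - 1\<close>; the top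
    term remains.\<close>
  moreover have tel: "(\<Sum>k\<le>p. (hom_taylor f a z k (l # is) - of_nat k * hom_taylor f a z (k - 1) (l # is)) / fact k)
      = hom_taylor f a z p (l # is) / fact p" for l
  proof (induction p)
    case (Suc p)
    have "(of_nat (Suc p) * hom_taylor f a z p (l # is)) / fact (Suc p) = hom_taylor f a z p (l # is) / fact p"
      by (simp only: fact_Suc of_nat_mult) (simp del: of_nat_Suc)
    then show ?case using Suc by (simp add: diff_divide_distrib)
  qed simp
  have "(\<Sum>k\<le>p. (\<Sum>l\<in>UNIV. complex_of_real (h $ l) *
            (hom_taylor f a z k (l # is) - of_nat k * hom_taylor f a z (k - 1) (l # is))) / fact k)
     = (\<Sum>l\<in>UNIV. complex_of_real (h $ l) * (hom_taylor f a z p (l # is) / fact p))" for h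
    unfolding sum_divide_distrib
    by (subst sum.swap) (simp only: tel[symmetric] sum_distrib_left times_divide_eq_right)
  ultimately show ?thesis by simp
qed

text \<open>Differentiating in \<open>z\<close> lowers the degree by one and lengthens the list by
  one, so degree plus \<open>length is\<close> is invariant. Estimates for lists of length at most 1
  therefore cover both a Taylor polynomial and its gradient.\<close>

lemma taylor_has_derivative:
  assumes U: "open U" and f: "smooth_on U f" and a: "a \<in> U"
  shows "((\<lambda>z. taylor f a z (Suc p) is) has_derivative
     (\<lambda>v. \<Sum>l\<in>UNIV. v $ l * taylor f a z p (l # is))) (at z)"
proof -
  have "((\<lambda>z. taylor f a z (Suc p) is) has_derivative
     (\<lambda>v. \<Sum>k\<le>Suc p. (\<Sum>l\<in>UNIV. v $ l * (of_nat k * hom_taylor f a z (k - 1) (l # is))) / fact k)) (at z)"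
    unfolding taylor_def divide_inverse
    by (intro has_derivative_sum has_derivative_mult_left hom_taylor_has_derivative[OF assms])
  moreover have "(\<Sum>k\<le>Suc p. (\<Sum>l\<in>UNIV. v $ l * (of_nat k * hom_taylor f a z (k - 1) (l # is))) / fact k)
      = (\<Sum>l\<in>UNIV. v $ l * taylor f a z p (l # is))" for v
  proof -
    have "(\<Sum>k\<le>Suc p. (\<Sum>l\<in>UNIV. v $ l * (of_nat k * hom_taylor f a z (k - 1) (l # is))) / fact k)
        = (\<Sum>k\<le>p. (\<Sum>l\<in>UNIV. v $ l * (of_nat (Suc k) * hom_taylor f a z k (l # is))) / fact (Suc k))"
      by (subst sum.atMost_Suc_shift) simp
    also have "\<dots> = (\<Sum>k\<le>p. \<Sum>l\<in>UNIV. v $ l * (hom_taylor f a z k (l # is) / fact k))"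
    proof (intro sum.cong refl)
      fix k
      have "of_nat (Suc k) / (fact (Suc k) :: complex) = 1 / fact k"
        by (simp only: fact_Suc of_nat_mult) (simp del: of_nat_Suc)
      then have "x * (of_nat (Suc k) * y) / fact (Suc k) = x * (y / (fact k :: complex))" for x y
        by (metis (no_types, opaque_lifting) mult.commute mult.left_commute mult_1 times_divide_eq_right)
      then show "(\<Sum>l\<in>UNIV. v $ l * (of_nat (Suc k) * hom_taylor f a z k (l # is))) / fact (Suc k)
          = (\<Sum>l\<in>UNIV. v $ l * (hom_taylor f a z k (l # is) / fact k))"
        unfolding sum_divide_distrib by simp
    qed
    also have "\<dots> = (\<Sum>l\<in>UNIV. v $ l * taylor f a z p (l # is))"
      by (subst sum.swap) (simp add: taylor_def sum_distrib_left)
    finally show ?thesis .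
  qed
  ultimately show ?thesis by simp
qed

lemma taylor_self: "taylor f x (cemb x) p is = complex_of_real (dpart is f x)"
proof -
  have "(\<Sum>i<p. hom_taylor f x (cemb x) (Suc i) is / fact (Suc i)) = 0"
    by (intro sum.neutral ballI) (simp add: cemb_def)
  then show ?thesis by (simp only: taylor_def sum.atMost_shift) simp
qed

section \<open>Mean value estimates along rectifiable curves\<close>

lemma length_le_dist:
  assumes "length_le g L" "t \<in> {0..1}" "s \<in> {0..1}"
  shows "dist (g s) (g t) \<le> L"
proof -
  have "dist (g s) (g t) \<le> L" if "s \<le> t" "t \<in> {0..1}" "s \<in> {0..1}" for s t
    using assms(1)[unfolded length_le_def, rule_format, of "[s, t]"] that by simp
  then show ?thesis using assms by (metis dist_commute linear)
qed

text \<open>The curve has finite length but need not be differentiable. It is subdivided so finely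
  that consecutive points lie in balls contained in \<open>U\<close>; on each chord the ordinary
  mean value theorem applies, and the chords have total length at most \<open>L\<close>. The chords
  may leave the curve, which is the reason for the slack \<open>\<eta>\<close>.\<close>

lemma path_mean_value:
  fixes G :: "'a::euclidean_space \<Rightarrow> 'b::real_normed_vector"
  assumes U: "open U" and g: "path g" "path_image g \<subseteq> U" "length_le g L" and \<eta>: "\<eta> > 0"
    and G: "\<And>\<xi>. \<xi> \<in> U \<Longrightarrow> (G has_derivative G' \<xi>) (at \<xi>)"
    and K: "\<And>\<xi> h. \<xi> \<in> U \<Longrightarrow> dist \<xi> (pathstart g) \<le> L + \<eta> \<Longrightarrow> norm (G' \<xi> h) \<le> K * norm h"
    and "K \<ge> 0"
  shows "norm (G (pathfinish g) - G (pathstart g)) \<le> K * L"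
proof -
  obtain e where e: "e > 0" "{y. infdist y (path_image g) \<le> e} \<subseteq> U"
    using compact_in_open_separated[OF _ compact_path_image[OF g(1)] U g(2)] by auto
  define \<epsilon> where "\<epsilon> = min e \<eta>"
  have \<epsilon>: "\<epsilon> > 0" using e \<eta> by (simp add: \<epsilon>_def)
  have ballU: "ball (g t) \<epsilon> \<subseteq> U" if "t \<in> {0..1}" for t
  proof
    fix y assume "y \<in> ball (g t) \<epsilon>"
    moreover have "infdist y (path_image g) \<le> dist y (g t)"
      using that by (intro infdist_le) (auto simp: path_image_def)
    ultimately have "infdist y (path_image g) \<le> e" by (simp add: \<epsilon>_def dist_commute)
    then show "y \<in> U" using e by auto
  qed
  have "uniformly_continuous_on {0..1} g"
    using g(1) unfolding path_def by (intro compact_uniformly_continuous) auto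
  then obtain d where d: "d > 0" "\<And>s t. s \<in> {0..1} \<Longrightarrow> t \<in> {0..1} \<Longrightarrow> dist s t < d \<Longrightarrow> dist (g s) (g t) < \<epsilon>"
    unfolding uniformly_continuous_on_def using \<epsilon> by metis
  obtain N :: nat where N: "N > 0" "1 / real N < d"
    using nat_approx_posE[OF d(1)] by (metis zero_less_Suc)
  define ts where "ts = map (\<lambda>i. real i / real N) [0..<Suc N]"
  have nth: "ts ! i = real i / real N" if "i \<le> N" for i
    using that by (simp add: ts_def nth_map del: upt_Suc)
  have len: "length ts = Suc N" by (simp add: ts_def)
  have step: "norm (G (g (ts ! Suc i)) - G (g (ts ! i))) \<le> K * dist (g (ts ! i)) (g (ts ! Suc i))"
    if "i < N" for i
  proof -
    have i: "ts ! i \<in> {0..1}" "ts ! Suc i \<in> {0..1}" "dist (ts ! i) (ts ! Suc i) < d"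
      using that N by (auto simp: nth dist_real_def field_simps)
    have "norm (G (g (ts ! Suc i)) - G (g (ts ! i))) \<le> K * norm (g (ts ! Suc i) - g (ts ! i))"
    proof (rule differentiable_bound)
      show "convex (ball (g (ts ! i)) \<epsilon>)" by simp
      show "g (ts ! i) \<in> ball (g (ts ! i)) \<epsilon>" "g (ts ! Suc i) \<in> ball (g (ts ! i)) \<epsilon>"
        using \<epsilon> d(2)[OF i] by auto
      fix \<xi> assume \<xi>: "\<xi> \<in> ball (g (ts ! i)) \<epsilon>"
      then have "\<xi> \<in> U" using ballU[OF i(1)] by auto
      show "(G has_derivative G' \<xi>) (at \<xi> within ball (g (ts ! i)) \<epsilon>)"
        using G[OF \<open>\<xi> \<in> U\<close>] by (rule has_derivative_at_withinI)
      have "dist \<xi> (pathstart g) \<le> dist \<xi> (g (ts ! i)) + dist (g (ts ! i)) (g 0)"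
        unfolding pathstart_def by (rule dist_triangle)
      also have "\<dots> \<le> \<eta> + L"
        using \<xi> length_le_dist[OF g(3), of 0 "ts ! i"] i
        by (intro add_mono) (auto simp: \<epsilon>_def dist_commute)
      finally show "onorm (G' \<xi>) \<le> K"
        using K[OF \<open>\<xi> \<in> U\<close>] \<open>K \<ge> 0\<close> by (intro onorm_bound) (auto simp: add.commute)
    qed
    then show ?thesis by (simp add: dist_norm norm_minus_commute)
  qed
  have "sorted ts" unfolding ts_def
    by (auto simp: sorted_iff_nth_mono divide_right_mono simp del: upt_Suc)
  moreover have "set ts \<subseteq> {0..1}" using N by (auto simp: ts_def)
  ultimately have sm: "(\<Sum>i<N. dist (g (ts ! i)) (g (ts ! Suc i))) \<le> L"
    using g(3) len unfolding length_le_def by (metis diff_Suc_1)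
  have "G (pathfinish g) - G (pathstart g) = G (g (ts ! N)) - G (g (ts ! 0))"
    using N by (simp add: nth pathfinish_def pathstart_def)
  also have "\<dots> = (\<Sum>i<N. G (g (ts ! Suc i)) - G (g (ts ! i)))"
    by (rule sum_lessThan_telescope[symmetric])
  also have "norm \<dots> \<le> (\<Sum>i<N. K * dist (g (ts ! i)) (g (ts ! Suc i)))"
    using step by (intro sum_norm_le) auto
  also have "\<dots> \<le> K * L"
    using sm \<open>K \<ge> 0\<close> by (simp add: mult_left_mono flip: sum_distrib_left)
  finally show ?thesis .
qed

text \<open>All base points on the curve, and on chords close to it, stay within \<open>R\<close> of
  \<open>z\<close>; the strict inequality in the hypothesis supplies the slack for
  \<open>path_mean_value\<close>.\<close>

lemma taylor_base_change:
  fixes f :: "real^'n \<Rightarrow> real"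
  assumes U: "open U" and f: "smooth_on U f"
    and g: "path g" "path_image g \<subseteq> U" "length_le g L"
    and K: "\<And>js \<xi>. \<xi> \<in> U \<Longrightarrow> length js = Suc (p + length is) \<Longrightarrow> \<bar>dpart js f \<xi>\<bar> \<le> K"
    and R: "norm (z - cemb (pathstart g)) + L < R"
  shows "norm (taylor f (pathfinish g) z p is - taylor f (pathstart g) z p is)
    \<le> real CARD('n) * ((real CARD('n) * R) ^ p * K / fact p) * L"
proof -
  define \<eta> where "\<eta> = R - (norm (z - cemb (pathstart g)) + L)"
  have \<eta>: "\<eta> > 0" using R by (simp add: \<eta>_def)
  have K0: "K \<ge> 0"
  proof -
    have "pathstart g \<in> U" using g(2) pathstart_in_path_image by blast
    from K[OF this, of "replicate (Suc (p + length is)) undefined"] show ?thesis by simp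
  qed
  have L0: "L \<ge> 0" using length_le_dist[OF g(3), of 0 0] by simp
  have R0: "R \<ge> 0" using R L0 norm_ge_zero[of "z - cemb (pathstart g)"] by linarith
  show ?thesis
  proof (rule path_mean_value[OF U g \<eta>,
        where G' = "\<lambda>a h. \<Sum>l\<in>UNIV. complex_of_real (h $ l) * (hom_taylor f a z p (l # is) / fact p)"])
    fix \<xi> :: "real^'n" and h assume \<xi>: "\<xi> \<in> U" "dist \<xi> (pathstart g) \<le> L + \<eta>"
    have "norm (z - cemb \<xi>) \<le> norm (z - cemb (pathstart g)) + dist \<xi> (pathstart g)"
      using dist_triangle[of z "cemb \<xi>" "cemb (pathstart g)"]
      by (simp add: dist_cemb dist_commute flip: dist_norm)
    also have "\<dots> \<le> R" using \<xi> by (simp add: \<eta>_def)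
    finally have zR: "norm (z - cemb \<xi>) \<le> R" .
    have b: "norm (hom_taylor f \<xi> z p (l # is)) \<le> (real CARD('n) * R) ^ p * K" for l
    proof -
      have "norm (hom_taylor f \<xi> z p (l # is)) \<le> (real CARD('n) * norm (z - cemb \<xi>)) ^ p * K"
        using K[OF \<xi>(1)] by (intro hom_taylor_bound) auto
      also have "\<dots> \<le> (real CARD('n) * R) ^ p * K"
        using zR K0 by (intro mult_right_mono power_mono mult_left_mono) auto
      finally show ?thesis .
    qed
    have "norm (complex_of_real (h $ l) * (hom_taylor f \<xi> z p (l # is) / fact p)) \<le>
       norm h * ((real CARD('n) * R) ^ p * K / fact p)" for l
      unfolding norm_mult norm_divide norm_fact
      using b component_le_norm_cart[of h l] K0 R0
      by (intro mult_mono divide_right_mono) (auto simp: norm_of_real)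
    then have "norm (\<Sum>l\<in>UNIV. complex_of_real (h $ l) * (hom_taylor f \<xi> z p (l # is) / fact p))
      \<le> (\<Sum>l\<in>(UNIV::'n set). norm h * ((real CARD('n) * R) ^ p * K / fact p))"
      by (intro sum_norm_le) auto
    then show "norm (\<Sum>l\<in>UNIV. complex_of_real (h $ l) * (hom_taylor f \<xi> z p (l # is) / fact p))
      \<le> real CARD('n) * ((real CARD('n) * R) ^ p * K / fact p) * norm h"
      by (simp add: mult_ac)
  qed (use taylor_has_derivative_base[OF U f] K0 R0 in auto)
qed

section \<open>The Bochner--Martinelli formula\<close>

lemma integrable_continuous_bounded_support:
  fixes f :: "'a::euclidean_space \<Rightarrow> 'b::{banach, second_countable_topology}"
  assumes "continuous_on UNIV f" "\<And>w. norm w > R \<Longrightarrow> f w = 0"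
  shows "integrable lborel f"
proof -
  have "integrable lborel (\<lambda>x. indicator (cball 0 R) x *\<^sub>R f x)"
    using assms(1) by (intro borel_integrable_compact) (auto intro: continuous_on_subset)
  moreover have "(\<lambda>x. indicator (cball 0 R) x *\<^sub>R f x) = f"
    using assms(2) by (auto simp: fun_eq_iff indicator_def not_le)
  ultimately show ?thesis by simp
qed

lemma integral_lborel_affine:
  fixes f :: "'a::euclidean_space \<Rightarrow> 'b::{banach, second_countable_topology}"
  assumes "f \<in> borel_measurable borel" "c > 0"
  shows "integral\<^sup>L lborel f = c ^ DIM('a) *\<^sub>R integral\<^sup>L lborel (\<lambda>x. f (t + c *\<^sub>R x))"
proof -
  have "integral\<^sup>L lborel f =
      integral\<^sup>L (density (distr lborel borel (\<lambda>x. t + c *\<^sub>R x)) (\<lambda>_. \<bar>c\<bar> ^ DIM('a))) f"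
    using lborel_affine[of c t] assms by simp
  also have "\<dots> = integral\<^sup>L (distr lborel borel (\<lambda>x. t + c *\<^sub>R x)) (\<lambda>x. (\<bar>c\<bar> ^ DIM('a)) *\<^sub>R f x)"
    using assms by (intro integral_density) auto
  also have "\<dots> = integral\<^sup>L lborel (\<lambda>x. (\<bar>c\<bar> ^ DIM('a)) *\<^sub>R f (t + c *\<^sub>R x))"
    using assms by (intro integral_distr) auto
  also have "\<dots> = c ^ DIM('a) *\<^sub>R integral\<^sup>L lborel (\<lambda>x. f (t + c *\<^sub>R x))"
    using assms by simp
  finally show ?thesis .
qed

lemma has_derivative_outside_support:
  fixes \<Phi> :: "'a::real_normed_vector \<Rightarrow> 'b::real_normed_vector"
  assumes "(\<Phi> has_derivative D) (at w)" "\<And>w. norm w > R \<Longrightarrow> \<Phi> w = 0" "norm w > R"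
  shows "D v = 0"
proof -
  have "open {w::'a. norm w > R}" by (intro open_Collect_less continuous_intros)
  then have "((\<lambda>_. 0) has_derivative D) (at w)"
    using assms by (intro has_derivative_transform_within_open[OF assms(1)]) auto
  then have "D = (\<lambda>_. 0)" by (rule has_derivative_unique) simp
  then show ?thesis by simp
qed

text \<open>Difference quotients of a compactly supported function integrate to 0 by translation
  invariance. They are bounded by a Lipschitz constant on a fixed ball, so dominated convergence
  transfers this to the derivative.\<close>

lemma integral_directional_derivative_eq_0:
  fixes \<Phi> :: "'a::euclidean_space \<Rightarrow> 'b::{banach, second_countable_topology}"
  assumes der: "\<And>w. (\<Phi> has_derivative D w) (at w)"
    and cont: "continuous_on UNIV (\<lambda>w. D w b)"
    and supp: "\<And>w. norm w > R \<Longrightarrow> \<Phi> w = 0"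
  shows "integral\<^sup>L lborel (\<lambda>w. D w b) = 0"
proof -
  have c\<Phi>: "continuous_on UNIV \<Phi>"
    using has_derivative_continuous[OF der] by (auto simp: continuous_on_eq_continuous_at)
  have D0: "D w b = 0" if "norm w > R" for w
    by (rule has_derivative_outside_support[OF der supp that])
  obtain L where L: "L > 0" "\<And>w. norm (D w b) \<le> L"
  proof -
    have "bounded ((\<lambda>w. D w b) ` cball 0 R)"
      using cont by (intro compact_imp_bounded compact_continuous_image) (auto intro: continuous_on_subset)
    then obtain L where "L > 0" "\<And>w. norm w \<le> R \<Longrightarrow> norm (D w b) \<le> L"
      by (auto simp: bounded_pos)
    with D0 that[of L] show ?thesis by (metis less_imp_le linorder_not_le norm_zero)
  qed
  have lip: "norm (\<Phi> (w + t *\<^sub>R b) - \<Phi> w) \<le> L * t" if "t \<ge> 0" for w t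
  proof -
    have "norm (\<Phi> (w + t *\<^sub>R b) - \<Phi> (w + 0 *\<^sub>R b)) \<le> L * norm (t - 0)"
    proof (rule differentiable_bound[where S = UNIV and f = "\<lambda>s. \<Phi> (w + s *\<^sub>R b)"])
      fix s :: real
      have "((\<lambda>s. w + s *\<^sub>R b) has_derivative (\<lambda>h. h *\<^sub>R b)) (at s)"
        by (auto intro!: derivative_eq_intros)
      from has_derivative_compose[OF this der]
      show "((\<lambda>s. \<Phi> (w + s *\<^sub>R b)) has_derivative (\<lambda>h. D (w + s *\<^sub>R b) (h *\<^sub>R b))) (at s)" .
      have "norm (D (w + s *\<^sub>R b) (h *\<^sub>R b)) \<le> L * norm h" for h
        using L(2)[of "w + s *\<^sub>R b"] has_derivative_linear[OF der[of "w + s *\<^sub>R b"]]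
        by (simp add: linear_scale mult.commute[of L] mult_left_mono)
      then show "onorm (\<lambda>h. D (w + s *\<^sub>R b) (h *\<^sub>R b)) \<le> L"
        using L by (intro onorm_bound) auto
    qed auto
    then show ?thesis using that by simp
  qed
  define s where "s m w = real (Suc m) *\<^sub>R (\<Phi> (w + (1 / Suc m) *\<^sub>R b) - \<Phi> w)" for m w
  have int\<Phi>: "integrable lborel (\<lambda>w. \<Phi> (w + c))" for c
  proof (rule integrable_continuous_bounded_support[where R = "R + norm c"])
    show "continuous_on UNIV (\<lambda>w. \<Phi> (w + c))"
      by (intro continuous_on_compose2[OF c\<Phi>] continuous_intros) auto
    fix w :: 'a assume "R + norm c < norm w"
    then show "\<Phi> (w + c) = 0" using norm_triangle_ineq4[of "w + c" c] by (intro supp) simp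
  qed
  have s0: "integral\<^sup>L lborel (s m) = 0" for m
  proof -
    have "integral\<^sup>L lborel \<Phi> = integral\<^sup>L lborel (\<lambda>w. \<Phi> ((1 / Suc m) *\<^sub>R b + 1 *\<^sub>R w))"
      using integral_lborel_affine[of \<Phi> 1 "(1 / Suc m) *\<^sub>R b"] c\<Phi> borel_measurable_continuous_onI by auto
    then show ?thesis
      using int\<Phi>[of "(1 / Suc m) *\<^sub>R b"] int\<Phi>[of 0]
      unfolding s_def by (simp add: add.commute)
  qed
  have "(\<lambda>m. integral\<^sup>L lborel (s m)) \<longlonglongrightarrow> integral\<^sup>L lborel (\<lambda>w. D w b)"
  proof (rule integral_dominated_convergence[where w = "\<lambda>w. L * indicator (cball 0 (R + norm b)) w"])
    show "(\<lambda>w. D w b) \<in> borel_measurable lborel"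
      using cont borel_measurable_continuous_onI by auto
    show "s m \<in> borel_measurable lborel" for m
      unfolding s_def using c\<Phi>
      by (auto intro!: borel_measurable_continuous_onI continuous_intros continuous_on_compose2[OF c\<Phi>])
    show "integrable lborel (\<lambda>w. L * indicator (cball 0 (R + norm b)) w)"
      by (intro integrable_mult_right integrable_real_indicator) (auto simp: emeasure_lborel_cball_finite[unfolded infinity_ennreal_def])
    show "AE w in lborel. (\<lambda>m. s m w) \<longlonglongrightarrow> D w b"
    proof (rule AE_I2)
      fix w
      have "((\<lambda>t. w + t *\<^sub>R b) has_derivative (\<lambda>h. h *\<^sub>R b)) (at 0)"
        by (auto intro!: derivative_eq_intros)
      from has_derivative_compose[OF this, of \<Phi> "D w"] der[of w]
      have "((\<lambda>t. \<Phi> (w + t *\<^sub>R b)) has_derivative (\<lambda>h. D w (h *\<^sub>R b))) (at 0)" by simp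
      moreover have "(\<lambda>h. D w (h *\<^sub>R b)) = (\<lambda>h. h *\<^sub>R D w b)"
        using has_derivative_linear[OF der[of w]] by (auto simp: linear_scale)
      ultimately have "((\<lambda>t. \<Phi> (w + t *\<^sub>R b)) has_derivative (\<lambda>h. h *\<^sub>R D w b)) (at 0)" by simp
      then have lim: "((\<lambda>h. norm (\<Phi> (w + h *\<^sub>R b) - \<Phi> w - h *\<^sub>R D w b) / norm h) \<longlongrightarrow> 0) (at 0)"
        by (simp add: has_derivative_at)
      have "filterlim (\<lambda>m. 1 / real (Suc m)) (at 0) sequentially"
        by (rule filterlim_atI[OF LIMSEQ_Suc[OF lim_1_over_n]]) auto
      from filterlim_compose[OF lim this]
      have "(\<lambda>m. norm (\<Phi> (w + (1 / Suc m) *\<^sub>R b) - \<Phi> w - (1 / Suc m) *\<^sub>R D w b) / norm (1 / real (Suc m))) \<longlonglongrightarrow> 0"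
        by simp
      moreover have "norm (\<Phi> (w + (1 / Suc m) *\<^sub>R b) - \<Phi> w - (1 / Suc m) *\<^sub>R D w b) / norm (1 / real (Suc m))
          = norm (s m w - D w b)" for m
      proof -
        have "s m w - D w b = real (Suc m) *\<^sub>R (\<Phi> (w + (1 / Suc m) *\<^sub>R b) - \<Phi> w - (1 / Suc m) *\<^sub>R D w b)"
          by (simp add: s_def algebra_simps del: of_nat_Suc)
        then show ?thesis by (simp del: of_nat_Suc)
      qed
      ultimately have "(\<lambda>m. norm (s m w - D w b)) \<longlonglongrightarrow> 0" by simp
      then show "(\<lambda>m. s m w) \<longlonglongrightarrow> D w b" by (simp add: LIM_zero_iff tendsto_norm_zero_iff)
    qed
    show "AE w in lborel. norm (s m w) \<le> L * indicator (cball 0 (R + norm b)) w" for m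
    proof (rule AE_I2)
      fix w
      have small: "norm ((1 / Suc m) *\<^sub>R b) \<le> norm b"
        by (simp add: divide_le_eq mult_le_cancel_left1)
      show "norm (s m w) \<le> L * indicator (cball 0 (R + norm b)) w"
      proof (cases "norm w \<le> R + norm b")
        case True
        have "norm (s m w) = real (Suc m) * norm (\<Phi> (w + (1 / Suc m) *\<^sub>R b) - \<Phi> w)"
          by (simp add: s_def)
        also have "\<dots> \<le> real (Suc m) * (L * (1 / Suc m))"
          by (intro mult_left_mono lip) auto
        finally show ?thesis using True by simp
      next
        case False
        then have "norm (w + (1 / Suc m) *\<^sub>R b) > R"
          using norm_triangle_ineq4[of "w + (1 / Suc m) *\<^sub>R b" "(1 / Suc m) *\<^sub>R b"] small by simp
        moreover have "norm w > R" using False norm_ge_zero[of b] by linarith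
        ultimately show ?thesis using False by (simp add: s_def supp)
      qed
    qed
  qed
  then show ?thesis by (simp add: s0 LIMSEQ_const_iff)
qed

section \<open>The regularised Bochner--Martinelli kernel\<close>

lemma inner_axis_complex: "inner (u::complex^'n) (axis j c) = inner (u $ j) c"
  by (simp add: inner_axis)

text \<open>The \<open>C\<^sup>1\<close> continuation of \<open>1 / s ^ n\<close> below \<open>e\<close> by its tangent.\<close>

definition reg_kernel :: "nat \<Rightarrow> real \<Rightarrow> real \<Rightarrow> real" where
  "reg_kernel n e s = (if s \<ge> e then 1 / s ^ n else (1 + n - n * s / e) / e ^ n)"

definition reg_kernel' :: "nat \<Rightarrow> real \<Rightarrow> real \<Rightarrow> real" where
  "reg_kernel' n e s = - (real n / (max s e) ^ Suc n)"

lemma inverse_power_has_derivative: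
  assumes "(s::real) > 0"
  shows "((\<lambda>s. 1 / s ^ n) has_real_derivative - (real n / s ^ Suc n)) (at s within T)"
proof -
  have "((\<lambda>s. inverse (s ^ n)) has_real_derivative - (inverse (s ^ n) * (real n * s ^ (n - 1)) * inverse (s ^ n))) (at s within T)"
    using assms by (auto intro!: derivative_eq_intros)
  moreover have "inverse (s ^ n) * (real n * s ^ (n - 1)) * inverse (s ^ n) = real n / s ^ Suc n"
    using assms by (cases n) (auto simp: field_simps)
  ultimately show ?thesis by (simp add: inverse_eq_divide)
qed

lemma reg_kernel_deriv:
  assumes e: "e > 0"
  shows "(reg_kernel n e has_real_derivative reg_kernel' n e s) (at s)"
proof -
  note d1 = inverse_power_has_derivative
  have d2: "((\<lambda>s. (1 + n - n * s / e) / e ^ n) has_real_derivative - (real n / e ^ Suc n)) (at s within T)" for T s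
    using e by (auto intro!: derivative_eq_intros simp: power_mult field_simps)
  have e2: "e > 0" using e by simp
  consider "s > e" | "s < e" | "s = e" by linarith
  then show ?thesis
  proof cases
    case 1
    have "((\<lambda>s. 1 / s ^ n) has_real_derivative reg_kernel' n e s) (at s)"
      using d1[of s n UNIV] 1 e2 by (simp add: reg_kernel'_def max_def)
    then show ?thesis
      by (rule has_field_derivative_transform_within_open[where S = "{e<..}"])
        (use 1 in \<open>auto simp: reg_kernel_def\<close>)
  next
    case 2
    have "((\<lambda>s. (1 + n - n * s / e) / e ^ n) has_real_derivative reg_kernel' n e s) (at s)"
      using d2[of s UNIV] 2
      by (simp add: reg_kernel'_def max_def)
    then show ?thesis
      by (rule has_field_derivative_transform_within_open[where S = "{..<e}"])
        (use 2 in \<open>auto simp: reg_kernel_def\<close>)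
  next
    case 3
    \<comment> \<open>At the joint both formulas agree in value and slope, so the two one-sided
      derivatives coincide.\<close>
    have c: "reg_kernel' n e s = - (real n / s ^ Suc n)" "reg_kernel' n e s = - (real n / e ^ Suc n)"
      using 3 by (simp_all add: reg_kernel'_def)
    have "(reg_kernel n e has_real_derivative reg_kernel' n e s) (at s within {s..})"
      unfolding c(1)
      by (rule has_field_derivative_transform_within[OF d1[of s n "{s..}"] zero_less_one])
        (use e2 3 in \<open>auto simp: reg_kernel_def\<close>)
    moreover have "(reg_kernel n e has_real_derivative reg_kernel' n e s) (at s within {..s})"
      unfolding c(2)
      by (rule has_field_derivative_transform_within[OF d2[of s "{..s}"] zero_less_one])
        (use e 3 in \<open>auto simp: reg_kernel_def field_simps\<close>)
    ultimately have "(reg_kernel n e has_real_derivative reg_kernel' n e s) (at s within {s..} \<union> {..s})"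
      unfolding has_field_derivative_def by (simp add: has_derivative_within Lim_Un)
    moreover have "{s..} \<union> {..s} = UNIV" by auto
    ultimately show ?thesis by simp
  qed
qed

lemma reg_kernel'_cont: "e > 0 \<Longrightarrow> continuous_on UNIV (reg_kernel' n e)"
  unfolding reg_kernel'_def by (intro continuous_intros) (auto simp: max_def)

text \<open>The bound does not depend on \<open>e\<close>; it provides the dominating function when
  \<open>e\<close> tends to 0.\<close>

lemma reg_kernel_bound:
  assumes "e > 0" "s > 0"
  shows "\<bar>reg_kernel n e s\<bar> \<le> (1 + n) / s ^ n"
proof (cases "s \<ge> e")
  case True
  then show ?thesis using assms by (simp add: reg_kernel_def divide_right_mono)
next
  case False
  have "0 \<le> 1 - s / e" using False assms by simp
  then have "0 \<le> real n * (1 - s / e)" by (intro mult_nonneg_nonneg) auto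
  then have "0 \<le> 1 + n - n * s / e" by (simp add: algebra_simps)
  moreover have "1 + n - n * s / e \<le> 1 + n" using assms by simp
  moreover have "s ^ n \<le> e ^ n" using False assms by (simp add: power_mult power_mono)
  ultimately have "\<bar>(1 + n - n * s / e) / e ^ n\<bar> \<le> (1 + n) / s ^ n"
    using assms by (simp add: abs_divide frac_le)
  then show ?thesis using False by (simp add: reg_kernel_def)
qed

text \<open>For \<open>1 / s ^ n\<close> the left side of \<open>reg_kernel_eta\<close> vanishes
  identically; \<open>bump_eta\<close> is what the tangent continuation contributes instead,
  rescaled to \<open>e = 1\<close>. It becomes the approximate identity of the representation
  formula.\<close>

definition bump_eta :: "nat \<Rightarrow> real \<Rightarrow> real" where
  "bump_eta n s = (if s < 1 then real n * (1 + n) * (1 - s) else 0)"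

lemma reg_kernel_eta:
  assumes "e > 0"
  shows "n * reg_kernel n e s + s * reg_kernel' n e s = bump_eta n (s / e) / e ^ n"
proof (cases "s \<ge> e")
  case True
  then have "s > 0" using assms by simp
  then show ?thesis using True assms by (auto simp: reg_kernel_def reg_kernel'_def bump_eta_def max_def)
next
  case False
  then show ?thesis using assms
    by (simp add: reg_kernel_def reg_kernel'_def bump_eta_def max_def power_mult field_simps)
qed

lemma norm_square_vec_complex: "(norm (u::complex^'n))\<^sup>2 = (\<Sum>j\<in>UNIV. (norm (u $ j))\<^sup>2)"
  by (simp add: norm_vec_def L2_set_def sum_nonneg)

lemma cnj_mult_inner:
  "cnj z * complex_of_real (inner z 1) + \<i> * cnj z * complex_of_real (inner z \<i>) = complex_of_real ((norm z)\<^sup>2)"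
  unfolding complex_eq_iff cmod_power2 by (simp add: inner_complex_def) (simp add: power2_eq_square)

text \<open>Derivatives of \<open>F w * cnj ((w - X) $ j) * g w\<close> integrate to 0,
  \<open>g\<close> being the regularised kernel. One part of the product rule is
  \<open>dbar F\<close> against the kernel. The other is \<open>F\<close> times \<open>n * g\<close>
  plus the squared distance times \<open>g'\<close>, which \<open>reg_kernel_eta\<close> identifies
  with the bump.\<close>

lemma reg_kernel_integral_identity:
  fixes F :: "complex^'n \<Rightarrow> complex" and X :: "complex^'n"
  assumes der: "\<And>z. (F has_derivative DF z) (at z)"
    and cont: "\<And>v. continuous_on UNIV (\<lambda>z. DF z v)"
    and supp: "\<And>z. norm z > R \<Longrightarrow> F z = 0" and E: "E > 0"
  shows "integral\<^sup>L lborel (\<lambda>w. \<Sum>j\<in>UNIV. (DF w (axis j 1) + \<i> * DF w (axis j \<i>)) / 2 *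
            (cnj ((w - X) $ j) * reg_kernel CARD('n) E ((norm (w - X))\<^sup>2)))
       = - integral\<^sup>L lborel (\<lambda>w. F w * complex_of_real (bump_eta CARD('n) ((norm (w - X))\<^sup>2 / E) / E ^ CARD('n)))"
proof -
  let ?n = "CARD('n)"
  define g where "g w = reg_kernel ?n E ((norm (w - X))\<^sup>2)" for w
  define g' where "g' w = reg_kernel' ?n E ((norm (w - X))\<^sup>2)" for w
  have gder: "(g has_derivative (\<lambda>v. g' w * (2 * inner (w - X) v))) (at w)" for w
  proof -
    have "((\<lambda>w. (norm (w - X))\<^sup>2) has_derivative (\<lambda>v. 2 * inner (w - X) v)) (at w)"
      unfolding power2_norm_eq_inner by (auto intro!: derivative_eq_intros simp: inner_commute)
    from has_derivative_compose[OF this reg_kernel_deriv[OF E, unfolded has_field_derivative_def]]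
    show ?thesis unfolding g_def g'_def .
  qed
  have gcont: "continuous_on UNIV g"
    using has_derivative_continuous[OF gder] by (auto simp: continuous_on_eq_continuous_at)
  have g'cont: "continuous_on UNIV g'"
    unfolding g'_def by (intro continuous_on_compose2[OF reg_kernel'_cont[OF E]] continuous_intros) auto
  have Fcont: "continuous_on UNIV F"
    using has_derivative_continuous[OF der] by (auto simp: continuous_on_eq_continuous_at)
  note DF0 = has_derivative_outside_support[OF der supp]
  \<comment> \<open>The factor \<open>c\<close> equals the direction of differentiation: adding the
    cases 1 and \<open>\<i>\<close> produces twice the antiholomorphic derivative in coordinate
    \<open>j\<close>.\<close>
  define DP where "DP j c w v = DF w v * (c * cnj ((w - X) $ j) * g w) +
     F w * (c * cnj (v $ j) * g w + c * cnj ((w - X) $ j) * complex_of_real (g' w * (2 * inner (w - X) v)))" for j c w v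
  have int0: "integral\<^sup>L lborel (\<lambda>w. DP j c w (axis j c)) = 0" for j c
  proof (rule integral_directional_derivative_eq_0[where \<Phi> = "\<lambda>w. F w * (c * cnj ((w - X) $ j) * g w)" and R = R])
    fix w
    have "((\<lambda>w. cnj ((w - X) $ j)) has_derivative (\<lambda>v. cnj (v $ j))) (at w)"
      by (auto intro!: derivative_eq_intros bounded_linear.has_derivative[OF bounded_linear_vec_nth]
          bounded_linear.has_derivative[OF bounded_linear_cnj])
    from has_derivative_mult[OF der has_derivative_mult[OF has_derivative_mult_right[OF this, of c] has_derivative_of_real[OF gder]]]
    show "((\<lambda>w. F w * (c * cnj ((w - X) $ j) * g w)) has_derivative DP j c w) (at w)"
      unfolding DP_def by (rule has_derivative_eq_rhs) (auto simp: fun_eq_iff algebra_simps)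
    show "continuous_on UNIV (\<lambda>w. DP j c w (axis j c))"
      unfolding DP_def by (intro continuous_intros cont gcont g'cont Fcont)
  qed (use supp in auto)
  have intDP: "integrable lborel (\<lambda>w. DP j c w (axis j c))" for j c
    unfolding DP_def
    by (intro integrable_continuous_bounded_support[where R = R] continuous_intros cont gcont g'cont Fcont)
      (simp add: supp DF0)
  define lhs where "lhs w = (\<Sum>j\<in>UNIV. (DF w (axis j 1) + \<i> * DF w (axis j \<i>)) / 2 *
            (cnj ((w - X) $ j) * complex_of_real (g w)))" for w
  define rhs where "rhs w = F w * complex_of_real (bump_eta ?n ((norm (w - X))\<^sup>2 / E) / E ^ ?n)" for w
  have rhs_eq: "rhs w = F w * complex_of_real (?n * g w + (norm (w - X))\<^sup>2 * g' w)" for w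
    unfolding rhs_def g_def g'_def reg_kernel_eta[OF E] ..
  have pt: "(\<Sum>j\<in>UNIV. DP j 1 w (axis j 1) + DP j \<i> w (axis j \<i>)) = 2 * lhs w + 2 * rhs w" for w
  proof -
    have "DP j 1 w (axis j 1) + DP j \<i> w (axis j \<i>) =
       2 * ((DF w (axis j 1) + \<i> * DF w (axis j \<i>)) / 2 * (cnj ((w - X) $ j) * complex_of_real (g w)))
       + 2 * (F w * complex_of_real (g w + (norm ((w - X) $ j))\<^sup>2 * g' w))" for j
    proof -
      have "cnj ((w - X) $ j) * complex_of_real (inner ((w - X) $ j) 1) + \<i> * cnj ((w - X) $ j) * complex_of_real (inner ((w - X) $ j) \<i>)
        = complex_of_real ((norm ((w - X) $ j))\<^sup>2)"
        by (rule cnj_mult_inner)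
      then have "F w * (complex_of_real (2 * g' w) * (cnj ((w - X) $ j) * complex_of_real (inner ((w - X) $ j) 1) + \<i> * cnj ((w - X) $ j) * complex_of_real (inner ((w - X) $ j) \<i>)))
         = F w * (complex_of_real (2 * g' w) * complex_of_real ((norm ((w - X) $ j))\<^sup>2))"
        by simp
      then show ?thesis
        by (simp add: DP_def inner_axis_complex field_simps)
    qed
    moreover have "(\<Sum>j\<in>UNIV. 2 * A j + 2 * (c * complex_of_real (B j))) =
        2 * (\<Sum>j\<in>UNIV. A j) + 2 * (c * complex_of_real (\<Sum>j\<in>UNIV. B j))"
      for A :: "'n \<Rightarrow> complex" and B c
      by (simp add: sum.distrib sum_distrib_left)
    ultimately have "(\<Sum>j\<in>UNIV. DP j 1 w (axis j 1) + DP j \<i> w (axis j \<i>)) =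
       2 * lhs w + 2 * (F w * complex_of_real (\<Sum>j\<in>UNIV. g w + (norm ((w - X) $ j))\<^sup>2 * g' w))"
      by (simp only: lhs_def)
    also have "(\<Sum>j\<in>(UNIV::'n set). g w + (norm ((w - X) $ j))\<^sup>2 * g' w) = ?n * g w + (norm (w - X))\<^sup>2 * g' w"
      by (simp add: sum.distrib norm_square_vec_complex flip: sum_distrib_right)
    finally show ?thesis by (simp add: rhs_eq)
  qed
  have ilhs: "integrable lborel lhs"
    unfolding lhs_def
    by (intro integrable_continuous_bounded_support[where R = R] continuous_intros cont gcont) (simp_all add: DF0)
  have irhs: "integrable lborel rhs"
    unfolding rhs_eq
    by (intro integrable_continuous_bounded_support[where R = R] continuous_intros Fcont gcont g'cont) (simp_all add: supp)
  have "0 = integral\<^sup>L lborel (\<lambda>w. \<Sum>j\<in>UNIV. DP j 1 w (axis j 1) + DP j \<i> w (axis j \<i>))"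
    using int0 intDP by simp
  also have "\<dots> = 2 * integral\<^sup>L lborel lhs + 2 * integral\<^sup>L lborel rhs"
    unfolding pt using ilhs irhs by simp
  also have "\<dots> = 2 * (integral\<^sup>L lborel lhs + integral\<^sup>L lborel rhs)" by (simp only: distrib_left)
  finally have "integral\<^sup>L lborel lhs + integral\<^sup>L lborel rhs = 0"
    by (metis mult_eq_0_iff zero_neq_numeral)
  then have "integral\<^sup>L lborel lhs = - integral\<^sup>L lborel rhs"
    by (simp only: eq_neg_iff_add_eq_0)
  then show ?thesis unfolding lhs_def rhs_def g_def .
qed

text \<open>The mass of the approximate identity and hence the normalising constant of the formula;
  \<open>bm_const_pos\<close> permits dividing by it.\<close>

definition bm_const :: "'n::finite itself \<Rightarrow> real" where
  "bm_const _ = integral\<^sup>L lborel (\<lambda>u::complex^'n. bump_eta CARD('n) ((norm u)\<^sup>2))"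

lemma bump_eta_nonneg: "bump_eta n s \<ge> 0"
  by (simp add: bump_eta_def)

lemma bump_eta_cont: "continuous_on UNIV (bump_eta n)"
proof -
  have "bump_eta n = (\<lambda>s. real n * (1 + n) * max 0 (1 - s))"
    by (auto simp: bump_eta_def fun_eq_iff max_def)
  then show ?thesis by (auto intro!: continuous_intros)
qed

lemma bump_eta_norm_cont: "continuous_on UNIV (\<lambda>u::complex^'n. bump_eta n ((norm u)\<^sup>2))"
  by (intro continuous_on_compose2[OF bump_eta_cont] continuous_intros) auto

lemma bump_eta_norm_eq_0: "norm u > 1 \<Longrightarrow> bump_eta n ((norm u)\<^sup>2) = 0"
  using power2_le_imp_le[of "norm u" 1] by (force simp: bump_eta_def abs_square_less_1)

lemma bump_eta_norm_integrable: "integrable lborel (\<lambda>u::complex^'n. bump_eta n ((norm u)\<^sup>2))"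
  by (rule integrable_continuous_bounded_support[OF bump_eta_norm_cont bump_eta_norm_eq_0])

lemma bm_const_pos: "bm_const TYPE('n::finite) > 0"
proof -
  let ?f = "\<lambda>u::complex^'n. bump_eta CARD('n) ((norm u)\<^sup>2)"
  have f: "?f u \<ge> 0" for u by (rule bump_eta_nonneg)
  have "integral\<^sup>L lborel ?f \<noteq> 0"
  proof
    assume "integral\<^sup>L lborel ?f = 0"
    then have ae: "AE u in lborel. ?f u = 0"
      using integral_nonneg_eq_0_iff_AE[OF bump_eta_norm_integrable] f by auto
    have "?f u \<noteq> 0" if "u \<in> ball 0 1" for u
    proof -
      have "(norm u)\<^sup>2 < 1" using that by (simp add: abs_square_less_1)
      then show ?thesis by (simp add: bump_eta_def)
    qed
    with ae have "AE u in lborel. u \<notin> ball (0::complex^'n) 1" by (auto elim!: eventually_mono)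
    then have "emeasure lborel (ball (0::complex^'n) 1) = 0"
      by (subst (asm) AE_iff_measurable[where N = "ball 0 1"]) auto
    then show False
      using content_ball_pos[of 1 "0::complex^'n"] by (simp add: measure_def)
  qed
  moreover have "integral\<^sup>L lborel ?f \<ge> 0" using f by (intro integral_nonneg_AE) auto
  ultimately show ?thesis by (simp add: bm_const_def)
qed

text \<open>Letting \<open>E\<close> tend to \<open>0\<close> in the previous identity: the kernels converge to the
  Bochner--Martinelli kernel, and the functions \<open>bump_eta\<close> form an approximate identity.\<close>

lemma bochner_martinelli:
  fixes F :: "complex^'n \<Rightarrow> complex" and X :: "complex^'n"
  assumes der: "\<And>z. (F has_derivative DF z) (at z)"
    and cont: "\<And>v. continuous_on UNIV (\<lambda>z. DF z v)"
    and supp: "\<And>z. norm z > R \<Longrightarrow> F z = 0"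
    and bd: "\<And>z j. norm ((DF z (axis j 1) + \<i> * DF z (axis j \<i>)) / 2) \<le> B * norm (z - X) ^ (2 * CARD('n) - 1)"
  shows "integral\<^sup>L lborel (\<lambda>w. \<Sum>j\<in>UNIV. (DF w (axis j 1) + \<i> * DF w (axis j \<i>)) / 2 *
            (cnj ((w - X) $ j) * complex_of_real (1 / ((norm (w - X))\<^sup>2) ^ CARD('n))))
       = - (bm_const TYPE('n) * F X)"
proof -
  let ?n = "CARD('n)"
  define db where "db j w = (DF w (axis j 1) + \<i> * DF w (axis j \<i>)) / 2" for j w
  define e where "e m = 1 / real (Suc m)" for m
  have e: "e m > 0" for m by (simp add: e_def)
  have elim: "e \<longlonglongrightarrow> 0" unfolding e_def using LIMSEQ_Suc[OF lim_1_over_n] by simp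
  \<comment> \<open>The kernel is a function of the squared distance, so its cut-off parameter is
    the square of a radius. The Jacobian \<open>e m ^ (2 * ?n)\<close> of the substitution
    \<open>w = X + e m *\<^sub>R u\<close> then cancels \<open>E m ^ ?n\<close>.\<close>
  define E where "E m = (e m)\<^sup>2" for m
  have E: "E m > 0" for m using e[of m] by (simp add: E_def)
  have Elim: "E \<longlonglongrightarrow> 0" unfolding E_def using tendsto_power[OF elim, of 2] by simp
  have Fcont: "continuous_on UNIV F"
    using has_derivative_continuous[OF der] by (auto simp: continuous_on_eq_continuous_at)
  have dbcont: "continuous_on UNIV (db j)" for j
    unfolding db_def by (intro continuous_intros cont) auto
  have db0: "db j w = 0" if "norm w > R" for w j
    by (simp add: db_def has_derivative_outside_support[OF der supp that])
  have dbm: "db j \<in> borel_measurable borel" for j using dbcont by (rule borel_measurable_continuous_onI)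
  have Bn: "B * norm (z - X) ^ (2 * ?n - 1) \<ge> 0" for z
    using bd[of z undefined] norm_ge_zero order_trans by blast
  let ?K = "\<lambda>w j. cnj ((w - X) $ j)"
  let ?I = "\<lambda>m w. \<Sum>j\<in>UNIV. db j w * (?K w j * complex_of_real (reg_kernel ?n (E m) ((norm (w - X))\<^sup>2)))"
  let ?J = "\<lambda>w. \<Sum>j\<in>UNIV. db j w * (?K w j * complex_of_real (1 / ((norm (w - X))\<^sup>2) ^ ?n))"
  let ?conv = "\<lambda>m w. F w * complex_of_real (bump_eta ?n ((norm (w - X))\<^sup>2 / E m) / E m ^ ?n)"
  let ?moved = "\<lambda>m u. F (X + e m *\<^sub>R u) * complex_of_real (bump_eta ?n ((norm u)\<^sup>2))"
  let ?limit = "\<lambda>u::complex^'n. F X * complex_of_real (bump_eta ?n ((norm u)\<^sup>2))"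
  have L: "(\<lambda>m. integral\<^sup>L lborel (?I m))
     \<longlonglongrightarrow> integral\<^sup>L lborel ?J"
  proof (rule integral_dominated_convergence[where w = "\<lambda>w. (?n * (B * (1 + ?n))) * indicator (cball 0 R) w"])
    show "?J \<in> borel_measurable lborel"
    proof -
      have K: "(\<lambda>w. ?K w j) \<in> borel_measurable lborel" for j
        by (auto intro!: borel_measurable_continuous_onI continuous_intros)
      have N: "(\<lambda>w. (norm (w - X))\<^sup>2) \<in> borel_measurable lborel"
        by (auto intro!: borel_measurable_continuous_onI continuous_intros)
      show ?thesis
        using dbm by (intro borel_measurable_sum borel_measurable_times K borel_measurable_of_real
          borel_measurable_divide borel_measurable_power N borel_measurable_const) auto
    qed
    have "continuous_on UNIV (reg_kernel ?n (E m))" for m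
      using DERIV_continuous[OF reg_kernel_deriv[OF E]] by (auto simp: continuous_on_eq_continuous_at)
    then have rc: "continuous_on UNIV (\<lambda>w. reg_kernel ?n (E m) ((norm (w - X))\<^sup>2))" for m
      by (rule continuous_on_compose2) (auto intro!: continuous_intros)
    show "(?I m) \<in> borel_measurable lborel" for m
      using dbcont by (auto intro!: borel_measurable_continuous_onI continuous_intros rc)
    show "integrable lborel (\<lambda>w. (?n * (B * (1 + ?n))) * indicator (cball (0::complex^'n) R) w)"
      by (intro integrable_mult_right integrable_real_indicator)
        (auto simp: emeasure_lborel_cball_finite[unfolded infinity_ennreal_def])
    show "AE w in lborel. (\<lambda>m. ?I m w)
        \<longlonglongrightarrow> (?J w)"
    proof (rule AE_I2)
      fix w
      show "(\<lambda>m. ?I m w)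
        \<longlonglongrightarrow> (?J w)"
      proof (cases "w = X")
        case False
        then have "(norm (w - X))\<^sup>2 > 0" by simp
        then have "eventually (\<lambda>m. E m < (norm (w - X))\<^sup>2) sequentially"
          using Elim by (simp add: order_tendsto_iff)
        then have "eventually (\<lambda>m. reg_kernel ?n (E m) ((norm (w - X))\<^sup>2) = 1 / ((norm (w - X))\<^sup>2) ^ ?n) sequentially"
          by eventually_elim (simp add: reg_kernel_def)
        then have "(\<lambda>m. reg_kernel ?n (E m) ((norm (w - X))\<^sup>2)) \<longlonglongrightarrow> 1 / ((norm (w - X))\<^sup>2) ^ ?n"
          by (rule tendsto_eventually)
        then show ?thesis by (intro tendsto_intros)
      qed simp
    qed
    show "AE w in lborel. norm (?I m w)
         \<le> (?n * (B * (1 + ?n))) * indicator (cball 0 R) w" for m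
    proof (rule AE_I2)
      fix w
      show "norm (?I m w)
         \<le> (?n * (B * (1 + ?n))) * indicator (cball 0 R) w"
      proof (cases "norm w \<le> R")
        case False
        then show ?thesis using db0[of w] by simp
      next
        case True
        have B0: "B \<ge> 0"
        proof -
          have "norm (X + axis undefined 1 - X) ^ (2 * ?n - 1) > 0" by (simp add: axis_eq_0_iff)
          then show ?thesis using Bn[of "X + axis undefined 1"] by (metis zero_le_mult_iff not_le)
        qed
        have "norm (db j w * (?K w j * complex_of_real (reg_kernel ?n (E m) ((norm (w - X))\<^sup>2)))) \<le> B * (1 + ?n)" for j
        proof (cases "w = X")
          case True
          then show ?thesis using B0 by simp
        next
          case False
          define r where "r = norm (w - X)"
          have r: "r > 0" using False by (simp add: r_def)
          \<comment> \<open>Flatness of order \<open>2 * ?n - 1\<close> and the factor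
            \<open>r\<close> together cancel the singularity of order \<open>2 * ?n\<close>, leaving
            a constant bound.\<close>
          have "norm (db j w) * (norm (?K w j) * \<bar>reg_kernel ?n (E m) (r\<^sup>2)\<bar>)
              \<le> (B * r ^ (2 * ?n - 1)) * (r * ((1 + ?n) / (r\<^sup>2) ^ ?n))"
            using bd[of w j] reg_kernel_bound[OF E, of "r\<^sup>2" ?n m] r Finite_Cartesian_Product.norm_nth_le[of "w - X" j] B0
            by (intro mult_mono) (auto simp: db_def r_def simp del: vector_minus_component)
          also have "\<dots> = B * (1 + ?n) * ((r * r ^ (2 * ?n - 1)) / r ^ (2 * ?n))"
            by (simp add: power_mult)
          also have "r * r ^ (2 * ?n - 1) = r ^ (2 * ?n)"
            by (metis power_eq_if zero_less_card_finite mult_is_0 less_numeral_extra(3) zero_neq_numeral)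
          finally show ?thesis using r by (simp add: norm_mult r_def)
        qed
        then have "norm (?I m w)
           \<le> (\<Sum>j\<in>(UNIV::'n set). B * (1 + ?n))" by (intro sum_norm_le) auto
        then show ?thesis using True by simp
      qed
    qed
  qed
  have Req: "integral\<^sup>L lborel (?conv m)
     = integral\<^sup>L lborel (?moved m)" for m
  proof -
    have meas: "(?conv m) \<in> borel_measurable borel"
      using Fcont E[of m] by (intro borel_measurable_continuous_onI continuous_intros
          continuous_on_compose2[OF bump_eta_cont]) auto
    have dim: "DIM(complex^'n) = 2 * ?n" by simp
    have "integral\<^sup>L lborel (?conv m)
       = e m ^ (2 * ?n) *\<^sub>R integral\<^sup>L lborel (\<lambda>u. F (X + e m *\<^sub>R u) *
            complex_of_real (bump_eta ?n ((norm (X + e m *\<^sub>R u - X))\<^sup>2 / E m) / E m ^ ?n))"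
      using integral_lborel_affine[OF meas e[of m], of X] unfolding dim .
    also have "\<dots> = e m ^ (2 * ?n) *\<^sub>R integral\<^sup>L lborel (\<lambda>u. F (X + e m *\<^sub>R u) *
            complex_of_real (bump_eta ?n ((norm u)\<^sup>2)) / complex_of_real (E m ^ ?n))"
      using e[of m] by (simp add: E_def power_mult_distrib)
    also have "\<dots> = integral\<^sup>L lborel (?moved m)"
      using e[of m] by (simp add: E_def power_mult scaleR_conv_of_real)
    finally show ?thesis .
  qed
  obtain MF where MF: "\<And>z. norm (F z) \<le> MF"
  proof -
    have "bounded (F ` cball 0 R)"
      using Fcont by (intro compact_imp_bounded compact_continuous_image) (auto intro: continuous_on_subset)
    then obtain L where "L > 0" "\<And>w. norm w \<le> R \<Longrightarrow> norm (F w) \<le> L"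
      by (auto simp: bounded_pos)
    with supp that[of L] show ?thesis by (metis less_imp_le linorder_not_le norm_zero)
  qed
  have "(\<lambda>m. integral\<^sup>L lborel (?moved m))
     \<longlonglongrightarrow> integral\<^sup>L lborel ?limit"
  proof (rule integral_dominated_convergence[where w = "\<lambda>u. MF * bump_eta ?n ((norm u)\<^sup>2)"])
    show "?limit \<in> borel_measurable lborel"
      using bump_eta_norm_cont by (auto intro!: borel_measurable_continuous_onI continuous_intros)
    show "(?moved m) \<in> borel_measurable lborel" for m
      using bump_eta_norm_cont
      by (auto intro!: borel_measurable_continuous_onI continuous_intros continuous_on_compose2[OF Fcont])
    show "integrable lborel (\<lambda>u::complex^'n. MF * bump_eta ?n ((norm u)\<^sup>2))"
      by (intro integrable_mult_right bump_eta_norm_integrable)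
    show "AE u in lborel. (\<lambda>m. ?moved m u)
        \<longlonglongrightarrow> ?limit u"
    proof (rule AE_I2)
      fix u :: "complex^'n"
      have "isCont F X" using Fcont by (simp add: continuous_on_eq_continuous_at)
      moreover have "(\<lambda>m. X + e m *\<^sub>R u) \<longlonglongrightarrow> X + 0 *\<^sub>R u" by (intro tendsto_intros elim)
      ultimately have "(\<lambda>m. F (X + e m *\<^sub>R u)) \<longlonglongrightarrow> F X"
        using isCont_tendsto_compose[of X F] by simp
      then show "(\<lambda>m. ?moved m u)
        \<longlonglongrightarrow> ?limit u" by (intro tendsto_intros)
    qed
    show "AE u in lborel. norm (?moved m u)
        \<le> MF * bump_eta ?n ((norm u)\<^sup>2)" for m
      by (rule AE_I2) (simp add: norm_mult bump_eta_nonneg MF mult_right_mono)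
  qed
  moreover have "integral\<^sup>L lborel ?limit
      = bm_const TYPE('n) * F X"
    by (simp add: bm_const_def)
  ultimately have Rl: "(\<lambda>m. - integral\<^sup>L lborel (?conv m))
      \<longlonglongrightarrow> - (bm_const TYPE('n) * F X)"
    unfolding Req by (intro tendsto_minus) (simp only:)
  have eq: "integral\<^sup>L lborel (?I m)
    = - integral\<^sup>L lborel (?conv m)" for m
    unfolding db_def using reg_kernel_integral_identity[OF der cont supp E, of R X m] by simp
  show ?thesis using LIMSEQ_unique[OF L[unfolded eq] Rl] unfolding db_def .
qed

section \<open>Derivatives of homogeneous kernels\<close>

text \<open>The real coordinates of \<open>w - cemb x\<close>: real parts for \<open>True\<close>;
  for \<open>False\<close> imaginary parts, which are independent of \<open>x\<close>. Splitting
  into them keeps kernels and densities real-valued.\<close>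

definition rel_coord :: "bool \<times> 'n::finite \<Rightarrow> complex^'n \<Rightarrow> real^'n \<Rightarrow> real" where
  "rel_coord e w x = (if fst e then Re (w $ snd e) - x $ snd e else Im (w $ snd e))"

lemma rel_coord_abs_le: "\<bar>rel_coord e w x\<bar> \<le> norm (w - cemb x)"
proof -
  have "\<bar>rel_coord e w x\<bar> \<le> norm ((w - cemb x) $ snd e)"
    using abs_Re_le_cmod[of "(w - cemb x) $ snd e"] abs_Im_le_cmod[of "(w - cemb x) $ snd e"]
    by (auto simp: rel_coord_def cemb_def)
  also have "\<dots> \<le> norm (w - cemb x)" by (rule Finite_Cartesian_Product.norm_nth_le)
  finally show ?thesis .
qed

text \<open>Kernels homogeneous of degree \<open>- d\<close> in \<open>w - x\<close>; \<open>D\<close> bounds the number of summands that the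
  product rule produces from one monomial, and \<open>c\<close> the sum of the absolute values of the coefficients.\<close>

inductive hom_kernel :: "nat \<Rightarrow> nat \<Rightarrow> real \<Rightarrow> (complex^'n \<Rightarrow> real^'n \<Rightarrow> real) \<Rightarrow> bool" where
  norm_power: "hom_kernel (2 * s) (2 * s) 1 (\<lambda>w x. 1 / ((norm (w - cemb x))\<^sup>2) ^ s)"
| coord: "hom_kernel (Suc d) D c g \<Longrightarrow> hom_kernel d (Suc D) c (\<lambda>w x. rel_coord e w x * g w x)"
| scale: "hom_kernel d D c g \<Longrightarrow> hom_kernel d D (\<bar>a\<bar> * c) (\<lambda>w x. a * g w x)"
| add: "hom_kernel d D c g \<Longrightarrow> hom_kernel d D c' g' \<Longrightarrow> hom_kernel d D (c + c') (\<lambda>w x. g w x + g' w x)"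
| weaken: "hom_kernel d D c g \<Longrightarrow> D \<le> D' \<Longrightarrow> c \<le> c' \<Longrightarrow> hom_kernel d D' c' g"

lemma hom_kernel_nonneg: "hom_kernel d D c g \<Longrightarrow> c \<ge> 0"
  by (induction rule: hom_kernel.induct) auto

lemma hom_kernel_bound:
  assumes "hom_kernel d D c g" "w \<noteq> cemb x"
  shows "\<bar>g w x\<bar> \<le> c / norm (w - cemb x) ^ d"
  using assms
proof (induction rule: hom_kernel.induct)
  case (norm_power s)
  then show ?case by (simp add: power_mult)
next
  case (coord d D c g e)
  have r: "norm (w - cemb x) > 0" using coord by simp
  have "\<bar>rel_coord e w x * g w x\<bar> \<le> norm (w - cemb x) * (c / norm (w - cemb x) ^ Suc d)"
    unfolding abs_mult using coord by (intro mult_mono rel_coord_abs_le) auto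
  also have "\<dots> = c / norm (w - cemb x) ^ d" using r by simp
  finally show ?case .
next
  case (scale d D c g a)
  then show ?case by (simp add: abs_mult mult_left_mono flip: times_divide_eq_right)
next
  case (add d D c g c' g')
  then show ?case by (simp add: add_divide_distrib)
next
  case (weaken d D c g D' c')
  have "c / norm (w - cemb x) ^ d \<le> c' / norm (w - cemb x) ^ d"
    using weaken by (intro divide_right_mono) auto
  then show ?case using weaken by linarith
qed

lemma rel_coord_borel: "(\<lambda>w. rel_coord e w x) \<in> borel_measurable borel"
proof (cases "fst e")
  case True
  then show ?thesis by (auto simp: rel_coord_def[abs_def] intro!: borel_measurable_continuous_onI continuous_intros)
next
  case False
  then show ?thesis by (auto simp: rel_coord_def[abs_def] intro!: borel_measurable_continuous_onI continuous_intros)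
qed

lemma hom_kernel_borel: "hom_kernel d D c g \<Longrightarrow> (\<lambda>w. g w x) \<in> borel_measurable borel"
proof (induction rule: hom_kernel.induct)
  case (norm_power s)
  have "(\<lambda>w. (norm (w - cemb x))\<^sup>2) \<in> borel_measurable borel"
    by (auto intro!: borel_measurable_continuous_onI continuous_intros)
  then show ?case by (intro borel_measurable_divide borel_measurable_power) auto
next
  case (coord d D c g e)
  show ?case by (intro borel_measurable_times rel_coord_borel coord.IH)
qed (auto intro: borel_measurable_times borel_measurable_add)

lemma rel_coord_has_derivative:
  "((\<lambda>x. rel_coord e w x) has_derivative (\<lambda>h. \<Sum>l\<in>UNIV. h $ l * (if fst e \<and> snd e = l then -1 else 0))) (at x)"
proof (cases "fst e")
  case True
  have "((\<lambda>x. Re (w $ snd e) - x $ snd e) has_derivative (\<lambda>h. - (h $ snd e))) (at x)"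
    by (auto intro!: derivative_eq_intros bounded_linear.has_derivative[OF bounded_linear_vec_nth])
  moreover have "(\<Sum>l\<in>UNIV. h $ l * (if fst e \<and> snd e = l then -1 else 0)) = - (h $ snd e)" for h :: "real^'a"
    using True by (simp add: if_distrib cong: if_cong)
  ultimately show ?thesis using True by (simp add: rel_coord_def)
next
  case False
  then show ?thesis by (simp add: rel_coord_def)
qed

lemma norm_square_cemb_has_derivative:
  "((\<lambda>x. (norm (w - cemb x))\<^sup>2) has_derivative (\<lambda>h. \<Sum>l\<in>UNIV. h $ l * (- 2 * rel_coord (True, l) w x))) (at x)"
proof -
  have eq: "(norm (w - cemb x))\<^sup>2 = (\<Sum>j\<in>UNIV. (Re (w $ j) - x $ j)\<^sup>2 + (Im (w $ j))\<^sup>2)" for x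
    by (simp add: norm_square_vec_complex cmod_power2 cemb_def)
  have "((\<lambda>x. \<Sum>j\<in>UNIV. (Re (w $ j) - x $ j)\<^sup>2 + (Im (w $ j))\<^sup>2) has_derivative
      (\<lambda>h. \<Sum>j\<in>UNIV. 2 * (Re (w $ j) - x $ j) * (- (h $ j)))) (at x)"
    by (auto intro!: derivative_eq_intros bounded_linear.has_derivative[OF bounded_linear_vec_nth]
        simp: algebra_simps)
  then show ?thesis unfolding eq by (rule has_derivative_eq_rhs) (auto simp: rel_coord_def algebra_simps intro!: sum.cong)
qed

abbreviation has_partials :: "(real^'n \<Rightarrow> real) \<Rightarrow> ('n \<Rightarrow> real) \<Rightarrow> real^'n \<Rightarrow> bool" where
  "has_partials g u x \<equiv> (g has_derivative (\<lambda>h. \<Sum>l\<in>UNIV. h $ l * u l)) (at x)"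

text \<open>A derivative of the inverse power with exponent \<open>2 * s\<close> is
  \<open>2 * s\<close> times a coordinate times the inverse power with exponent
  \<open>2 * s + 2\<close>. This raises the complexity \<open>D\<close> by 3: two for the exponent
  and one for the coordinate. In a product with a coordinate the rule adds at most one further term
  of weight \<open>c\<close>. Each derivative thus multiplies the weight by the current
  \<open>D\<close>.\<close>

lemma hom_kernel_has_derivative:
  assumes "hom_kernel d D c (g :: complex^'n \<Rightarrow> real^'n \<Rightarrow> real)"
  shows "\<exists>g'. (\<forall>l. hom_kernel (Suc d) (D + 3) (D * c) (g' l)) \<and>
    (\<forall>w x. w \<noteq> cemb x \<longrightarrow> has_partials (g w) (\<lambda>l. g' l w x) x)"
  using assms
proof (induction rule: hom_kernel.induct)
  case (norm_power s)
  define g' where "g' l w x = 2 * real s * (rel_coord (True, l) w x * (1 / ((norm (w - cemb x))\<^sup>2) ^ Suc s))" for l :: 'n and w x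
  have "hom_kernel (Suc (2 * s)) (Suc (2 * Suc s)) 1 (\<lambda>w x. rel_coord (True, l) w x * (1 / ((norm (w - cemb x))\<^sup>2) ^ Suc s))" for l :: 'n
    using hom_kernel.norm_power[of "Suc s"] by (intro hom_kernel.coord) simp
  then have "hom_kernel (Suc (2 * s)) (2 * s + 3) (\<bar>2 * real s\<bar> * 1) (g' l)" for l
    unfolding g'_def by (intro hom_kernel.scale) (simp add: numeral_3_eq_3)
  moreover have "((\<lambda>x. 1 / ((norm (w - cemb x))\<^sup>2) ^ s) has_derivative (\<lambda>h. \<Sum>l\<in>UNIV. h $ l * g' l w x)) (at x)"
    if "w \<noteq> cemb x" for w x
  proof -
    have q: "(norm (w - cemb x))\<^sup>2 > 0" using that by simp
    from has_derivative_compose[OF norm_square_cemb_has_derivative inverse_power_has_derivative[OF q, unfolded has_field_derivative_def]]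
    show ?thesis
      by (rule has_derivative_eq_rhs) (auto simp: fun_eq_iff g'_def sum_distrib_left sum_divide_distrib mult_ac simp flip: sum_negf intro!: sum.cong)
  qed
  ultimately show ?case by (intro exI[of _ g']) auto
next
  case (coord d D c g e)
  then obtain g' where g': "\<And>l. hom_kernel (Suc (Suc d)) (D + 3) (D * c) (g' l)"
    "\<And>w x. w \<noteq> cemb x \<Longrightarrow> has_partials (g w) (\<lambda>l. g' l w x) x" by blast
  note c0 = hom_kernel_nonneg[OF coord.hyps]
  define \<epsilon> :: "'n \<Rightarrow> real" where "\<epsilon> l = (if fst e \<and> snd e = l then -1 else 0)" for l
  define G where "G l w x = rel_coord e w x * g' l w x + \<epsilon> l * g w x" for l w x
  have "hom_kernel (Suc d) (Suc D + 3) (Suc D * c) (G l)" for l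
  proof -
    have 1: "hom_kernel (Suc d) (Suc (D + 3)) (D * c) (\<lambda>w x. rel_coord e w x * g' l w x)"
      by (rule hom_kernel.coord[OF g'(1)])
    have "hom_kernel (Suc d) D (\<bar>\<epsilon> l\<bar> * c) (\<lambda>w x. \<epsilon> l * g w x)"
      by (rule hom_kernel.scale[OF coord.hyps])
    then have "hom_kernel (Suc d) (Suc (D + 3)) c (\<lambda>w x. \<epsilon> l * g w x)"
      by (rule hom_kernel.weaken) (use c0 in \<open>auto simp: \<epsilon>_def\<close>)
    from hom_kernel.add[OF 1 this] show ?thesis by (simp add: G_def[abs_def] algebra_simps)
  qed
  moreover have "((\<lambda>x. rel_coord e w x * g w x) has_derivative (\<lambda>h. \<Sum>l\<in>UNIV. h $ l * G l w x)) (at x)"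
    if "w \<noteq> cemb x" for w x
    using has_derivative_mult[OF rel_coord_has_derivative[of e w] g'(2)[OF that]]
    by (rule has_derivative_eq_rhs)
      (auto simp: fun_eq_iff G_def \<epsilon>_def sum_distrib_left sum_distrib_right distrib_left sum.distrib mult_ac)
  ultimately show ?case by blast
next
  case (scale d D c g a)
  then obtain g' where g': "\<And>l. hom_kernel (Suc d) (D + 3) (D * c) (g' l)"
    "\<And>w x. w \<noteq> cemb x \<Longrightarrow> has_partials (g w) (\<lambda>l. g' l w x) x" by blast
  have "hom_kernel (Suc d) (D + 3) (D * (\<bar>a\<bar> * c)) (\<lambda>w x. a * g' l w x)" for l
    using hom_kernel.scale[OF g'(1), of a l] by (simp add: mult_ac)
  moreover have "((\<lambda>x. a * g w x) has_derivative (\<lambda>h. \<Sum>l\<in>UNIV. h $ l * (a * g' l w x))) (at x)"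
    if "w \<noteq> cemb x" for w x
    using has_derivative_mult_right[OF g'(2)[OF that], of a]
    by (rule has_derivative_eq_rhs) (auto simp: fun_eq_iff sum_distrib_left mult_ac)
  ultimately show ?case by (intro exI[of _ "\<lambda>l w x. a * g' l w x"]) auto
next
  case (add d D c g c' h)
  then obtain g' h' where g': "\<And>l. hom_kernel (Suc d) (D + 3) (D * c) (g' l)"
    "\<And>w x. w \<noteq> cemb x \<Longrightarrow> has_partials (g w) (\<lambda>l. g' l w x) x"
    and h': "\<And>l. hom_kernel (Suc d) (D + 3) (D * c') (h' l)"
    "\<And>w x. w \<noteq> cemb x \<Longrightarrow> ((\<lambda>x. h w x) has_derivative (\<lambda>v. \<Sum>l\<in>UNIV. v $ l * h' l w x)) (at x)" by blast
  have "hom_kernel (Suc d) (D + 3) (D * (c + c')) (\<lambda>w x. g' l w x + h' l w x)" for l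
    using hom_kernel.add[OF g'(1) h'(1), of l l] by (simp add: algebra_simps)
  moreover have "((\<lambda>x. g w x + h w x) has_derivative (\<lambda>v. \<Sum>l\<in>UNIV. v $ l * (g' l w x + h' l w x))) (at x)"
    if "w \<noteq> cemb x" for w x
    using has_derivative_add[OF g'(2)[OF that] h'(2)[OF that]]
    by (rule has_derivative_eq_rhs) (auto simp: fun_eq_iff sum.distrib distrib_left)
  ultimately show ?case by (intro exI[of _ "\<lambda>l w x. g' l w x + h' l w x"]) auto
next
  case (weaken d D c g D' c')
  then obtain g' where g': "\<And>l. hom_kernel (Suc d) (D + 3) (D * c) (g' l)"
    "\<And>w x. w \<noteq> cemb x \<Longrightarrow> has_partials (g w) (\<lambda>l. g' l w x) x" by blast
  have "real D * c \<le> real D' * c'"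
    using weaken hom_kernel_nonneg[OF weaken.hyps(1)] by (intro mult_mono) auto
  then have "hom_kernel (Suc d) (D' + 3) (D' * c') (g' l)" for l
    using weaken by (intro hom_kernel.weaken[OF g'(1)]) auto
  then show ?case using g'(2) by blast
qed

section \<open>Differentiation under the integral sign\<close>

abbreviation kernel_integral ::
    "(complex^'n \<Rightarrow> real) \<Rightarrow> (complex^'n \<Rightarrow> real^'n \<Rightarrow> real) \<Rightarrow> real^'n \<Rightarrow> real" where
  "kernel_integral A g x \<equiv> integral\<^sup>L lborel (\<lambda>w. A w * g w x)"

text \<open>Flatness of order \<open>d\<close> cancels a singularity of order \<open>d\<close>. At
  the singular point itself the density is 0 because \<open>d\<close> is positive.\<close>

lemma flat_kernel_bound:
  assumes g: "hom_kernel d D c g" and Bd: "\<bar>a\<bar> \<le> B * norm (w - cemb x) ^ d" and d: "d > 0" and B: "B \<ge> 0"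
  shows "\<bar>a * g w x\<bar> \<le> B * c"
proof (cases "w = cemb x")
  case True
  then have "a = 0" using Bd d by (simp add: zero_power)
  then show ?thesis using B hom_kernel_nonneg[OF g] by simp
next
  case False
  then have r: "norm (w - cemb x) > 0" by simp
  have "\<bar>a * g w x\<bar> \<le> (B * norm (w - cemb x) ^ d) * (c / norm (w - cemb x) ^ d)"
    unfolding abs_mult using B by (intro mult_mono Bd hom_kernel_bound[OF g False]) auto
  also have "\<dots> = B * c" using r by simp
  finally show ?thesis .
qed

text \<open>Models the real or imaginary part of a component of \<open>dbar F\<close>. It is flat of
  every order \<open>d\<close> along \<open>U\<close>, with a constant \<open>B d\<close> kept
  explicit because it carries the weight sequence.\<close>

definition flat_density :: "(real^'n) set \<Rightarrow> real \<Rightarrow> (nat \<Rightarrow> real) \<Rightarrow> (complex^'n \<Rightarrow> real) \<Rightarrow> bool" where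
  "flat_density U R B A \<longleftrightarrow> A \<in> borel_measurable borel \<and> (\<forall>w. norm w > R \<longrightarrow> A w = 0) \<and> (\<forall>d. B d \<ge> 0) \<and>
     (\<forall>d. \<forall>x\<in>U. \<forall>w. \<bar>A w\<bar> \<le> B d * norm (w - cemb x) ^ d)"

lemma flat_density_kernel_bound:
  assumes A: "flat_density U R B A" and g: "hom_kernel d D c g" and d: "d > 0" and x: "x \<in> U"
  shows "\<bar>A w * g w x\<bar> \<le> (B d * c) * indicator (cball 0 R) w"
proof (cases "norm w \<le> R")
  case True
  then show ?thesis using flat_kernel_bound[OF g _ d, of "A w" "B d"] A x by (simp add: flat_density_def)
next
  case False
  then show ?thesis using A by (simp add: flat_density_def)
qed

lemma integrable_indicator_cball: "integrable lborel (\<lambda>w::'a::euclidean_space. (c::real) * indicator (cball 0 R) w)"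
  by (intro integrable_mult_right integrable_real_indicator)
    (auto simp: emeasure_lborel_cball_finite[unfolded infinity_ennreal_def])

lemma flat_density_kernel_integrable:
  assumes A: "flat_density U R B A" and g: "hom_kernel d D c g" and d: "d > 0" and x: "x \<in> U"
  shows "integrable lborel (\<lambda>w. A w * g w x)"
proof (rule Bochner_Integration.integrable_bound)
  show "integrable lborel (\<lambda>w::complex^'a. (B d * c) * indicator (cball 0 R) w :: real)"
    by (rule integrable_indicator_cball)
  show "(\<lambda>w. A w * g w x) \<in> borel_measurable lborel"
    using A hom_kernel_borel[OF g] by (auto simp: flat_density_def)
  show "AE w in lborel. norm (A w * g w x) \<le> norm ((B d * c) * indicator (cball 0 R) w :: real)"
    using flat_density_kernel_bound[OF assms] by (intro AE_I2) (auto intro: order_trans[OF _ abs_ge_self])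
qed

lemma flat_density_kernel_integral_bound:
  assumes A: "flat_density U R B A" and g: "hom_kernel d D c (g :: complex^'n \<Rightarrow> _)" and d: "d > 0" and x: "x \<in> U"
  shows "\<bar>kernel_integral A g x\<bar> \<le> B d * c * measure lborel (cball (0::complex^'n) R)"
proof -
  have "norm (kernel_integral A g x) \<le> integral\<^sup>L lborel (\<lambda>w::complex^'n. (B d * c) * indicator (cball 0 R) w)"
    by (rule Bochner_Integration.integral_norm_bound_integral[OF flat_density_kernel_integrable[OF assms] integrable_indicator_cball])
      (use flat_density_kernel_bound[OF assms] in auto)
  then show ?thesis by simp
qed

lemma has_derivative_quadratic_bound:
  fixes f :: "'a::real_normed_vector \<Rightarrow> 'b::real_normed_vector"
  assumes D: "bounded_linear D" and r: "r > 0"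
    and le: "\<And>y. y \<in> ball x r \<Longrightarrow> norm (f y - f x - D (y - x)) \<le> K * (norm (y - x))\<^sup>2"
  shows "(f has_derivative D) (at x)"
  unfolding has_derivative_at_alt
proof (intro conjI D allI impI)
  fix e :: real assume e: "e > 0"
  define d where "d = min r (e / (\<bar>K\<bar> + 1))"
  have d: "d > 0" using r e by (simp add: d_def)
  have "norm (f y - f x - D (y - x)) \<le> e * norm (y - x)" if "norm (y - x) < d" for y
  proof -
    have "norm (f y - f x - D (y - x)) \<le> K * (norm (y - x))\<^sup>2"
      using that by (intro le) (simp add: d_def dist_norm norm_minus_commute)
    also have "\<dots> \<le> (\<bar>K\<bar> + 1) * (norm (y - x))\<^sup>2" by (intro mult_right_mono) auto
    also have "\<dots> = ((\<bar>K\<bar> + 1) * norm (y - x)) * norm (y - x)" by (simp add: power2_eq_square)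
    also have "\<dots> \<le> ((\<bar>K\<bar> + 1) * (e / (\<bar>K\<bar> + 1))) * norm (y - x)"
      using that by (intro mult_right_mono mult_left_mono) (auto simp: d_def)
    also have "(\<bar>K\<bar> + 1) * (e / (\<bar>K\<bar> + 1)) = e" by (simp add: add_nonneg_eq_0_iff)
    finally show ?thesis .
  qed
  then show "\<exists>d>0. \<forall>y. norm (y - x) < d \<longrightarrow> norm (f y - f x - D (y - x)) \<le> e * norm (y - x)"
    using d by blast
qed

lemma norm_sum_coord_le:
  fixes h :: "real^'n"
  assumes "\<And>l. \<bar>u l\<bar> \<le> K"
  shows "\<bar>\<Sum>l\<in>UNIV. h $ l * u l\<bar> \<le> real CARD('n) * K * norm h"
proof -
  have "\<bar>h $ l * u l\<bar> \<le> norm h * K" for l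
    unfolding abs_mult using assms component_le_norm_cart[of h l] by (intro mult_mono) auto
  then have "\<bar>\<Sum>l\<in>UNIV. h $ l * u l\<bar> \<le> (\<Sum>l\<in>(UNIV::'n set). norm h * K)"
    by (intro order_trans[OF sum_abs] sum_mono) auto
  then show ?thesis by (simp add: mult_ac)
qed

lemma bounded_linear_coord_sum: "bounded_linear (\<lambda>h::real^'n. \<Sum>l\<in>UNIV. h $ l * u l)"
  by (intro bounded_linear_sum bounded_linear_mult_const bounded_linear_vec_nth)

text \<open>Flatness of order \<open>d + 2\<close> bounds the second derivatives of the integrand
  uniformly in \<open>w\<close>. The first-order remainder is then quadratic with a uniform
  constant, and integrating it over the ball of radius \<open>R\<close> gives
  differentiability.\<close>

lemma flat_density_kernel_has_derivative:
  assumes U: "open U" and A: "flat_density U R B A" and d: "d > 0" and x: "x \<in> U"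
    and g: "hom_kernel d D c (g :: complex^'n \<Rightarrow> real^'n \<Rightarrow> real)"
    and g': "\<And>l. hom_kernel (Suc d) D' c' (g' l)"
    and der: "\<And>w x. w \<noteq> cemb x \<Longrightarrow> has_partials (g w) (\<lambda>l. g' l w x) x"
  shows "((\<lambda>x. kernel_integral A g x) has_derivative
     (\<lambda>h. \<Sum>l\<in>UNIV. h $ l * kernel_integral A (g' l) x)) (at x)"
proof -
  obtain r where r: "r > 0" "ball x r \<subseteq> U" using U x open_contains_ball by blast
  have "\<forall>l. \<exists>G. (\<forall>k. hom_kernel (Suc (Suc d)) (D' + 3) (D' * c') (G k)) \<and>
    (\<forall>w x. w \<noteq> cemb x \<longrightarrow> ((\<lambda>x. g' l w x) has_derivative (\<lambda>h. \<Sum>k\<in>UNIV. h $ k * G k w x)) (at x))"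
    using hom_kernel_has_derivative[OF g'] by blast
  from choice[OF this] obtain G where G: "\<And>l k. hom_kernel (Suc (Suc d)) (D' + 3) (D' * c') (G l k)"
    "\<And>l w x. w \<noteq> cemb x \<Longrightarrow> ((\<lambda>x. g' l w x) has_derivative (\<lambda>h. \<Sum>k\<in>UNIV. h $ k * G l k w x)) (at x)"
    by blast
  let ?n = "real CARD('n)"
  define K where "K = B (Suc (Suc d)) * (D' * c')"
  have K0: "K \<ge> 0" using A hom_kernel_nonneg[OF G(1)] by (simp add: K_def flat_density_def)
  have A0: "A w = 0" if "w = cemb y" "y \<in> U" for w y
    using A that unfolding flat_density_def by (metis abs_le_zero_iff diff_self mult_zero_right norm_zero power_0_Suc power_one_right)
  \<comment> \<open>Where the density vanishes the integrand is identically 0; elsewhere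
    \<open>w\<close> lies off the embedded \<open>U\<close> and the kernel is
    differentiable.\<close>
  have Ader: "((\<lambda>x. A w * g w x) has_derivative (\<lambda>h. \<Sum>l\<in>UNIV. h $ l * (A w * g' l w y))) (at y)" if "y \<in> U" for w y
  proof (cases "A w = 0")
    case False
    then have "w \<noteq> cemb y" using A0 that by blast
    from has_derivative_mult_right[OF der[OF this], of "A w"] show ?thesis
      by (rule has_derivative_eq_rhs) (auto simp: fun_eq_iff sum_distrib_left mult_ac)
  qed simp
  have Ader': "((\<lambda>x. A w * g' l w x) has_derivative (\<lambda>h. \<Sum>k\<in>UNIV. h $ k * (A w * G l k w y))) (at y)" if "y \<in> U" for w l y
  proof (cases "A w = 0")
    case False
    then have "w \<noteq> cemb y" using A0 that by blast
    from has_derivative_mult_right[OF G(2)[OF this], of "A w"] show ?thesis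
      by (rule has_derivative_eq_rhs) (auto simp: fun_eq_iff sum_distrib_left mult_ac)
  qed simp
  have GK: "\<bar>A w * G l k w y\<bar> \<le> K" if "y \<in> U" for w l k y
    using flat_density_kernel_bound[OF A G(1) _ that, of w l k] K0
    by (cases "norm w \<le> R") (auto simp: K_def)
  have lip: "\<bar>A w * g' l w y - A w * g' l w x\<bar> \<le> ?n * K * norm (y - x)" if "y \<in> ball x r" for w l y
  proof -
    have "norm (A w * g' l w y - A w * g' l w x) \<le> (?n * K) * norm (y - x)"
    proof (rule differentiable_bound[where S = "ball x r"])
      fix z assume z: "z \<in> ball x r"
      then have zU: "z \<in> U" using r by auto
      show "((\<lambda>y. A w * g' l w y) has_derivative (\<lambda>h. \<Sum>k\<in>UNIV. h $ k * (A w * G l k w z))) (at z within ball x r)"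
        by (rule has_derivative_at_withinI[OF Ader'[OF zU]])
      show "onorm (\<lambda>h. \<Sum>k\<in>UNIV. h $ k * (A w * G l k w z)) \<le> ?n * K"
        using norm_sum_coord_le[OF GK[OF zU]] K0 by (intro onorm_bound) auto
    qed (use that r in auto)
    then show ?thesis by simp
  qed
  have quad: "\<bar>A w * g w y - A w * g w x - (\<Sum>l\<in>UNIV. (y - x) $ l * (A w * g' l w x))\<bar>
      \<le> (?n * (?n * K) * (norm (y - x))\<^sup>2) * indicator (cball 0 R) w" if y: "y \<in> ball x r" for w y
  proof (cases "norm w \<le> R")
    case False
    then have "A w = 0" using A by (simp add: flat_density_def)
    then show ?thesis using False by simp
  next
    case True
    define s where "s = norm (y - x)"
    have "norm (A w * g w y - A w * g w x - (\<Sum>l\<in>UNIV. (y - x) $ l * (A w * g' l w x)))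
      \<le> norm (y - x) * (?n * (?n * K * s))"
    \<comment> \<open>Restricting to \<open>cball x s\<close> bounds the variation of the gradient
      by a multiple of \<open>s\<close>, which yields the square of
      \<open>norm (y - x)\<close>.\<close>
    proof (rule differentiable_bound_linearization[where S = "ball x r \<inter> cball x s" and ?x0.0 = x and
        f' = "\<lambda>z h. \<Sum>l\<in>UNIV. h $ l * (A w * g' l w z)"])
      show "x + t *\<^sub>R (y - x) \<in> ball x r \<inter> cball x s" if "t \<in> {0..1}" for t
      proof -
        have "norm (t *\<^sub>R (y - x)) \<le> 1 * norm (y - x)" using that by (simp add: mult_left_le_one_le)
        moreover have "norm (y - x) < r" using y by (simp add: dist_norm norm_minus_commute)
        ultimately show ?thesis by (simp add: dist_norm s_def)
      qed
      show "((\<lambda>y. A w * g w y) has_derivative (\<lambda>h. \<Sum>l\<in>UNIV. h $ l * (A w * g' l w z))) (at z within ball x r \<inter> cball x s)"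
        if "z \<in> ball x r \<inter> cball x s" for z
        using that r by (intro has_derivative_at_withinI[OF Ader]) auto
      show "onorm ((\<lambda>h. \<Sum>l\<in>UNIV. h $ l * (A w * g' l w z)) - (\<lambda>h. \<Sum>l\<in>UNIV. h $ l * (A w * g' l w x))) \<le> ?n * (?n * K * s)"
        if z: "z \<in> ball x r \<inter> cball x s" for z
      proof -
        have "\<bar>A w * g' l w z - A w * g' l w x\<bar> \<le> ?n * K * s" for l
        proof -
          have "\<bar>A w * g' l w z - A w * g' l w x\<bar> \<le> ?n * K * norm (z - x)" using z by (intro lip) auto
          also have "\<dots> \<le> ?n * K * s" using z K0 by (intro mult_left_mono) (auto simp: dist_norm norm_minus_commute)
          finally show ?thesis .
        qed
        from norm_sum_coord_le[OF this]
        have "norm (\<Sum>l\<in>UNIV. h $ l * (A w * g' l w z - A w * g' l w x)) \<le> ?n * (?n * K * s) * norm h" for h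
          by simp
        then show ?thesis using K0 unfolding fun_diff_def
          by (intro onorm_bound) (auto simp: s_def right_diff_distrib sum_subtractf)
      qed
      show "x \<in> ball x r \<inter> cball x s" using r by (simp add: s_def)
    qed
    then show ?thesis using True by (simp add: s_def power2_eq_square mult_ac)
  qed
  have int: "integrable lborel (\<lambda>w. A w * g w y)" if "y \<in> U" for y
    by (rule flat_density_kernel_integrable[OF A g d that])
  have int': "integrable lborel (\<lambda>w. A w * g' l w x)" for l
    by (rule flat_density_kernel_integrable[OF A g' _ x]) simp
  show ?thesis
  proof (rule has_derivative_quadratic_bound[OF bounded_linear_coord_sum r(1)])
    fix y assume y: "y \<in> ball x r"
    then have yU: "y \<in> U" using r by auto
    have "kernel_integral A g y - kernel_integral A g x -
        (\<Sum>l\<in>UNIV. (y - x) $ l * kernel_integral A (g' l) x)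
      = integral\<^sup>L lborel (\<lambda>w. A w * g w y - A w * g w x - (\<Sum>l\<in>UNIV. (y - x) $ l * (A w * g' l w x)))"
      using int[OF yU] int[OF x] int' by simp
    also have "norm \<dots> \<le> integral\<^sup>L lborel (\<lambda>w::complex^'n. (?n * (?n * K) * (norm (y - x))\<^sup>2) * indicator (cball 0 R) w)"
      using int[OF yU] int[OF x] int' quad[OF y]
      by (intro Bochner_Integration.integral_norm_bound_integral integrable_indicator_cball) auto
    also have "\<dots> = (?n * (?n * K) * measure lborel (cball (0::complex^'n) R)) * (norm (y - x))\<^sup>2"
      by simp
    finally show "norm (kernel_integral A g y - kernel_integral A g x -
        (\<Sum>l\<in>UNIV. (y - x) $ l * kernel_integral A (g' l) x))
      \<le> (?n * (?n * K) * measure lborel (cball (0::complex^'n) R)) * (norm (y - x))\<^sup>2" .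
  qed
qed

text \<open>Each derivative replaces the kernels by their derivatives and keeps the densities. The
  constants depend on the list through its length alone, as the final estimates require.\<close>

lemma dpart_flat_integral:
  fixes f :: "real^'n \<Rightarrow> real" and g :: "'e \<Rightarrow> complex^'n \<Rightarrow> real^'n \<Rightarrow> real"
  assumes U: "open U" and S: "finite S" and A: "\<And>e. e \<in> S \<Longrightarrow> flat_density U R B (A e)" and d: "d > 0"
    and g: "\<And>e. e \<in> S \<Longrightarrow> hom_kernel d D c (g e)"
    and f: "\<And>x. x \<in> U \<Longrightarrow> f x = (\<Sum>e\<in>S. kernel_integral (A e) (g e) x)"
  shows "\<exists>G. (\<forall>e\<in>S. hom_kernel (d + length is) (D + 3 * length is) ((\<Prod>i<length is. real (D + 3 * i)) * c) (G e)) \<and>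
     (\<forall>x\<in>U. dpart is f x = (\<Sum>e\<in>S. kernel_integral (A e) (G e) x) \<and> dpart is f differentiable (at x))"
proof -
  have diff: "((\<lambda>x. \<Sum>e\<in>S. kernel_integral (A e) (G e) x) has_derivative
       (\<lambda>h. \<Sum>e\<in>S. \<Sum>l\<in>UNIV. h $ l * kernel_integral (A e) (G' e l) x)) (at x)"
    if "x \<in> U" "d' > 0" "\<And>e. e \<in> S \<Longrightarrow> hom_kernel d' D' c' (G e)"
      "\<And>e l. e \<in> S \<Longrightarrow> hom_kernel (Suc d') (D' + 3) (real D' * c') (G' e l)"
      "\<And>e w x. e \<in> S \<Longrightarrow> w \<noteq> cemb x \<Longrightarrow> has_partials (G e w) (\<lambda>l. G' e l w x) x"
    for x d' D' c' and G :: "'e \<Rightarrow> complex^'n \<Rightarrow> real^'n \<Rightarrow> real" and G' :: "'e \<Rightarrow> 'n \<Rightarrow> complex^'n \<Rightarrow> real^'n \<Rightarrow> real"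
    by (intro has_derivative_sum flat_density_kernel_has_derivative[OF U A that(2,1)]) (use that in auto)
  have ex': "\<exists>G'. (\<forall>e\<in>S. \<forall>l. hom_kernel (Suc d') (D' + 3) (real D' * c') (G' e l)) \<and>
      (\<forall>e\<in>S. \<forall>w x. w \<noteq> cemb x \<longrightarrow> has_partials (G e w) (\<lambda>l. G' e l w x) x)"
    if "\<And>e. e \<in> S \<Longrightarrow> hom_kernel d' D' c' (G e)" for d' D' c' and G :: "'e \<Rightarrow> complex^'n \<Rightarrow> real^'n \<Rightarrow> real"
  proof -
    have "\<forall>e\<in>S. \<exists>G'. (\<forall>l. hom_kernel (Suc d') (D' + 3) (real D' * c') (G' l)) \<and>
        (\<forall>w x. w \<noteq> cemb x \<longrightarrow> has_partials (G e w) (\<lambda>l. G' l w x) x)"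
      using hom_kernel_has_derivative[OF that] by blast
    from bchoice[OF this] show ?thesis by blast
  qed
  have step: "dpart is f differentiable (at x)"
    if hk: "\<And>e. e \<in> S \<Longrightarrow> hom_kernel d' D' c' (G e)" and d': "d' > 0" and dp:
      "\<And>x. x \<in> U \<Longrightarrow> dpart is f x = (\<Sum>e\<in>S. kernel_integral (A e) (G e) x)" and xU: "x \<in> U"
    for "is" d' D' c' G x
  proof -
    obtain G' where G': "\<And>e l. e \<in> S \<Longrightarrow> hom_kernel (Suc d') (D' + 3) (real D' * c') (G' e l)"
      "\<And>e w x. e \<in> S \<Longrightarrow> w \<noteq> cemb x \<Longrightarrow> has_partials (G e w) (\<lambda>l. G' e l w x) x"
      using ex'[of d' D' c' G, OF hk] by blast
    have "(\<lambda>x. \<Sum>e\<in>S. kernel_integral (A e) (G e) x) differentiable (at x)"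
      using diff[of x d' D' c' G G', OF xU d' hk G'] unfolding differentiable_def by blast
    then show ?thesis using differentiable_cong[OF U xU dp] by simp
  qed
  have "\<exists>G. (\<forall>e\<in>S. hom_kernel (d + length is) (D + 3 * length is) ((\<Prod>i<length is. real (D + 3 * i)) * c) (G e)) \<and>
     (\<forall>x\<in>U. dpart is f x = (\<Sum>e\<in>S. kernel_integral (A e) (G e) x))"
  proof (induction "is")
    case Nil
    then show ?case using g f by (intro exI[of _ g]) auto
  next
    case (Cons i "is")
    let ?d = "d + length is" and ?D = "D + 3 * length is" and ?c = "(\<Prod>i<length is. real (D + 3 * i)) * c"
    from Cons obtain G where G: "\<And>e. e \<in> S \<Longrightarrow> hom_kernel ?d ?D ?c (G e)"
      "\<And>x. x \<in> U \<Longrightarrow> dpart is f x = (\<Sum>e\<in>S. kernel_integral (A e) (G e) x)" by blast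
    obtain G' where G': "\<And>e l. e \<in> S \<Longrightarrow> hom_kernel (Suc ?d) (?D + 3) (real ?D * ?c) (G' e l)"
      "\<And>e w x. e \<in> S \<Longrightarrow> w \<noteq> cemb x \<Longrightarrow> has_partials (G e w) (\<lambda>l. G' e l w x) x"
      using ex'[of ?d ?D ?c G, OF G(1)] by blast
    have "dpart (i # is) f x = (\<Sum>e\<in>S. kernel_integral (A e) (G' e i) x)" if x: "x \<in> U" for x
    proof -
      have "dpart (i # is) f x = frechet_derivative (\<lambda>x. \<Sum>e\<in>S. kernel_integral (A e) (G e) x) (at x) (axis i 1)"
        using frechet_derivative_cong[OF U x G(2)] by simp
      also have "\<dots> = (\<Sum>e\<in>S. \<Sum>l\<in>UNIV. axis i 1 $ l * kernel_integral (A e) (G' e l) x)"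
        using frechet_derivative_at[OF diff[of x ?d ?D ?c G G', OF x _ G(1) G']] d by (simp add: fun_eq_iff)
      also have "\<dots> = (\<Sum>e\<in>S. kernel_integral (A e) (G' e i) x)"
        by (intro sum.cong refl) (simp add: axis_def if_distrib if_distribR cong: if_cong)
      finally show ?thesis .
    qed
    moreover have "hom_kernel (d + length (i # is)) (D + 3 * length (i # is))
        ((\<Prod>i<length (i # is). real (D + 3 * i)) * c) (G' e i)" if "e \<in> S" for e
      using G'(1)[OF that, of i] by (simp add: mult_ac add_ac)
    ultimately show ?case by (intro exI[of _ "\<lambda>e. G' e i"]) blast
  qed
  then obtain G where G: "\<And>e. e \<in> S \<Longrightarrow> hom_kernel (d + length is) (D + 3 * length is) ((\<Prod>i<length is. real (D + 3 * i)) * c) (G e)"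
    "\<And>x. x \<in> U \<Longrightarrow> dpart is f x = (\<Sum>e\<in>S. kernel_integral (A e) (G e) x)" by blast
  have "dpart is f differentiable (at x)" if "x \<in> U" for x
    by (rule step[OF G(1) _ G(2) that]) (use d in auto)
  then show ?thesis using G by blast
qed

text \<open>The product of the successive complexities is a geometric factor times
  \<open>fact k\<close>; this factorial is cancelled by the one in \<open>small_seq\<close>.\<close>

lemma prod_arith_le_fact: "(\<Prod>i<k. real (D + 3 * i)) \<le> real (D + 3) ^ k * fact k"
proof (induction k)
  case (Suc k)
  have "(\<Prod>i<Suc k. real (D + 3 * i)) \<le> (real (D + 3) ^ k * fact k) * real (D + 3 * k)"
    unfolding prod.lessThan_Suc using Suc by (intro mult_right_mono) auto
  also have "\<dots> \<le> (real (D + 3) ^ k * fact k) * (real (D + 3) * real (Suc k))"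
  proof (intro mult_left_mono)
    have "D + 3 * k \<le> (D + 3) * Suc k" by (simp add: algebra_simps)
    then show "real (D + 3 * k) \<le> real (D + 3) * real (Suc k)" unfolding of_nat_mult[symmetric] of_nat_le_iff .
  qed simp
  finally show ?case by (simp add: mult_ac)
qed simp

section \<open>From almost analytic extensions to derivative bounds\<close>

lemma C1cE:
  assumes "C1c F"
  obtains R where "\<And>z. (F has_derivative frechet_derivative F (at z)) (at z)"
    "\<And>v. continuous_on UNIV (\<lambda>z. frechet_derivative F (at z) v)"
    "\<And>z. norm z > R \<Longrightarrow> F z = 0"
proof -
  obtain F' where F': "\<And>z. (F has_derivative blinfun_apply (F' z)) (at z)" "continuous_on UNIV F'"
    and c: "compact (closure {z. F z \<noteq> 0})"
    using assms unfolding C1c_def by blast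
  have eq: "frechet_derivative F (at z) = blinfun_apply (F' z)" for z
    using frechet_derivative_at[OF F'(1)] by simp
  obtain R where R: "\<And>z. z \<in> closure {z. F z \<noteq> 0} \<Longrightarrow> norm z \<le> R"
    using compact_imp_bounded[OF c] by (auto simp: bounded_iff)
  show ?thesis
  proof
    show "(F has_derivative frechet_derivative F (at z)) (at z)" for z using F' eq by simp
    show "continuous_on UNIV (\<lambda>z. frechet_derivative F (at z) v)" for v
      unfolding eq by (intro continuous_intros F')
    show "F z = 0" if "norm z > R" for z
    proof (rule ccontr)
      assume "F z \<noteq> 0"
      then have "z \<in> closure {z. F z \<noteq> 0}" using closure_subset[of "{z. F z \<noteq> 0}"] by blast
      then show False using R that by fastforce
    qed
  qed
qed

lemma almost_analytic_extendable_imp_B_roumieu: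
  fixes f :: "real^'n \<Rightarrow> real"
  assumes R: "R_regular \<MM>" and U: "open U" and ext: "almost_analytic_extendable \<MM> U f"
  shows "f \<in> B_roumieu \<MM> U"
proof -
  obtain M \<rho> F C where M: "M \<in> \<MM>" and \<rho>: "\<rho> > 0" and F: "C1c F" and C: "C \<ge> 1"
    and Ff: "\<And>x. x \<in> U \<Longrightarrow> F (cemb x) = complex_of_real (f x)"
    and dF: "\<And>z. norm (dbar F z) \<le> C * h_fun (small_seq M) (\<rho> * infdist z (cemb ` closure U))"
    using ext unfolding almost_analytic_extendable_def almost_analytic_ext_def by blast
  note m = R_regular_root_divergent[OF R M]
  let ?DF = "\<lambda>z. frechet_derivative F (at z)"
  obtain r where der: "\<And>z. (F has_derivative ?DF z) (at z)"
    and cont: "\<And>v. continuous_on UNIV (\<lambda>z. ?DF z v)" and supp: "\<And>z. norm z > r \<Longrightarrow> F z = 0"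
    using C1cE[OF F] by metis
  define n where "n = CARD('n)"
  have n: "n > 0" by (simp add: n_def)
  \<comment> \<open>The associated function is at most its \<open>d\<close>-th term, for every
    \<open>d\<close> at once, and the distance to the closure of \<open>U\<close> is at most the
    distance to any \<open>x \<in> U\<close>.\<close>
  define B where "B d = C * (small_seq M d * \<rho> ^ d)" for d
  have B0: "B d \<ge> 0" for d
    using C \<rho> root_divergentD(1)[OF m, of d] by (simp add: B_def)
  have dFB: "norm (dbar F z) \<le> B d * norm (z - cemb x) ^ d" if x: "x \<in> U" for z x d
  proof -
    have "infdist z (cemb ` closure U) \<le> dist z (cemb x)"
      using x closure_subset by (intro infdist_le) auto
    then have le: "infdist z (cemb ` closure U) \<le> norm (z - cemb x)" by (simp add: dist_norm)
    have "h_fun (small_seq M) (\<rho> * infdist z (cemb ` closure U))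
        \<le> small_seq M d * (\<rho> * infdist z (cemb ` closure U)) ^ d"
      using \<rho> by (intro h_fun_le[OF m] mult_nonneg_nonneg infdist_nonneg) auto
    also have "\<dots> \<le> small_seq M d * (\<rho> * norm (z - cemb x)) ^ d"
      using \<rho> le root_divergentD(1)[OF m, of d]
      by (intro mult_left_mono power_mono mult_nonneg_nonneg infdist_nonneg) auto
    finally have "C * h_fun (small_seq M) (\<rho> * infdist z (cemb ` closure U))
       \<le> C * (small_seq M d * (\<rho> * norm (z - cemb x)) ^ d)"
      using C by (intro mult_left_mono) auto
    then show ?thesis using dF[of z] by (simp add: B_def power_mult_distrib mult_ac)
  qed
  define a where "a j w = (?DF w (axis j 1) + \<i> * ?DF w (axis j \<i>)) / 2" for j w
  have acont: "continuous_on UNIV (a j)" for j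
    unfolding a_def by (intro continuous_intros cont) auto
  have abd: "norm (a j w) \<le> B d * norm (w - cemb x) ^ d" if "x \<in> U" for j w x d
    using order_trans[OF Finite_Cartesian_Product.norm_nth_le[of "dbar F w" j] dFB[OF that]]
    by (simp add: a_def dbar_def)
  have a0: "a j w = 0" if "norm w > r" for j w
    by (simp add: a_def has_derivative_outside_support[OF der supp that])
  define P where "P e w = (if fst e then Re (a (snd e) w) else Im (a (snd e) w))" for e w
  have P: "flat_density U r B (P e)" for e
    unfolding flat_density_def
  proof (intro conjI allI impI ballI)
    have "continuous_on UNIV (P e)"
      unfolding P_def using acont by (cases "fst e") (auto intro!: continuous_intros)
    then show "P e \<in> borel_measurable borel" by (rule borel_measurable_continuous_onI)
    show "\<bar>P e w\<bar> \<le> B d * norm (w - cemb x) ^ d" if "x \<in> U" for d x w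
      using abd[OF that, of "snd e" w d] abs_Re_le_cmod[of "a (snd e) w"] abs_Im_le_cmod[of "a (snd e) w"]
      by (auto simp: P_def)
  qed (auto simp: P_def a0 B0)
  \<comment> \<open>A component of the Bochner--Martinelli kernel, split into real and imaginary
    coordinates; its degree is \<open>2 * n - 1\<close>.\<close>
  define g where "g e w x = rel_coord e w x * (1 / ((norm (w - cemb x))\<^sup>2) ^ n)" for e :: "bool \<times> 'n" and w x
  have g: "hom_kernel (2 * n - 1) (Suc (2 * n)) 1 (g e)" for e
    unfolding g_def using hom_kernel.norm_power[of n] n by (intro hom_kernel.coord) simp
  have n1: "2 * n - 1 > 0" using n by simp
  define \<kappa> where "\<kappa> = bm_const TYPE('n)"
  have \<kappa>: "\<kappa> > 0" by (simp add: \<kappa>_def bm_const_pos)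
  have intPg: "integrable lborel (\<lambda>w. P e' w * g e w x)" if "x \<in> U" for e e' x
    by (rule flat_density_kernel_integrable[OF P g n1 that])
  \<comment> \<open>\<open>f\<close> is real, so the real part of the complex formula is taken; the
    real part of a product with a conjugate pairs real parts with real parts and imaginary with
    imaginary.\<close>
  have fx: "f x = (\<Sum>e\<in>UNIV. integral\<^sup>L lborel (\<lambda>w. P e w * (- 1 / \<kappa> * g e w x)))" if x: "x \<in> U" for x
  proof -
    let ?I = "\<lambda>w. \<Sum>j\<in>UNIV. a j w * (cnj ((w - cemb x) $ j) * complex_of_real (1 / ((norm (w - cemb x))\<^sup>2) ^ n))"
    have split: "a j w * (cnj ((w - cemb x) $ j) * complex_of_real (1 / ((norm (w - cemb x))\<^sup>2) ^ n)) =
       complex_of_real (P (True, j) w * g (True, j) w x + P (False, j) w * g (False, j) w x)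
       + \<i> * complex_of_real (P (False, j) w * g (True, j) w x - P (True, j) w * g (False, j) w x)" for j w
    proof -
      have gen: "b * (cnj u * complex_of_real q) = complex_of_real (Re b * (Re u * q) + Im b * (Im u * q))
          + \<i> * complex_of_real (Im b * (Re u * q) - Re b * (Im u * q))" for b u q
        by (simp add: complex_eq_iff algebra_simps)
      have "rel_coord (True, j) w x = Re ((w - cemb x) $ j)" "rel_coord (False, j) w x = Im ((w - cemb x) $ j)"
        by (simp_all add: rel_coord_def cemb_def)
      then show ?thesis unfolding gen P_def g_def by simp
    qed
    have "integrable lborel ?I"
      unfolding split
      by (intro Bochner_Integration.integrable_sum Bochner_Integration.integrable_add integrable_mult_right
          integrable_of_real Bochner_Integration.integrable_diff intPg x)
    then have "Re (integral\<^sup>L lborel ?I) = integral\<^sup>L lborel (\<lambda>w. Re (?I w))"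
      by (rule integral_Re[symmetric])
    also have "\<dots> = integral\<^sup>L lborel (\<lambda>w. \<Sum>j\<in>UNIV. P (True, j) w * g (True, j) w x + P (False, j) w * g (False, j) w x)"
      unfolding split by simp
    also have "\<dots> = (\<Sum>j\<in>UNIV. integral\<^sup>L lborel (\<lambda>w. P (True, j) w * g (True, j) w x) +
        integral\<^sup>L lborel (\<lambda>w. P (False, j) w * g (False, j) w x))"
      using intPg[OF x] by simp
    also have "\<dots> = (\<Sum>b\<in>UNIV. \<Sum>j\<in>UNIV. integral\<^sup>L lborel (\<lambda>w. P (b, j) w * g (b, j) w x))"
      by (simp add: UNIV_bool sum.distrib)
    also have "\<dots> = (\<Sum>e\<in>UNIV. kernel_integral (P e) (g e) x)"
      by (simp add: sum.cartesian_product UNIV_Times_UNIV)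
    finally have I: "Re (integral\<^sup>L lborel ?I) = (\<Sum>e\<in>UNIV. kernel_integral (P e) (g e) x)" .
    have "integral\<^sup>L lborel ?I = - (\<kappa> * F (cemb x))"
      unfolding a_def n_def \<kappa>_def
      by (rule bochner_martinelli[OF der cont supp, where B = "B (2 * n - 1)"])
        (use abd[OF x, unfolded a_def] n_def in auto)
    then have "Re (integral\<^sup>L lborel ?I) = - \<kappa> * f x" using Ff[OF x] by simp
    then have "f x = - 1 / \<kappa> * (\<Sum>e\<in>UNIV. kernel_integral (P e) (g e) x)"
      using \<kappa> I by (simp add: field_simps)
    then show ?thesis by (simp add: sum_distrib_left mult_ac sum_negf sum_divide_distrib)
  qed
  let ?c = "\<bar>- 1 / \<kappa>\<bar> * 1" and ?D = "Suc (2 * n)" and ?d = "2 * n - 1"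
  have gs: "hom_kernel ?d ?D ?c (\<lambda>w x. - 1 / \<kappa> * g e w x)" for e
    by (rule hom_kernel.scale[OF g])
  have main: "\<exists>G. (\<forall>e. hom_kernel (?d + length is) (?D + 3 * length is) ((\<Prod>i<length is. real (?D + 3 * i)) * ?c) (G e)) \<and>
     (\<forall>x\<in>U. dpart is f x = (\<Sum>e\<in>UNIV. kernel_integral (P e) (G e) x) \<and> dpart is f differentiable (at x))" for "is"
    using dpart_flat_integral[OF U finite P n1 gs fx, of "is"] by simp
  have smooth: "smooth_on U f" unfolding smooth_on_def using main by blast
  obtain N Cs where N: "N \<in> \<MM>" and Cs: "Cs \<ge> 1" and NM: "\<And>j. M (j + ?d) \<le> Cs ^ Suc j * N j"
    using R_regular_shift[OF R M, of ?d] by blast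
  have wM: "weight_sequence M" and wN: "weight_sequence N"
    using R M N by (auto simp: R_regular_def weight_matrix_def)
  define K where "K = real (2 * n) * ((1 / \<kappa>) * measure lborel (cball (0::complex^'n) r) * C * \<rho> ^ ?d * Cs)"
  define \<sigma> where "\<sigma> = \<rho> * real (?D + 3) * Cs"
  have \<sigma>: "\<sigma> > 0" using \<rho> Cs by (simp add: \<sigma>_def)
  have "\<bar>dpart is f x\<bar> / (\<sigma> ^ length is * N (length is)) \<le> K" if x: "x \<in> U" for x "is"
  proof -
    let ?k = "length is"
    obtain G where G: "\<And>e. hom_kernel (?d + ?k) (?D + 3 * ?k) ((\<Prod>i<?k. real (?D + 3 * i)) * ?c) (G e)"
      "dpart is f x = (\<Sum>e\<in>UNIV. kernel_integral (P e) (G e) x)"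
      using main[of "is"] x by blast
    let ?V = "measure lborel (cball (0::complex^'n) r)"
    let ?E = "B (?d + ?k) * ((\<Prod>i<?k. real (?D + 3 * i)) * ?c) * ?V"
    have "\<bar>dpart is f x\<bar> \<le> (\<Sum>e\<in>(UNIV::(bool \<times> 'n) set). ?E)"
      unfolding G(2) using n1
      by (intro order_trans[OF sum_abs] sum_mono flat_density_kernel_integral_bound[OF P G(1) _ x]) auto
    also have "\<dots> = real (2 * n) * ?E" by (simp add: n_def card_UNIV_bool flip: UNIV_Times_UNIV)
    also have "\<dots> \<le> real (2 * n) * ((C * (M (?k + ?d) / fact ?k * \<rho> ^ (?d + ?k))) * ((real (?D + 3) ^ ?k * fact ?k) * ?c) * ?V)"
    proof (intro mult_left_mono mult_right_mono mult_mono prod_arith_le_fact)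
      \<comment> \<open>Replacing \<open>fact (?d + ?k)\<close> by the smaller
        \<open>fact ?k\<close> leaves exactly the factorial that the product of complexities
        produces.\<close>
      have "fact ?k \<le> (fact (?d + ?k) :: real)" by (intro fact_mono) auto
      then have "M (?d + ?k) / fact (?d + ?k) \<le> M (?k + ?d) / fact ?k"
        using wM unfolding add.commute[of ?d]
        by (intro divide_left_mono) (auto simp: weight_sequence_def less_imp_le)
      then show "B (?d + ?k) \<le> C * (M (?k + ?d) / fact ?k * \<rho> ^ (?d + ?k))"
        unfolding B_def small_seq_def using C \<rho> by (intro mult_left_mono mult_right_mono) auto
      show "0 \<le> C * (M (?k + ?d) / fact ?k * \<rho> ^ (?d + ?k))"
        using wM C \<rho> by (auto simp: weight_sequence_def less_imp_le)
    qed (auto intro!: mult_nonneg_nonneg prod_nonneg)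
    also have "\<dots> = real (2 * n) * ((1 / \<kappa>) * ?V * C * \<rho> ^ ?d) * (\<rho> * real (?D + 3)) ^ ?k * M (?k + ?d)"
      using \<kappa> by (simp add: power_add power_mult_distrib mult_ac)
    also have "\<dots> \<le> real (2 * n) * ((1 / \<kappa>) * ?V * C * \<rho> ^ ?d) * (\<rho> * real (?D + 3)) ^ ?k * (Cs ^ Suc ?k * N ?k)"
      using \<kappa> C \<rho> by (intro mult_left_mono NM) (auto intro!: mult_nonneg_nonneg)
    also have "\<dots> = K * (\<sigma> ^ ?k * N ?k)"
      by (simp add: K_def \<sigma>_def power_mult_distrib mult_ac)
    finally show ?thesis using \<sigma> wN by (simp add: weight_sequence_def pos_divide_le_eq)
  qed
  then show ?thesis unfolding B_roumieu_def using smooth N \<sigma> by blast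
qed

section \<open>A lattice partition of unity\<close>

definition sq_pos :: "real \<Rightarrow> real" where
  "sq_pos t = (max 0 t)\<^sup>2"

lemma sq_pos_deriv: "(sq_pos has_real_derivative 2 * max 0 t) (at t)"
proof -
  consider "t > 0" | "t < 0" | "t = 0" by linarith
  then show ?thesis
  proof cases
    case 1
    have "((\<lambda>t. t\<^sup>2) has_real_derivative 2 * max 0 t) (at t)"
      using 1 by (auto intro!: derivative_eq_intros)
    then show ?thesis
      by (rule has_field_derivative_transform_within_open[where S = "{0<..}"]) (use 1 in \<open>auto simp: sq_pos_def\<close>)
  next
    case 2
    have "((\<lambda>t. 0) has_real_derivative 2 * max 0 t) (at t)"
      using 2 by auto
    then show ?thesis
      by (rule has_field_derivative_transform_within_open[where S = "{..<0}"]) (use 2 in \<open>auto simp: sq_pos_def\<close>)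
  next
    case 3
    have "((\<lambda>h. sq_pos h / h) \<longlongrightarrow> 0) (at 0)"
    proof (rule Lim_null_comparison)
      show "\<forall>\<^sub>F h in at 0. norm (sq_pos h / h) \<le> \<bar>h\<bar>"
        by (rule always_eventually) (auto simp: sq_pos_def power2_eq_square max_def)
      show "((\<lambda>h::real. \<bar>h\<bar>) \<longlongrightarrow> 0) (at 0)" by (rule tendsto_rabs_zero) (rule tendsto_ident_at)
    qed
    moreover have "sq_pos 0 = 0" by (simp add: sq_pos_def)
    ultimately show ?thesis using 3 by (simp add: DERIV_def)
  qed
qed

text \<open>The quadratic B-spline with knots 0, 1, 2, 3.\<close>

definition bspline :: "real \<Rightarrow> real" where
  "bspline t = (sq_pos t - 3 * sq_pos (t - 1) + 3 * sq_pos (t - 2) - sq_pos (t - 3)) / 2"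

definition bspline' :: "real \<Rightarrow> real" where
  "bspline' t = max 0 t - 3 * max 0 (t - 1) + 3 * max 0 (t - 2) - max 0 (t - 3)"

lemma bspline_deriv: "(bspline has_real_derivative bspline' t) (at t)"
proof -
  have s: "((\<lambda>t. sq_pos (t - c)) has_real_derivative 2 * max 0 (t - c)) (at t)" for c
    using DERIV_shift[of sq_pos "2 * max 0 (t - c)" t "- c"] sq_pos_deriv[of "t - c"] by simp
  have "((\<lambda>t. (sq_pos (t - 0) - 3 * sq_pos (t - 1) + 3 * sq_pos (t - 2) - sq_pos (t - 3)) / 2) has_real_derivative
      (2 * max 0 (t - 0) - 3 * (2 * max 0 (t - 1)) + 3 * (2 * max 0 (t - 2)) - 2 * max 0 (t - 3)) / 2) (at t)"
    by (intro DERIV_cdivide DERIV_diff DERIV_add DERIV_cmult s)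
  moreover have "(2 * max 0 (t - 0) - 3 * (2 * max 0 (t - 1)) + 3 * (2 * max 0 (t - 2)) - 2 * max 0 (t - 3)) / 2 = bspline' t"
    by (simp add: bspline'_def)
  ultimately show ?thesis by (simp add: bspline_def[abs_def])
qed

lemma bspline_cont: "continuous_on A bspline"
  by (intro continuous_at_imp_continuous_on ballI DERIV_isCont[OF bspline_deriv])

lemma bspline'_cont: "continuous_on A bspline'"
  unfolding bspline'_def by (intro continuous_intros)

lemma bspline_eq_0: "t \<le> 0 \<or> t \<ge> 3 \<Longrightarrow> bspline t = 0"
  by (auto simp: bspline_def sq_pos_def max_def power2_eq_square algebra_simps)

lemma bspline'_eq_0: "t \<le> 0 \<or> t \<ge> 3 \<Longrightarrow> bspline' t = 0"
  by (auto simp: bspline'_def max_def)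

lemma bspline_bound: "\<bar>bspline t\<bar> \<le> 12"
proof (cases "t \<le> 0 \<or> t \<ge> 3")
  case False
  have le: "0 \<le> sq_pos s" "s \<le> c \<Longrightarrow> c \<ge> 0 \<Longrightarrow> sq_pos s \<le> c\<^sup>2" for s c
    unfolding sq_pos_def by (auto intro!: power_mono)
  have "sq_pos t \<le> 3\<^sup>2" "sq_pos (t - 1) \<le> 2\<^sup>2" "sq_pos (t - 2) \<le> 1\<^sup>2" "sq_pos (t - 3) \<le> 0\<^sup>2"
    using False le(2)[of t 3] le(2)[of "t - 1" 2] le(2)[of "t - 2" 1] le(2)[of "t - 3" 0] by simp_all
  with le(1)[of t] le(1)[of "t - 1"] le(1)[of "t - 2"] le(1)[of "t - 3"]
  have "0 \<le> sq_pos t" "sq_pos t \<le> 9" "0 \<le> sq_pos (t - 1)" "sq_pos (t - 1) \<le> 4"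
    "0 \<le> sq_pos (t - 2)" "sq_pos (t - 2) \<le> 1" "sq_pos (t - 3) = 0" by auto
  then show ?thesis unfolding bspline_def by simp
qed (simp add: bspline_eq_0)

lemma bspline'_bound: "\<bar>bspline' t\<bar> \<le> 12"
proof (cases "t \<le> 0 \<or> t \<ge> 3")
  case False
  then show ?thesis unfolding bspline'_def by (auto simp: max_def)
qed (simp add: bspline'_eq_0)

text \<open>The three quadratic pieces over a common unit interval add up to 1 exactly, so the
  partition of unity comes without a normalising denominator.\<close>

lemma bspline_sum: "(\<Sum>l\<in>{\<lfloor>t\<rfloor> - 2..\<lfloor>t\<rfloor>}. bspline (t - of_int l)) = 1"
proof -
  have eq: "{\<lfloor>t\<rfloor> - 2..\<lfloor>t\<rfloor>} = {\<lfloor>t\<rfloor> - 2, \<lfloor>t\<rfloor> - 1, \<lfloor>t\<rfloor>}" by auto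
  define u where "u = t - of_int \<lfloor>t\<rfloor>"
  have u: "0 \<le> u" "u < 1" by (simp_all add: u_def) linarith+
  have "(\<Sum>l\<in>{\<lfloor>t\<rfloor> - 2..\<lfloor>t\<rfloor>}. bspline (t - of_int l)) = bspline (u + 2) + bspline (u + 1) + bspline u"
    unfolding eq u_def by (simp add: algebra_simps)
  also have "\<dots> = 1"
    using u by (simp add: bspline_def sq_pos_def max_def) (simp add: power2_eq_square field_simps)
  finally show ?thesis .
qed

text \<open>A tensor product spline living on the cube of side \<open>3 * d\<close> with lower
  corner \<open>lattice_node d l\<close>.\<close>

definition lattice_bump :: "real \<Rightarrow> ('a::euclidean_space \<Rightarrow> int) \<Rightarrow> 'a \<Rightarrow> real" where
  "lattice_bump d l z = (\<Prod>b\<in>Basis. bspline (inner z b / d - l b))"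

definition lattice_bump' :: "real \<Rightarrow> ('a::euclidean_space \<Rightarrow> int) \<Rightarrow> 'a \<Rightarrow> 'a \<Rightarrow> real" where
  "lattice_bump' d l z v =
     (\<Sum>b\<in>Basis. (bspline' (inner z b / d - l b) * (inner v b / d)) * (\<Prod>c\<in>Basis - {b}. bspline (inner z c / d - l c)))"

definition lattice_node :: "real \<Rightarrow> ('a::euclidean_space \<Rightarrow> int) \<Rightarrow> 'a" where
  "lattice_node d l = (\<Sum>b\<in>Basis. (d * l b) *\<^sub>R b)"

text \<open>Collects the indices whose bump can be nonzero at \<open>z\<close>. \<open>PiE\<close>
  fixes the index functions outside \<open>Basis\<close>, so that equal nodes have equal indices and
  the set is finite.\<close>

definition lattice_near :: "real \<Rightarrow> 'a::euclidean_space \<Rightarrow> ('a \<Rightarrow> int) set" where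
  "lattice_near d z = PiE Basis (\<lambda>b. {\<lfloor>inner z b / d\<rfloor> - 2..\<lfloor>inner z b / d\<rfloor>})"

lemma finite_lattice_near: "finite (lattice_near d z)"
  unfolding lattice_near_def by (intro finite_PiE) auto

lemma card_lattice_near: "card (lattice_near d (z::'a::euclidean_space)) = 3 ^ DIM('a)"
  unfolding lattice_near_def by (subst card_PiE) auto

lemma sum_lattice_bump: "(\<Sum>l\<in>lattice_near d z. lattice_bump d l z) = 1"
  unfolding lattice_near_def lattice_bump_def
  by (subst prod_sum_PiE[symmetric]) (auto simp: bspline_sum)

lemma lattice_bump_has_derivative:
  assumes "d > 0"
  shows "(lattice_bump d l has_derivative lattice_bump' d l z) (at z)"
proof -
  have "((\<lambda>z. bspline (inner z b / d - l b)) has_derivative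
      (\<lambda>v. bspline' (inner z b / d - l b) * (inner v b / d))) (at z)" for b
  proof -
    have "((\<lambda>z. inner z b / d - l b) has_derivative (\<lambda>v. inner v b / d)) (at z)"
      using assms by (auto intro!: derivative_eq_intros)
    from has_derivative_compose[OF this bspline_deriv[unfolded has_field_derivative_def]]
    show ?thesis .
  qed
  from has_derivative_prod[where I = Basis, OF this]
  show ?thesis unfolding lattice_bump_def lattice_bump'_def
    by (rule has_derivative_eq_rhs) (auto simp: fun_eq_iff)
qed

lemma lattice_bump'_cont: "d > 0 \<Longrightarrow> continuous_on A (\<lambda>z. lattice_bump' d l z v)"
proof -
  assume d: "d > 0"
  have "continuous_on A (\<lambda>z. bspline (inner z b / d - l b))" for b
    by (intro continuous_on_compose2[OF bspline_cont[of UNIV]] continuous_intros) (use d in auto)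
  moreover have "continuous_on A (\<lambda>z. bspline' (inner z b / d - l b))" for b
    by (intro continuous_on_compose2[OF bspline'_cont[of UNIV]] continuous_intros) (use d in auto)
  ultimately show ?thesis unfolding lattice_bump'_def using d
    by (intro continuous_intros) auto
qed

lemma lattice_bump_support:
  assumes d: "d > 0" and l: "l \<in> PiE Basis (\<lambda>_. UNIV)" "l \<notin> lattice_near d z"
  shows "lattice_bump d l z = 0" "lattice_bump' d l z v = 0"
proof -
  obtain b where b: "b \<in> Basis" "l b \<notin> {\<lfloor>inner z b / d\<rfloor> - 2..\<lfloor>inner z b / d\<rfloor>}"
    using l unfolding lattice_near_def PiE_iff by auto
  then have "inner z b / d - l b \<le> 0 \<or> inner z b / d - l b \<ge> 3"
    by (simp add: not_le) linarith
  then have 0: "bspline (inner z b / d - l b) = 0" "bspline' (inner z b / d - l b) = 0"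
    using bspline_eq_0 bspline'_eq_0 by auto
  show "lattice_bump d l z = 0"
    unfolding lattice_bump_def using b 0 by (intro prod_zero) auto
  show "lattice_bump' d l z v = 0"
    unfolding lattice_bump'_def
  proof (intro sum.neutral ballI)
    fix c :: 'a assume c: "c \<in> Basis"
    show "bspline' (inner z c / d - l c) * (inner v c / d) * (\<Prod>c\<in>Basis - {c}. bspline (inner z c / d - l c)) = 0"
    proof (cases "c = b")
      case False
      then have "(\<Prod>c\<in>Basis - {c}. bspline (inner z c / d - l c)) = 0"
        using b 0 by (intro prod_zero) auto
      then show ?thesis by simp
    qed (use 0 in simp)
  qed
qed

text \<open>Each coordinate differs by at most \<open>3 * d\<close>, and the norm is at most the sum
  of the absolute coordinates. This is the origin of \<open>s = 3 * real DIM(complex^'n)\<close>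
  below.\<close>

lemma lattice_near_node:
  assumes d: "d > 0" and l: "l \<in> lattice_near d (z::'a::euclidean_space)"
  shows "norm (z - lattice_node d l) \<le> 3 * real DIM('a) * d"
proof -
  have "\<bar>inner (z - lattice_node d l) b\<bar> \<le> 3 * d" if b: "b \<in> Basis" for b
  proof -
    have "l b \<in> {\<lfloor>inner z b / d\<rfloor> - 2..\<lfloor>inner z b / d\<rfloor>}"
      using l b by (auto simp: lattice_near_def PiE_iff)
    then have "0 \<le> inner z b / d - l b" "inner z b / d - l b \<le> 3"
      by (simp_all add: le_floor_iff) linarith+
    moreover have "inner (z - lattice_node d l) b = d * (inner z b / d - l b)"
      using b d by (simp add: lattice_node_def inner_diff_left inner_sum_left_Basis field_simps)
    ultimately show ?thesis using d by (simp add: abs_mult mult.commute[of d])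
  qed
  then have "norm (z - lattice_node d l) \<le> (\<Sum>b\<in>(Basis::'a set). 3 * d)"
    by (intro order_trans[OF norm_le_l1] sum_mono)
  then show ?thesis by (simp add: mult_ac)
qed

lemma prod_bspline_bound:
  assumes "finite A"
  shows "\<bar>\<Prod>c\<in>A. bspline (x c)\<bar> \<le> 12 ^ card A"
proof -
  have "\<bar>\<Prod>c\<in>A. bspline (x c)\<bar> \<le> (\<Prod>c\<in>A. 12)"
    unfolding abs_prod by (intro prod_mono) (auto simp: bspline_bound)
  then show ?thesis by simp
qed

lemma lattice_bump_bound: "\<bar>lattice_bump d l (z::'a::euclidean_space)\<bar> \<le> 12 ^ DIM('a)"
  unfolding lattice_bump_def by (rule prod_bspline_bound) simp

lemma lattice_bump'_bound:
  assumes d: "d > 0"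
  shows "\<bar>lattice_bump' d l z (v::'a::euclidean_space)\<bar> \<le> real DIM('a) * 12 ^ DIM('a) / d * norm v"
proof -
  have "\<bar>(bspline' (inner z b / d - l b) * (inner v b / d)) * (\<Prod>c\<in>Basis - {b}. bspline (inner z c / d - l c))\<bar>
      \<le> (12 * (norm v / d)) * 12 ^ (DIM('a) - 1)" if "b \<in> Basis" for b
  proof -
    have "\<bar>\<Prod>c\<in>Basis - {b}. bspline (inner z c / d - l c)\<bar> \<le> 12 ^ (DIM('a) - 1)"
      using prod_bspline_bound[of "Basis - {b}"] that by (simp add: card_Diff_singleton)
    moreover have "\<bar>inner v b / d\<bar> \<le> norm v / d"
      using Basis_le_norm[OF that, of v] d by (simp add: divide_right_mono)
    ultimately show ?thesis
      unfolding abs_mult using d by (intro mult_mono bspline'_bound) auto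
  qed
  then have "\<bar>lattice_bump' d l z v\<bar> \<le> (\<Sum>b\<in>(Basis::'a set). (12 * (norm v / d)) * 12 ^ (DIM('a) - 1))"
    unfolding lattice_bump'_def by (intro order_trans[OF sum_abs] sum_mono)
  also have "\<dots> = real DIM('a) * (12 * 12 ^ (DIM('a) - 1)) / d * norm v" by (simp add: mult_ac)
  also have "12 * 12 ^ (DIM('a) - 1) = (12::real) ^ DIM('a)"
    using DIM_positive[where 'a='a] by (simp flip: power_Suc)
  finally show ?thesis .
qed

section \<open>Gluing of local holomorphic approximations\<close>

text \<open>Domination by the summable \<open>A\<close> makes the series of derivatives converge
  uniformly on the whole space, which gives both termwise differentiation and continuity of the
  sum.\<close>

lemma C1_series:
  fixes f :: "nat \<Rightarrow> 'a::euclidean_space \<Rightarrow> 'b::banach"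
  assumes der: "\<And>k z. (f k has_derivative f' k z) (at z)"
    and cont: "\<And>k v. continuous_on UNIV (\<lambda>z. f' k z v)"
    and bd: "\<And>k z v. norm (f' k z v) \<le> A k * norm v" and A: "summable A"
    and sm: "\<And>z. summable (\<lambda>k. f k z)"
  shows "((\<lambda>z. \<Sum>k. f k z) has_derivative (\<lambda>v. \<Sum>k. f' k z v)) (at z)"
    and "continuous_on UNIV (\<lambda>z. \<Sum>k. f' k z v)"
proof -
  have sm': "summable (\<lambda>k. f' k z v)" for z v
    using bd by (intro summable_comparison_test[OF _ summable_mult2[OF A, of "norm v"]]) auto
  have tail: "norm ((\<Sum>i<n. f' i z v) - (\<Sum>k. f' k z v)) \<le> (\<Sum>i. A (i + n)) * norm v" for n z v
  proof -
    have "norm ((\<Sum>i<n. f' i z v) - (\<Sum>k. f' k z v)) = norm (\<Sum>i. f' (i + n) z v)"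
      using suminf_split_initial_segment[OF sm'[of z v], of n] by (simp add: norm_minus_commute)
    also have "\<dots> \<le> (\<Sum>i. A (i + n) * norm v)"
    proof (rule norm_suminf_le)
      show "summable (\<lambda>i. A (i + n) * norm v)"
        using A by (intro summable_mult2) (simp add: summable_iff_shift)
    qed (rule bd)
    also have "\<dots> = (\<Sum>i. A (i + n)) * norm v"
      using A by (intro suminf_mult2[symmetric]) (simp add: summable_iff_shift)
    finally show ?thesis .
  qed
  have "\<exists>g. \<forall>x\<in>UNIV. (\<lambda>n. f n x) sums g x \<and> (g has_derivative (\<lambda>v. \<Sum>k. f' k x v)) (at x within UNIV)"
  proof (rule has_derivative_series)
    show "(f n has_derivative f' n x) (at x within UNIV)" for n x using der by simp
    show "(\<lambda>k. f k 0) sums (\<Sum>k. f k 0)" using sm by (rule summable_sums)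
    fix e :: real assume "e > 0"
    obtain N where N: "\<And>n. n \<ge> N \<Longrightarrow> norm (\<Sum>i. A (i + n)) < e"
      using suminf_exist_split[OF \<open>e > 0\<close> A] by blast
    have "norm ((\<Sum>i<n. f' i x h) - (\<Sum>k. f' k x h)) \<le> e * norm h" if "n \<ge> N" for n x h
    proof -
      have "(\<Sum>i. A (i + n)) * norm h \<le> e * norm h"
        using N[OF that] by (intro mult_right_mono) auto
      then show ?thesis using tail[of x h n] by linarith
    qed
    then show "\<forall>\<^sub>F n in sequentially. \<forall>x\<in>UNIV. \<forall>h. norm ((\<Sum>i<n. f' i x h) - (\<Sum>k. f' k x h)) \<le> e * norm h"
      unfolding eventually_sequentially by blast
  qed auto
  then obtain g where g: "\<And>x. (\<lambda>n. f n x) sums g x" "\<And>x. (g has_derivative (\<lambda>v. \<Sum>k. f' k x v)) (at x)"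
    by auto
  have "g = (\<lambda>z. \<Sum>k. f k z)" using g(1) sums_unique by (auto simp: fun_eq_iff)
  then show "((\<lambda>z. \<Sum>k. f k z) has_derivative (\<lambda>v. \<Sum>k. f' k z v)) (at z)" using g(2) by simp
  show "continuous_on UNIV (\<lambda>z. \<Sum>k. f' k z v)"
  proof (rule uniform_limit_theorem)
    show "uniform_limit UNIV (\<lambda>n z. \<Sum>i<n. f' i z v) (\<lambda>z. \<Sum>k. f' k z v) sequentially"
      by (rule Weierstrass_m_test[OF bd summable_mult2[OF A]])
    show "\<forall>\<^sub>F n in sequentially. continuous_on UNIV (\<lambda>z. \<Sum>i<n. f' i z v)"
      by (intro always_eventually allI continuous_on_sum cont)
  qed simp
qed

text \<open>The radius \<open>4 * s * d\<close> is chosen so that a point within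
  \<open>3 * s * d\<close> of \<open>S\<close> has all its nearby nodes in the set, these being at
  most \<open>s * d\<close> away.\<close>

definition patch_index :: "'a::euclidean_space set \<Rightarrow> real \<Rightarrow> real \<Rightarrow> ('a \<Rightarrow> int) set" where
  "patch_index S s d = {l \<in> PiE Basis (\<lambda>_. UNIV). infdist (lattice_node d l) S < 4 * s * d}"

lemma finite_patch_index:
  assumes S: "bounded S" "S \<noteq> {}" and d: "d > 0"
  shows "finite (patch_index S s d)"
proof -
  obtain R where R: "\<And>x. x \<in> S \<Longrightarrow> norm x \<le> R" using S by (auto simp: bounded_iff)
  define K where "K = \<lceil>(R + 4 * s * d) / d\<rceil>"
  have "patch_index S s d \<subseteq> PiE Basis (\<lambda>_. {- K..K})"
  proof
    fix l assume l: "l \<in> patch_index S s d"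
    then have "infdist (lattice_node d l) S < 4 * s * d" by (simp add: patch_index_def)
    then obtain y where y: "y \<in> S" "dist (lattice_node d l) y < 4 * s * d"
      using S(2) by (metis (mono_tags, lifting) cINF_less_iff bdd_below_image_dist infdist_notempty)
    have "norm (lattice_node d l) \<le> norm y + dist (lattice_node d l) y"
      using norm_triangle_ineq[of y "lattice_node d l - y"] by (simp add: dist_norm)
    then have n: "norm (lattice_node d l) \<le> R + 4 * s * d" using y R[OF y(1)] by linarith
    have "l b \<in> {- K..K}" if b: "b \<in> Basis" for b
    proof -
      have "\<bar>d * l b\<bar> \<le> R + 4 * s * d"
        using Basis_le_norm[OF b, of "lattice_node d l"] n b
        by (simp add: lattice_node_def inner_sum_left_Basis)
      then have "\<bar>of_int (l b)\<bar> \<le> (R + 4 * s * d) / d"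
        using d by (simp add: abs_mult field_simps)
      then have "of_int \<bar>l b\<bar> \<le> (R + 4 * s * d) / d" by simp
      then have "\<bar>l b\<bar> \<le> K" unfolding K_def by linarith
      then show ?thesis by auto
    qed
    then show "l \<in> PiE Basis (\<lambda>_. {- K..K})"
      using l by (auto simp: patch_index_def PiE_iff)
  qed
  moreover have "finite (PiE (Basis::'a set) (\<lambda>_. {- K..K}))" by (intro finite_PiE) auto
  ultimately show ?thesis by (rule finite_subset)
qed

text \<open>The patches \<open>T k l\<close> only have to be compatible where the bumps of \<open>l\<close> and \<open>l'\<close> are both nonzero;
  \<open>s * \<delta> k\<close> bounds the distance from such a point to the nodes.\<close>

locale patches =
  fixes S :: "(complex^'n) set" and s :: real and \<delta>0 :: real and \<delta> :: "nat \<Rightarrow> real"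
    and T :: "nat \<Rightarrow> (complex^'n \<Rightarrow> int) \<Rightarrow> complex^'n \<Rightarrow> complex"
    and T' :: "nat \<Rightarrow> (complex^'n \<Rightarrow> int) \<Rightarrow> complex^'n \<Rightarrow> complex^'n \<Rightarrow> complex"
    and H G :: "nat \<Rightarrow> real"
  assumes S: "compact S" "S \<noteq> {}" and s: "s = 3 * real DIM(complex^'n)"
    and \<delta>0: "\<delta>0 > 0" and \<delta>: "\<And>k. \<delta> k = \<delta>0 / 2 ^ k"
    and T_der: "\<And>k l z. l \<in> patch_index S s (\<delta> k) \<Longrightarrow> (T k l has_derivative T' k l z) (at z)"
    and T_cont: "\<And>k l v. l \<in> patch_index S s (\<delta> k) \<Longrightarrow> continuous_on UNIV (\<lambda>z. T' k l z v)"
    and T_hol: "\<And>k l z j. l \<in> patch_index S s (\<delta> k) \<Longrightarrow> T' k l z (axis j \<i>) = \<i> * T' k l z (axis j 1)"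
    and T_near: "\<And>k l l' z. l \<in> patch_index S s (\<delta> k) \<Longrightarrow> l' \<in> patch_index S s (\<delta> k) \<Longrightarrow>
       norm (z - lattice_node (\<delta> k) l) \<le> s * \<delta> k \<Longrightarrow> norm (z - lattice_node (\<delta> k) l') \<le> s * \<delta> k \<Longrightarrow>
       norm (T k l z - T k l' z) \<le> H k"
    and T_cross: "\<And>k l l' z. l \<in> patch_index S s (\<delta> (Suc k)) \<Longrightarrow> l' \<in> patch_index S s (\<delta> k) \<Longrightarrow>
       norm (z - lattice_node (\<delta> (Suc k)) l) \<le> s * \<delta> (Suc k) \<Longrightarrow> norm (z - lattice_node (\<delta> k) l') \<le> s * \<delta> k \<Longrightarrow>
       norm (T (Suc k) l z - T k l' z) \<le> H k"
    and T_cross': "\<And>k l l' z v. l \<in> patch_index S s (\<delta> (Suc k)) \<Longrightarrow> l' \<in> patch_index S s (\<delta> k) \<Longrightarrow>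
       norm (z - lattice_node (\<delta> (Suc k)) l) \<le> s * \<delta> (Suc k) \<Longrightarrow> norm (z - lattice_node (\<delta> k) l') \<le> s * \<delta> k \<Longrightarrow>
       norm (T' (Suc k) l z v - T' k l' z v) \<le> G k * norm v"
    and H: "\<And>k. H k \<ge> 0" "summable (\<lambda>k. H k / \<delta> k)" and G: "\<And>k. G k \<ge> 0" "summable G"
begin

abbreviation L :: "nat \<Rightarrow> (complex^'n \<Rightarrow> int) set" where "L k \<equiv> patch_index S s (\<delta> k)"
abbreviation \<phi> :: "nat \<Rightarrow> (complex^'n \<Rightarrow> int) \<Rightarrow> complex^'n \<Rightarrow> real" where "\<phi> k \<equiv> lattice_bump (\<delta> k)"
abbreviation \<phi>' :: "nat \<Rightarrow> (complex^'n \<Rightarrow> int) \<Rightarrow> complex^'n \<Rightarrow> complex^'n \<Rightarrow> real" where "\<phi>' k \<equiv> lattice_bump' (\<delta> k)"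
abbreviation near :: "nat \<Rightarrow> complex^'n \<Rightarrow> (complex^'n \<Rightarrow> int) set" where "near k \<equiv> lattice_near (\<delta> k)"
abbreviation d :: "complex^'n \<Rightarrow> real" where "d z \<equiv> infdist z S"

lemma \<delta>_pos: "\<delta> k > 0" using \<delta>0 by (simp add: \<delta>)

lemma \<delta>_Suc: "\<delta> (Suc k) = \<delta> k / 2" by (simp add: \<delta>)

lemma s_pos: "s > 0" by (simp add: s)

lemma finite_L: "finite (L k)"
  using S \<delta>_pos by (intro finite_patch_index compact_imp_bounded) auto

lemma near_node: "l \<in> near k z \<Longrightarrow> norm (z - lattice_node (\<delta> k) l) \<le> s * \<delta> k"
  unfolding s by (rule lattice_near_node[OF \<delta>_pos])

lemma outside_near:
  assumes "l \<in> L k" "l \<notin> near k z"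
  shows "\<phi> k l z = 0" "\<phi>' k l z v = 0"
  using lattice_bump_support[OF \<delta>_pos _ assms(2)] assms(1) by (auto simp: patch_index_def)

text \<open>The node is within \<open>4 * s * \<delta> k\<close> of \<open>S\<close> and within
  \<open>s * \<delta> k\<close> of \<open>z\<close>. So everything built at scale \<open>k\<close>
  lives at distance below \<open>5 * s * \<delta> k\<close>, while by \<open>sum_\<phi>\<close> the
  bumps sum to 1 at distance below \<open>3 * s * \<delta> k\<close>.\<close>

lemma near_dist:
  assumes "l \<in> L k" "l \<in> near k z"
  shows "d z < 5 * s * \<delta> k"
proof -
  have "d z \<le> infdist (lattice_node (\<delta> k) l) S + dist z (lattice_node (\<delta> k) l)" by (rule infdist_triangle)
  moreover have "infdist (lattice_node (\<delta> k) l) S < 4 * s * \<delta> k" using assms(1) by (simp add: patch_index_def)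
  ultimately show ?thesis using near_node[OF assms(2)] by (simp add: dist_norm)
qed

lemma near_subset_L:
  assumes "d z < 3 * s * \<delta> k"
  shows "near k z \<subseteq> L k"
proof
  fix l assume l: "l \<in> near k z"
  have "infdist (lattice_node (\<delta> k) l) S \<le> d z + dist (lattice_node (\<delta> k) l) z" by (rule infdist_triangle)
  then have "infdist (lattice_node (\<delta> k) l) S < 4 * s * \<delta> k"
    using near_node[OF l] assms by (simp add: dist_norm norm_minus_commute)
  then show "l \<in> L k" using l by (auto simp: patch_index_def lattice_near_def PiE_iff)
qed

lemma sum_\<phi>:
  assumes "d z < 3 * s * \<delta> k"
  shows "(\<Sum>l\<in>L k. \<phi> k l z) = 1"
proof -
  have "(\<Sum>l\<in>L k. \<phi> k l z) = (\<Sum>l\<in>near k z. \<phi> k l z)"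
    using near_subset_L[OF assms] finite_L outside_near by (intro sum.mono_neutral_right) auto
  then show ?thesis by (simp add: sum_lattice_bump)
qed

definition overlap :: real where "overlap = 3 ^ DIM(complex^'n)"
definition bump_max :: real where "bump_max = 12 ^ DIM(complex^'n)"
definition slope :: real where "slope = real DIM(complex^'n) * 12 ^ DIM(complex^'n)"

lemma overlap_pos: "overlap > 0" by (simp add: overlap_def)
lemma bump_max_pos: "bump_max > 0" by (simp add: bump_max_def)
lemma slope_pos: "slope > 0" by (simp add: slope_def)

lemma \<phi>_bound: "\<bar>\<phi> k l z\<bar> \<le> bump_max"
  unfolding bump_max_def by (rule lattice_bump_bound)

lemma \<phi>'_bound: "\<bar>\<phi>' k l z v\<bar> \<le> slope / \<delta> k * norm v"
  unfolding slope_def by (rule lattice_bump'_bound[OF \<delta>_pos])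

lemma sum_near_bound:
  fixes X :: "_ \<Rightarrow> 'c::real_normed_vector"
  assumes "\<And>l. l \<in> L k \<Longrightarrow> l \<notin> near k z \<Longrightarrow> X l = 0"
    and "\<And>l. l \<in> L k \<Longrightarrow> l \<in> near k z \<Longrightarrow> norm (X l) \<le> K" and "K \<ge> 0"
  shows "norm (\<Sum>l\<in>L k. X l) \<le> overlap * K"
proof -
  have "(\<Sum>l\<in>L k. X l) = (\<Sum>l\<in>L k \<inter> near k z. X l)"
    using assms(1) finite_L by (intro sum.mono_neutral_right) auto
  also have "norm \<dots> \<le> (\<Sum>l\<in>L k \<inter> near k z. K)"
    using assms(2) by (intro sum_norm_le) auto
  also have "\<dots> = real (card (L k \<inter> near k z)) * K" by simp
  also have "\<dots> \<le> overlap * K"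
  proof (intro mult_right_mono assms)
    have "card (L k \<inter> near k z) \<le> card (near k z)"
      by (intro card_mono finite_lattice_near) auto
    then show "real (card (L k \<inter> near k z)) \<le> overlap"
      unfolding overlap_def card_lattice_near by (metis of_nat_le_iff of_nat_numeral of_nat_power)
  qed
  finally show ?thesis .
qed

definition layer :: "nat \<Rightarrow> complex^'n \<Rightarrow> complex" where
  "layer k z = (\<Sum>l\<in>L k. complex_of_real (\<phi> k l z) * T k l z)"

definition layer' :: "nat \<Rightarrow> complex^'n \<Rightarrow> complex^'n \<Rightarrow> complex" where
  "layer' k z v = (\<Sum>l\<in>L k. complex_of_real (\<phi> k l z) * T' k l z v + complex_of_real (\<phi>' k l z v) * T k l z)"

text \<open>Where both partitions sum to 1 this is \<open>layer (Suc k) z - layer k z\<close>. The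
  double sum of differences is preferred because it is small everywhere by \<open>T_cross\<close>,
  also where a partition is incomplete.\<close>

definition correction :: "nat \<Rightarrow> complex^'n \<Rightarrow> complex" where
  "correction k z = (\<Sum>l\<in>L (Suc k). \<Sum>l'\<in>L k.
     complex_of_real (\<phi> (Suc k) l z * \<phi> k l' z) * (T (Suc k) l z - T k l' z))"

definition correction' :: "nat \<Rightarrow> complex^'n \<Rightarrow> complex^'n \<Rightarrow> complex" where
  "correction' k z v = (\<Sum>l\<in>L (Suc k). \<Sum>l'\<in>L k.
     complex_of_real (\<phi> (Suc k) l z * \<phi> k l' z) * (T' (Suc k) l z v - T' k l' z v) +
     complex_of_real (\<phi> (Suc k) l z * \<phi>' k l' z v + \<phi>' (Suc k) l z v * \<phi> k l' z) * (T (Suc k) l z - T k l' z))"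

lemma layer_has_derivative: "(layer k has_derivative layer' k z) (at z)"
  unfolding layer_def[abs_def] layer'_def[abs_def]
  by (intro has_derivative_sum has_derivative_mult has_derivative_of_real
      lattice_bump_has_derivative[OF \<delta>_pos] T_der)

lemma T_continuous: "l \<in> L k \<Longrightarrow> continuous_on UNIV (T k l)"
  using has_derivative_continuous[OF T_der] by (auto simp: continuous_on_eq_continuous_at)

lemma \<phi>_continuous: "continuous_on UNIV (\<phi> k l)"
  using has_derivative_continuous[OF lattice_bump_has_derivative[OF \<delta>_pos]]
  by (auto simp: continuous_on_eq_continuous_at)

lemma layer'_continuous: "continuous_on UNIV (\<lambda>z. layer' k z v)"
  unfolding layer'_def
  by (intro continuous_intros T_continuous T_cont \<phi>_continuous lattice_bump'_cont \<delta>_pos)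

lemma correction_has_derivative: "(correction k has_derivative correction' k z) (at z)"
  unfolding correction_def[abs_def] correction'_def[abs_def]
  by (intro has_derivative_sum has_derivative_mult has_derivative_of_real has_derivative_diff
      lattice_bump_has_derivative[OF \<delta>_pos] T_der)

lemma correction'_continuous: "continuous_on UNIV (\<lambda>z. correction' k z v)"
  unfolding correction'_def
  by (intro continuous_intros T_continuous T_cont \<phi>_continuous lattice_bump'_cont \<delta>_pos)

text \<open>At most \<open>overlap\<close> indices of each of the two scales contribute at a given
  point.\<close>

lemma double_sum_near_bound:
  fixes X :: "_ \<Rightarrow> _ \<Rightarrow> complex"
  assumes X0: "\<And>l l'. l \<in> L (Suc k) \<Longrightarrow> l' \<in> L k \<Longrightarrow> l \<notin> near (Suc k) z \<or> l' \<notin> near k z \<Longrightarrow> X l l' = 0"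
    and XK: "\<And>l l'. l \<in> L (Suc k) \<Longrightarrow> l' \<in> L k \<Longrightarrow> norm (z - lattice_node (\<delta> (Suc k)) l) \<le> s * \<delta> (Suc k) \<Longrightarrow>
      norm (z - lattice_node (\<delta> k) l') \<le> s * \<delta> k \<Longrightarrow> norm (X l l') \<le> K"
    and K: "K \<ge> 0"
  shows "norm (\<Sum>l\<in>L (Suc k). \<Sum>l'\<in>L k. X l l') \<le> overlap * (overlap * K)"
proof (rule sum_near_bound)
  show "0 \<le> overlap * K" using K overlap_pos by simp
  fix l assume l: "l \<in> L (Suc k)"
  show "(\<Sum>l'\<in>L k. X l l') = 0" if "l \<notin> near (Suc k) z" using X0 l that by simp
  show "norm (\<Sum>l'\<in>L k. X l l') \<le> overlap * K" if "l \<in> near (Suc k) z"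
    using X0 XK l near_node that by (intro sum_near_bound[OF _ _ K]) auto
qed

lemma correction_bound: "norm (correction k z) \<le> overlap * (overlap * (bump_max * bump_max * H k))"
  unfolding correction_def
proof (rule double_sum_near_bound)
  show "norm (complex_of_real (\<phi> (Suc k) l z * \<phi> k l' z) * (T (Suc k) l z - T k l' z)) \<le> bump_max * bump_max * H k"
    if "l \<in> L (Suc k)" "l' \<in> L k" "norm (z - lattice_node (\<delta> (Suc k)) l) \<le> s * \<delta> (Suc k)"
      "norm (z - lattice_node (\<delta> k) l') \<le> s * \<delta> k" for l l'
    unfolding norm_mult norm_of_real abs_mult
    using bump_max_pos that by (intro mult_mono \<phi>_bound T_cross) auto
qed (use bump_max_pos H outside_near in auto)

lemma correction'_coeff_bound:
  "\<bar>\<phi> (Suc k) l z * \<phi>' k l' z v + \<phi>' (Suc k) l z v * \<phi> k l' z\<bar> \<le> 3 * bump_max * slope / \<delta> k * norm v"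
proof -
  have "\<bar>\<phi> (Suc k) l z * \<phi>' k l' z v\<bar> \<le> bump_max * (slope / \<delta> k * norm v)"
    unfolding abs_mult using bump_max_pos by (intro mult_mono \<phi>_bound \<phi>'_bound) auto
  moreover have "\<bar>\<phi>' (Suc k) l z v * \<phi> k l' z\<bar> \<le> (slope / \<delta> (Suc k) * norm v) * bump_max"
    unfolding abs_mult using slope_pos \<delta>_pos[of "Suc k"] by (intro mult_mono \<phi>_bound \<phi>'_bound) auto
  moreover have "bump_max * (slope / \<delta> k * norm v) + (slope / \<delta> (Suc k) * norm v) * bump_max
      = 3 * bump_max * slope / \<delta> k * norm v"
    using \<delta>_pos[of k] by (simp add: \<delta>_Suc field_simps)
  ultimately show ?thesis by linarith
qed

lemma correction'_bound:
  "norm (correction' k z v) \<le> overlap * (overlap * (bump_max * bump_max * G k + 3 * bump_max * slope * (H k / \<delta> k))) * norm v"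
proof -
  let ?K = "(bump_max * bump_max * G k + 3 * bump_max * slope * (H k / \<delta> k)) * norm v"
  have "norm (correction' k z v) \<le> overlap * (overlap * ?K)"
    unfolding correction'_def
  proof (rule double_sum_near_bound)
    show "0 \<le> ?K" using bump_max_pos slope_pos H G \<delta>_pos[of k] by simp
    fix l l' assume l: "l \<in> L (Suc k)" "l' \<in> L k" and z: "norm (z - lattice_node (\<delta> (Suc k)) l) \<le> s * \<delta> (Suc k)"
      "norm (z - lattice_node (\<delta> k) l') \<le> s * \<delta> k"
    let ?A = "complex_of_real (\<phi> (Suc k) l z * \<phi> k l' z) * (T' (Suc k) l z v - T' k l' z v)"
    let ?B = "complex_of_real (\<phi> (Suc k) l z * \<phi>' k l' z v + \<phi>' (Suc k) l z v * \<phi> k l' z) * (T (Suc k) l z - T k l' z)"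
    have "norm (?A + ?B) \<le> bump_max * bump_max * (G k * norm v) + (3 * bump_max * slope / \<delta> k * norm v) * H k"
    proof (rule order_trans[OF norm_triangle_ineq add_mono])
      show "norm ?A \<le> bump_max * bump_max * (G k * norm v)"
        unfolding norm_mult norm_of_real abs_mult
        using bump_max_pos by (intro mult_mono \<phi>_bound T_cross' l z) auto
      show "norm ?B \<le> (3 * bump_max * slope / \<delta> k * norm v) * H k"
        unfolding norm_mult[of "complex_of_real _"] norm_of_real
        using bump_max_pos slope_pos \<delta>_pos[of k]
        by (intro mult_mono correction'_coeff_bound T_cross l z) auto
    qed
    then show "norm (?A + ?B) \<le> ?K" by (simp add: algebra_simps)
  qed (use outside_near in auto)
  then show ?thesis by (simp add: mult_ac)
qed

lemma summable_H: "summable H"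
proof (rule summable_comparison_test)
  show "summable (\<lambda>k. \<delta>0 * (H k / \<delta> k))" by (rule summable_mult[OF H(2)])
  have "H k \<le> \<delta>0 * (H k / \<delta> k)" for k
  proof -
    have "H k * 1 \<le> H k * 2 ^ k" using H(1)[of k] by (intro mult_left_mono) auto
    then show ?thesis using \<delta>0 by (simp add: \<delta> mult_ac)
  qed
  then show "\<exists>N. \<forall>n\<ge>N. norm (H n) \<le> \<delta>0 * (H n / \<delta> n)" using H(1) by auto
qed

lemma summable_correction: "summable (\<lambda>k. correction k z)"
proof (rule summable_comparison_test)
  show "summable (\<lambda>k. overlap * (overlap * (bump_max * bump_max * H k)))"
    by (intro summable_mult summable_H)
qed (use correction_bound in blast)

lemma correction_series:
  "((\<lambda>z. \<Sum>k. correction k z) has_derivative (\<lambda>v. \<Sum>k. correction' k z v)) (at z)"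
  "continuous_on UNIV (\<lambda>z. \<Sum>k. correction' k z v)"
proof -
  have "summable (\<lambda>k. overlap * (overlap * (bump_max * bump_max * G k + 3 * bump_max * slope * (H k / \<delta> k))))"
    by (intro summable_mult summable_add G H)
  note C1_series[OF correction_has_derivative correction'_continuous correction'_bound this summable_correction]
  then show "((\<lambda>z. \<Sum>k. correction k z) has_derivative (\<lambda>v. \<Sum>k. correction' k z v)) (at z)"
    "continuous_on UNIV (\<lambda>z. \<Sum>k. correction' k z v)" by auto
qed

text \<open>Near \<open>S\<close> the partial sums are the layers, so on \<open>S\<close> the series
  has the limit of the layers as its value. Off \<open>S\<close> finitely many terms are nonzero;
  the uniform convergence of the differentiated series makes the derivative continuous across
  \<open>S\<close>.\<close>

definition ext :: "complex^'n \<Rightarrow> complex" where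
  "ext z = layer 0 z + (\<Sum>k. correction k z)"

definition ext' :: "complex^'n \<Rightarrow> complex^'n \<Rightarrow> complex" where
  "ext' z v = layer' 0 z v + (\<Sum>k. correction' k z v)"

lemma ext_has_derivative: "(ext has_derivative ext' z) (at z)"
  unfolding ext_def[abs_def] ext'_def[abs_def]
  by (intro has_derivative_add layer_has_derivative correction_series)

lemma ext'_continuous: "continuous_on UNIV (\<lambda>z. ext' z v)"
  unfolding ext'_def by (intro continuous_on_add layer'_continuous correction_series)

lemma layer_eq_0: "d z \<ge> 5 * s * \<delta> k \<Longrightarrow> layer k z = 0"
  unfolding layer_def using near_dist outside_near by (intro sum.neutral ballI) force

lemma correction_eq_0: "d z \<ge> 5 * s * \<delta> (Suc k) \<Longrightarrow> correction k z = 0"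
  unfolding correction_def using near_dist[of _ "Suc k"] outside_near[of _ "Suc k"]
  by (intro sum.neutral ballI) force

lemma \<delta>_antimono: "j \<le> k \<Longrightarrow> \<delta> k \<le> \<delta> j"
  using \<delta>0 by (auto simp: \<delta> intro!: divide_left_mono power_increasing)

lemma ext_C1c: "C1c ext"
  unfolding C1c_def
proof (intro conjI exI[of _ "\<lambda>z. Blinfun (ext' z)"] allI)
  have ap: "blinfun_apply (Blinfun (ext' z)) = ext' z" for z
    using has_derivative_bounded_linear[OF ext_has_derivative] by (rule bounded_linear_Blinfun_apply)
  show "(ext has_derivative blinfun_apply (Blinfun (ext' z))) (at z)" for z
    unfolding ap by (rule ext_has_derivative)
  show "continuous_on UNIV (\<lambda>z. Blinfun (ext' z))"
    by (rule continuous_on_blinfun_componentwise) (simp add: ap ext'_continuous)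
  have "{z. ext z \<noteq> 0} \<subseteq> {z. d z \<le> 5 * s * \<delta>0}"
  proof (intro subsetI CollectI, rule ccontr)
    fix z assume z: "z \<in> {z. ext z \<noteq> 0}" and "\<not> d z \<le> 5 * s * \<delta>0"
    then have far: "d z \<ge> 5 * s * \<delta> k" for k
      using \<delta>_antimono[of 0 k] s_pos mult_left_mono[of "\<delta> k" \<delta>0 "5 * s"] by (simp add: \<delta>)
    then have "ext z = 0" unfolding ext_def by (simp add: layer_eq_0 correction_eq_0)
    then show False using z by simp
  qed
  moreover have "bounded {z. d z \<le> 5 * s * \<delta>0}"
  proof -
    obtain R where R: "\<And>x. x \<in> S \<Longrightarrow> norm x \<le> R"
      using compact_imp_bounded[OF S(1)] by (auto simp: bounded_iff)
    have "norm z \<le> R + 5 * s * \<delta>0" if "d z \<le> 5 * s * \<delta>0" for z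
    proof -
      obtain y where y: "y \<in> S" "d z = dist z y"
        using infdist_attains_inf[OF compact_imp_closed[OF S(1)] S(2)] by metis
      have "norm z \<le> norm y + dist z y"
        using norm_triangle_ineq[of y "z - y"] by (simp add: dist_norm)
      then show ?thesis using y R[OF y(1)] that by linarith
    qed
    then show ?thesis by (auto simp: bounded_iff)
  qed
  ultimately show "compact (closure {z. ext z \<noteq> 0})"
    using bounded_subset by (auto simp: compact_closure)
qed

lemma correction_telescope:
  assumes "d z < 3 * s * \<delta> (Suc k)"
  shows "correction k z = layer (Suc k) z - layer k z"
proof -
  have *: "\<delta> (Suc k) \<le> \<delta> k" by (rule \<delta>_antimono) simp
  have dk: "d z < 3 * s * \<delta> k"
  proof -
    have "3 * s * \<delta> (Suc k) \<le> 3 * s * \<delta> k" using * s_pos by (intro mult_left_mono) auto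
    then show ?thesis using assms by linarith
  qed
  have "correction k z = (\<Sum>l\<in>L (Suc k). complex_of_real (\<phi> (Suc k) l z) * T (Suc k) l z * (\<Sum>l'\<in>L k. complex_of_real (\<phi> k l' z))
     - complex_of_real (\<phi> (Suc k) l z) * (\<Sum>l'\<in>L k. complex_of_real (\<phi> k l' z) * T k l' z))"
    unfolding correction_def sum_distrib_left sum_subtractf[symmetric]
    by (intro sum.cong refl) (simp add: algebra_simps)
  also have "(\<Sum>l'\<in>L k. complex_of_real (\<phi> k l' z)) = 1"
    using sum_\<phi>[OF dk] by (simp flip: of_real_sum)
  also have "(\<Sum>l\<in>L (Suc k). complex_of_real (\<phi> (Suc k) l z) * T (Suc k) l z * 1
     - complex_of_real (\<phi> (Suc k) l z) * (\<Sum>l'\<in>L k. complex_of_real (\<phi> k l' z) * T k l' z))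
     = layer (Suc k) z - (\<Sum>l\<in>L (Suc k). complex_of_real (\<phi> (Suc k) l z)) * layer k z"
    by (simp add: sum_subtractf layer_def sum_distrib_right)
  also have "(\<Sum>l\<in>L (Suc k). complex_of_real (\<phi> (Suc k) l z)) = 1"
    using sum_\<phi>[OF assms] by (simp flip: of_real_sum)
  finally show ?thesis by simp
qed

lemma partial_ext:
  assumes "d z < 3 * s * \<delta> k"
  shows "layer 0 z + (\<Sum>j<k. correction j z) = layer k z"
  using assms
proof (induction k)
  case (Suc k)
  have "\<delta> (Suc k) \<le> \<delta> k" by (rule \<delta>_antimono) simp
  then have "3 * s * \<delta> (Suc k) \<le> 3 * s * \<delta> k" using s_pos by (intro mult_left_mono) auto
  then have "d z < 3 * s * \<delta> k" using Suc.prems by linarith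
  then show ?case using Suc.IH correction_telescope[OF Suc.prems] by (simp add: algebra_simps)
qed simp

text \<open>The distance is small enough for the partial sum to collapse to \<open>layer k\<close>,
  and large enough for all corrections of index above \<open>k\<close> to vanish:
  \<open>5 * s * \<delta> (k + 2)\<close> equals \<open>5 / 4 * s * \<delta> k\<close>. Since
  \<open>3 * s * \<delta> (k + 1)\<close> is \<open>3 / 2 * s * \<delta> k\<close>, consecutive
  shells overlap.\<close>

lemma ext_eq:
  assumes "d z < 3 * s * \<delta> k" "5 / 4 * s * \<delta> k < d z"
  shows "ext z = layer k z + correction k z"
proof -
  have "correction j z = 0" if "j \<notin> {..<Suc k}" for j
  proof (rule correction_eq_0)
    have "\<delta> (Suc j) \<le> \<delta> (Suc (Suc k))" using that by (intro \<delta>_antimono) auto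
    then have "5 * s * \<delta> (Suc j) \<le> 5 * s * \<delta> (Suc (Suc k))" using s_pos by (intro mult_left_mono) auto
    also have "\<dots> = 5 / 4 * s * \<delta> k" by (simp add: \<delta>_Suc)
    finally show "5 * s * \<delta> (Suc j) \<le> d z" using assms(2) by simp
  qed
  then have "(\<Sum>j. correction j z) = (\<Sum>j<Suc k. correction j z)"
    by (intro suminf_finite) auto
  then show ?thesis using partial_ext[OF assms(1)] by (simp add: ext_def add.assoc[symmetric])
qed

lemma layer_bound_at:
  assumes z: "d z < 3 * s * \<delta> k"
    and K: "\<And>l. l \<in> L k \<Longrightarrow> l \<in> near k z \<Longrightarrow> norm (T k l z - y) \<le> K" "K \<ge> 0"
  shows "norm (layer k z - y) \<le> overlap * (bump_max * K)"
proof -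
  have "layer k z - y = (\<Sum>l\<in>L k. complex_of_real (\<phi> k l z) * (T k l z - y))"
  proof -
    have "(\<Sum>l\<in>L k. complex_of_real (\<phi> k l z)) = 1"
      using sum_\<phi>[OF z] by (simp flip: of_real_sum)
    then have "y = (\<Sum>l\<in>L k. complex_of_real (\<phi> k l z) * y)" by (simp flip: sum_distrib_right)
    then show ?thesis by (simp add: layer_def right_diff_distrib sum_subtractf)
  qed
  also have "norm \<dots> \<le> overlap * (bump_max * K)"
  proof (rule sum_near_bound)
    show "0 \<le> bump_max * K" using bump_max_pos K by simp
    fix l assume l: "l \<in> L k"
    show "complex_of_real (\<phi> k l z) * (T k l z - y) = 0" if "l \<notin> near k z" using outside_near[OF l that] by simp
    show "norm (complex_of_real (\<phi> k l z) * (T k l z - y)) \<le> bump_max * K" if "l \<in> near k z"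
      unfolding norm_mult norm_of_real using bump_max_pos by (intro mult_mono \<phi>_bound K l that) auto
  qed
  finally show ?thesis .
qed

text \<open>Points of \<open>S\<close> are in the range of every scale, so all partial sums are
  layers, that is, sums of total weight 1 of patches tending to \<open>y\<close>.\<close>

lemma ext_on_S:
  assumes z: "z \<in> S"
    and K: "\<And>k l. l \<in> L k \<Longrightarrow> norm (z - lattice_node (\<delta> k) l) \<le> s * \<delta> k \<Longrightarrow> norm (T k l z - y) \<le> K k"
    and K0: "K \<longlonglongrightarrow> 0" "\<And>k. K k \<ge> 0"
  shows "ext z = y"
proof -
  have d0: "d z < 3 * s * \<delta> k" for k using z \<delta>_pos s_pos by simp
  have "(\<lambda>k. layer 0 z + (\<Sum>j<k. correction j z)) \<longlonglongrightarrow> ext z"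
    unfolding ext_def by (intro tendsto_intros summable_LIMSEQ summable_correction)
  then have 1: "(\<lambda>k. layer k z) \<longlonglongrightarrow> ext z" using partial_ext[OF d0] by simp
  have "(\<lambda>k. layer k z - y) \<longlonglongrightarrow> 0"
  proof (rule Lim_null_comparison)
    show "\<forall>\<^sub>F k in sequentially. norm (layer k z - y) \<le> overlap * (bump_max * K k)"
      using layer_bound_at[OF d0 K K0(2)] near_node by (intro always_eventually allI) blast
    show "(\<lambda>k. overlap * (bump_max * K k)) \<longlonglongrightarrow> 0"
      by (intro tendsto_mult_right_zero K0)
  qed
  then have "(\<lambda>k. layer k z) \<longlonglongrightarrow> y" by (simp add: LIM_zero_iff)
  with 1 show ?thesis by (rule LIMSEQ_unique)
qed

section \<open>The antiholomorphic derivative of the glued function\<close>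

definition cr :: "'n \<Rightarrow> (complex^'n \<Rightarrow> complex) \<Rightarrow> complex" where
  "cr j A = (A (axis j 1) + \<i> * A (axis j \<i>)) / 2"

lemma cr_T': "l \<in> L k \<Longrightarrow> cr j (T' k l z) = 0"
  by (simp add: cr_def T_hol flip: mult.assoc)

lemma norm_axis_complex: "norm (axis j c :: complex^'n) = norm c"
proof -
  have "(norm (axis j c :: complex^'n))\<^sup>2 = (\<Sum>i\<in>UNIV. (if i = j then (norm c)\<^sup>2 else 0))"
    unfolding norm_square_vec_complex by (intro sum.cong) (auto simp: axis_def)
  then show ?thesis by simp
qed

lemma cr_bound:
  assumes "\<And>v. norm (A v) \<le> K * norm v"
  shows "norm (cr j A) \<le> K"
proof -
  have "norm (A (axis j 1) + \<i> * A (axis j \<i>)) \<le> norm (A (axis j 1)) + norm (\<i> * A (axis j \<i>))"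
    by (rule norm_triangle_ineq)
  also have "\<dots> \<le> K + K"
    using assms[of "axis j 1"] assms[of "axis j \<i>"] by (intro add_mono) (auto simp: norm_mult norm_axis_complex)
  finally show ?thesis by (simp add: cr_def norm_divide)
qed

text \<open>The patches are holomorphic, so the derivatives of the bumps alone remain. These sum to
  0, which allows subtracting one fixed patch \<open>T k l0\<close> and leaves differences bounded
  by \<open>H k\<close>.\<close>

lemma cr_layer':
  assumes z: "d z < 3 * s * \<delta> k"
  shows "norm (cr j (layer' k z)) \<le> overlap * (slope / \<delta> k * H k)"
proof -
  have one: "(\<Sum>l\<in>L k. \<phi>' k l z v) = 0" for v
  proof -
    have op: "open {z. d z < 3 * s * \<delta> k}"
      by (intro open_Collect_less continuous_intros)
    have "((\<lambda>z. \<Sum>l\<in>L k. \<phi> k l z) has_derivative (\<lambda>v. \<Sum>l\<in>L k. \<phi>' k l z v)) (at z)"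
      by (intro has_derivative_sum lattice_bump_has_derivative \<delta>_pos)
    then have "((\<lambda>z. 1) has_derivative (\<lambda>v. \<Sum>l\<in>L k. \<phi>' k l z v)) (at z)"
      by (rule has_derivative_transform_within_open[OF _ op]) (use z sum_\<phi> in auto)
    then have "(\<lambda>v. \<Sum>l\<in>L k. \<phi>' k l z v) = (\<lambda>v. 0)"
      by (rule has_derivative_unique) simp
    then show ?thesis by (rule fun_cong)
  qed
  have "near k z \<noteq> {}" using card_lattice_near[of "\<delta> k" z] by force
  then obtain l0 where l0: "l0 \<in> near k z" "l0 \<in> L k" using near_subset_L[OF z] by blast
  define c where "c l = cr j (\<lambda>v. complex_of_real (\<phi>' k l z v))" for l
  have csum: "(\<Sum>l\<in>L k. c l) = 0"
  proof -
    have "(\<Sum>l\<in>L k. c l) = (complex_of_real (\<Sum>l\<in>L k. \<phi>' k l z (axis j 1)) + \<i> * complex_of_real (\<Sum>l\<in>L k. \<phi>' k l z (axis j \<i>))) / 2"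
      by (simp add: c_def cr_def sum_divide_distrib sum.distrib sum_distrib_left add_divide_distrib)
    then show ?thesis by (simp only: one) simp
  qed
  have "cr j (layer' k z) = (\<Sum>l\<in>L k. complex_of_real (\<phi> k l z) * cr j (T' k l z) + c l * T k l z)"
    unfolding cr_def layer'_def c_def sum_distrib_left sum.distrib[symmetric] sum_divide_distrib
    by (intro sum.cong refl) (simp add: field_simps)
  also have "\<dots> = (\<Sum>l\<in>L k. c l * T k l z)" by (intro sum.cong refl) (simp add: cr_T')
  also have "\<dots> = (\<Sum>l\<in>L k. c l * (T k l z - T k l0 z))"
    using csum by (simp add: right_diff_distrib sum_subtractf flip: sum_distrib_right)
  also have "norm \<dots> \<le> overlap * (slope / \<delta> k * H k)"
  proof (rule sum_near_bound)
    show "0 \<le> slope / \<delta> k * H k" using slope_pos \<delta>_pos[of k] H by simp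
    fix l assume l: "l \<in> L k"
    show "c l * (T k l z - T k l0 z) = 0" if "l \<notin> near k z" using outside_near[OF l that] by (simp add: c_def cr_def)
    show "norm (c l * (T k l z - T k l0 z)) \<le> slope / \<delta> k * H k" if "l \<in> near k z"
      unfolding norm_mult
    proof (intro mult_mono T_near l l0 near_node that)
      show "norm (c l) \<le> slope / \<delta> k" unfolding c_def by (rule cr_bound) (simp only: norm_of_real \<phi>'_bound)
    qed (use slope_pos \<delta>_pos[of k] in auto)
  qed
  finally show ?thesis .
qed

text \<open>Both patches are holomorphic and drop out; the bump derivatives already multiply a
  difference of patches.\<close>

lemma cr_correction': "norm (cr j (correction' k z)) \<le> overlap * (overlap * (3 * bump_max * slope / \<delta> k * H k))"
proof -
  define c where "c l l' = cr j (\<lambda>v. complex_of_real (\<phi> (Suc k) l z * \<phi>' k l' z v + \<phi>' (Suc k) l z v * \<phi> k l' z))" for l l'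
  have "cr j (correction' k z) = (\<Sum>l\<in>L (Suc k). \<Sum>l'\<in>L k.
      complex_of_real (\<phi> (Suc k) l z * \<phi> k l' z) * (cr j (T' (Suc k) l z) - cr j (T' k l' z)) + c l l' * (T (Suc k) l z - T k l' z))"
    unfolding cr_def correction'_def c_def sum_distrib_left sum.distrib[symmetric] sum_divide_distrib
    by (intro sum.cong refl) (simp add: field_simps)
  also have "\<dots> = (\<Sum>l\<in>L (Suc k). \<Sum>l'\<in>L k. c l l' * (T (Suc k) l z - T k l' z))"
    by (intro sum.cong refl) (simp add: cr_T')
  also have "norm \<dots> \<le> overlap * (overlap * (3 * bump_max * slope / \<delta> k * H k))"
  proof (rule double_sum_near_bound)
    show "norm (c l l' * (T (Suc k) l z - T k l' z)) \<le> 3 * bump_max * slope / \<delta> k * H k"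
      if "l \<in> L (Suc k)" "l' \<in> L k" "norm (z - lattice_node (\<delta> (Suc k)) l) \<le> s * \<delta> (Suc k)"
        "norm (z - lattice_node (\<delta> k) l') \<le> s * \<delta> k" for l l'
      unfolding norm_mult
    proof (intro mult_mono T_cross that)
      show "norm (c l l') \<le> 3 * bump_max * slope / \<delta> k"
        unfolding c_def by (rule cr_bound) (simp only: norm_of_real correction'_coeff_bound)
    qed (use bump_max_pos slope_pos \<delta>_pos[of k] in auto)
    show "0 \<le> 3 * bump_max * slope / \<delta> k * H k" using slope_pos bump_max_pos \<delta>_pos[of k] H by simp
  qed (use outside_near in \<open>auto simp: c_def cr_def\<close>)
  finally show ?thesis .
qed

lemma dbar_bound_componentwise:
  assumes "\<And>j. norm (cr j (frechet_derivative F (at z))) \<le> K"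
  shows "norm (dbar F z) \<le> real CARD('n) * K"
proof -
  have "norm (dbar F z) \<le> (\<Sum>j\<in>UNIV. norm (dbar F z $ j))"
    by (simp add: norm_vec_def L2_set_le_sum)
  also have "\<dots> \<le> (\<Sum>j\<in>(UNIV::'n set). K)"
    using assms by (intro sum_mono) (simp add: dbar_def cr_def)
  finally show ?thesis by simp
qed

lemma ext_dbar_eq: "frechet_derivative ext (at z) = ext' z"
  using frechet_derivative_at[OF ext_has_derivative] by simp

lemma ext_dbar_shell:
  "\<exists>C\<ge>0. \<forall>k z. d z < 3 * s * \<delta> k \<longrightarrow> 5 / 4 * s * \<delta> k < d z \<longrightarrow> norm (dbar ext z) \<le> C * (H k / \<delta> k)"
proof -
  define C where "C = overlap * slope + overlap * (overlap * (3 * bump_max * slope))"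
  have "norm (dbar ext z) \<le> real CARD('n) * (C * (H k / \<delta> k))"
    if z: "d z < 3 * s * \<delta> k" "5 / 4 * s * \<delta> k < d z" for k z
  proof (rule dbar_bound_componentwise)
    fix j
    have op: "open {z. d z < 3 * s * \<delta> k \<and> 5 / 4 * s * \<delta> k < d z}"
      by (intro open_Collect_conj open_Collect_less continuous_intros)
    have "((\<lambda>z. layer k z + correction k z) has_derivative (\<lambda>v. layer' k z v + correction' k z v)) (at z)"
      by (intro has_derivative_add layer_has_derivative correction_has_derivative)
    then have "(ext has_derivative (\<lambda>v. layer' k z v + correction' k z v)) (at z)"
      by (rule has_derivative_transform_within_open[OF _ op]) (use z ext_eq in auto)
    then have "ext' z = (\<lambda>v. layer' k z v + correction' k z v)"
      by (rule has_derivative_unique[OF ext_has_derivative])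
    then have "cr j (ext' z) = cr j (layer' k z) + cr j (correction' k z)"
      by (simp add: cr_def field_simps)
    then have "norm (cr j (ext' z)) \<le> norm (cr j (layer' k z)) + norm (cr j (correction' k z))"
      by (simp add: norm_triangle_ineq)
    also have "\<dots> \<le> overlap * (slope / \<delta> k * H k) + overlap * (overlap * (3 * bump_max * slope / \<delta> k * H k))"
      by (intro add_mono cr_layer' cr_correction' z)
    also have "\<dots> = C * (H k / \<delta> k)" by (simp add: C_def algebra_simps)
    finally show "norm (cr j (frechet_derivative ext (at z))) \<le> C * (H k / \<delta> k)" by (simp add: ext_dbar_eq)
  qed
  moreover have "C \<ge> 0" using overlap_pos slope_pos bump_max_pos by (simp add: C_def)
  ultimately show ?thesis by (intro exI[of _ "real CARD('n) * C"]) (auto simp: mult.assoc)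
qed

lemma ext_dbar_continuous: "continuous_on UNIV (\<lambda>z. norm (dbar ext z))"
  unfolding dbar_def ext_dbar_eq by (intro continuous_intros ext'_continuous) auto

text \<open>Covers the points whose distance from \<open>S\<close> exceeds the coarsest
  shell.\<close>

lemma ext_dbar_bounded: "\<exists>C\<ge>0. \<forall>z. norm (dbar ext z) \<le> C"
proof -
  obtain R where R: "\<And>z. norm z > R \<Longrightarrow> ext z = 0" using C1cE[OF ext_C1c] by metis
  have out: "dbar ext z = 0" if "norm z > R" for z
    by (simp add: dbar_def ext_dbar_eq vec_eq_iff has_derivative_outside_support[OF ext_has_derivative R that])
  have "bounded ((\<lambda>z. norm (dbar ext z)) ` cball 0 R)"
    using ext_dbar_continuous by (intro compact_imp_bounded compact_continuous_image) (auto intro: continuous_on_subset)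
  then obtain C where "C > 0" "\<And>z. norm z \<le> R \<Longrightarrow> norm (dbar ext z) \<le> C"
    by (auto simp: bounded_pos)
  then show ?thesis using out by (metis less_imp_le linorder_not_le norm_zero)
qed

end

section \<open>From derivative bounds to almost analytic extensions\<close>

lemma length_le_mono: "length_le g L \<Longrightarrow> L \<le> L' \<Longrightarrow> length_le g L'"
  unfolding length_le_def by (meson order_trans)

locale smooth_bounds =
  fixes U :: "(real^'n) set" and f :: "real^'n \<Rightarrow> real" and M :: "nat \<Rightarrow> real" and B \<rho> Q :: real
  assumes U: "open U" and f: "smooth_on U f" and B: "B \<ge> 0" and \<rho>: "\<rho> > 0" and Q: "Q \<ge> 0"
    and M: "\<And>k. M k > 0"
    and bd: "\<And>x is. x \<in> U \<Longrightarrow> \<bar>dpart is f x\<bar> \<le> B * (\<rho> ^ length is * M (length is))"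
    and qc: "\<And>x y. x \<in> U \<Longrightarrow> y \<in> U \<Longrightarrow> \<exists>g. path g \<and> path_image g \<subseteq> U \<and>
         pathstart g = x \<and> pathfinish g = y \<and> length_le g (Q * dist x y)"
begin

abbreviation "m \<equiv> small_seq M"

lemma m_pos: "m k > 0" using M by (simp add: small_seq_def)

text \<open>Passing from \<open>fact p\<close> to \<open>fact q\<close> costs one or two factors of
  size at most \<open>q\<close>, absorbed by \<open>4 ^ q\<close>.\<close>

lemma M_div_fact_le:
  assumes "j \<le> 1" "q = p + 1 + j"
  shows "M q / fact p \<le> 4 ^ q * m q"
proof -
  have two: "real (Suc k) \<le> 2 ^ Suc k" for k by (rule less_imp_le[OF of_nat_less_two_power])
  have "fact q / fact p \<le> (4::real) ^ q"
  proof (cases "j = 0")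
    case True
    then have q: "q = Suc p" using assms by simp
    have "fact q / fact p = real (Suc p)" unfolding q by (simp only: fact_Suc of_nat_mult) (simp del: of_nat_Suc)
    also have "\<dots> \<le> 2 ^ q" unfolding q by (rule two)
    also have "\<dots> \<le> 4 ^ q" by (intro power_mono) auto
    finally show ?thesis .
  next
    case False
    then have q: "q = Suc (Suc p)" using assms by simp
    have "fact q / fact p = real (Suc (Suc p)) * real (Suc p)"
      unfolding q by (simp only: fact_Suc of_nat_mult) (simp del: of_nat_Suc)
    also have "\<dots> \<le> 2 ^ Suc (Suc p) * 2 ^ Suc p" by (intro mult_mono two) auto
    also have "\<dots> \<le> 2 ^ Suc (Suc p) * 2 ^ Suc (Suc p)" by (intro mult_left_mono power_increasing) auto
    also have "\<dots> = 4 ^ q" unfolding q by (simp flip: power_mult_distrib)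
    finally show ?thesis .
  qed
  then have "(fact q / fact p) * m q \<le> 4 ^ q * m q" using m_pos[of q] by (intro mult_right_mono) auto
  then show ?thesis by (simp add: small_seq_def)
qed

lemma M_div_fact_le':
  assumes "j \<le> 1"
  shows "M (i + j) / fact i \<le> 2 ^ (i + j) * m (i + j)"
proof -
  have "fact (i + j) / fact i \<le> (2::real) ^ (i + j)"
  proof (cases "j = 0")
    case False
    then have j: "j = 1" using assms by simp
    have "fact (i + j) / fact i = real (Suc i)"
      unfolding j by (simp only: Suc_eq_plus1[symmetric] fact_Suc of_nat_mult) (simp del: of_nat_Suc)
    also have "\<dots> \<le> 2 ^ Suc i" by (rule less_imp_le[OF of_nat_less_two_power])
    also have "\<dots> = 2 ^ (i + j)" by (simp add: j)
    finally show ?thesis .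
  qed simp
  then have "(fact (i + j) / fact i) * m (i + j) \<le> 2 ^ (i + j) * m (i + j)"
    using m_pos[of "i + j"] by (intro mult_right_mono) auto
  then show ?thesis by (simp add: small_seq_def)
qed

text \<open>Both base points are within \<open>6 * r\<close> of \<open>z\<close>, hence at most
  \<open>12 * r\<close> apart and joined by a curve of length at most \<open>12 * Q * r\<close>. The
  7 instead of 6 in \<open>x\<close> leaves room for the strict inequality of
  \<open>taylor_base_change\<close>. A derivative recorded in \<open>is\<close> costs
  \<open>\<rho> / x\<close>.\<close>

lemma taylor_near_bound:
  assumes ab: "a \<in> U" "b \<in> U" and z: "norm (z - cemb a) \<le> 6 * r" "norm (z - cemb b) \<le> 6 * r" and r: "r > 0"
    and x: "x = real CARD('n) * (7 + 12 * Q) * r * \<rho>" and j: "length is \<le> 1" and q: "q = p + 1 + length is"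
  shows "norm (taylor f b z p is - taylor f a z p is) \<le> B * (\<rho> / x) ^ length is * (m q * (8 * x) ^ q)"
proof -
  let ?n = "real CARD('n)" and ?j = "length is"
  have n: "?n > 0" by simp
  have x0: "x > 0" unfolding x using r \<rho> Q n by (intro mult_pos_pos) auto
  obtain g where g: "path g" "path_image g \<subseteq> U" "pathstart g = a" "pathfinish g = b" "length_le g (Q * dist a b)"
    using qc[OF ab] by blast
  have "dist a b \<le> norm (z - cemb a) + norm (z - cemb b)"
    using dist_triangle3[of "cemb a" "cemb b" z] unfolding dist_cemb dist_norm[of z] .
  then have dab: "dist a b \<le> 12 * r" using z by linarith
  have len: "length_le g (Q * (12 * r))"
    using g(5) dab Q by (rule_tac length_le_mono) (auto intro!: mult_left_mono)
  have R: "norm (z - cemb (pathstart g)) + Q * (12 * r) < (7 + 12 * Q) * r"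
    using z(1) r g(3) by (simp add: algebra_simps)
  have "norm (taylor f (pathfinish g) z p is - taylor f (pathstart g) z p is)
    \<le> ?n * ((?n * ((7 + 12 * Q) * r)) ^ p * (B * (\<rho> ^ q * M q)) / fact p) * (Q * (12 * r))"
  proof (rule taylor_base_change[OF U f g(1,2) len _ R])
    fix js :: "'n list" and \<xi> assume "\<xi> \<in> U" "length js = Suc (p + ?j)"
    then show "\<bar>dpart js f \<xi>\<bar> \<le> B * (\<rho> ^ q * M q)" using bd[of \<xi> js] by (simp add: q)
  qed
  also have "\<dots> = B * ((?n * ((7 + 12 * Q) * r)) ^ p * \<rho> ^ q * (M q / fact p)) * (?n * (Q * (12 * r)))"
    by simp
  also have "\<dots> \<le> B * ((?n * ((7 + 12 * Q) * r)) ^ p * \<rho> ^ q * (4 ^ q * m q)) * (?n * ((7 + 12 * Q) * r))"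
  proof (rule mult_mono)
    have W: "0 \<le> (?n * ((7 + 12 * Q) * r)) ^ p * \<rho> ^ q"
      using r \<rho> Q by (intro mult_nonneg_nonneg zero_le_power) auto
    show "B * ((?n * ((7 + 12 * Q) * r)) ^ p * \<rho> ^ q * (M q / fact p))
        \<le> B * ((?n * ((7 + 12 * Q) * r)) ^ p * \<rho> ^ q * (4 ^ q * m q))"
      by (rule mult_left_mono[OF mult_left_mono[OF M_div_fact_le[OF j q] W] B])
    show "0 \<le> B * ((?n * ((7 + 12 * Q) * r)) ^ p * \<rho> ^ q * (4 ^ q * m q))"
      using m_pos[of q] by (intro mult_nonneg_nonneg[OF B mult_nonneg_nonneg[OF W]]) auto
    show "?n * (Q * (12 * r)) \<le> ?n * ((7 + 12 * Q) * r)"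
      using r by (intro mult_left_mono) (auto simp: algebra_simps)
    show "0 \<le> ?n * (Q * (12 * r))" using r Q by simp
  qed
  also have "\<dots> = B * \<rho> ^ ?j * ((?n * ((7 + 12 * Q) * r)) ^ (p + 1) * \<rho> ^ (p + 1)) * (4 ^ q * m q)"
    by (simp add: q power_add mult_ac)
  also have "(?n * ((7 + 12 * Q) * r)) ^ (p + 1) * \<rho> ^ (p + 1) = x ^ (p + 1)"
    by (simp only: x power_mult_distrib[symmetric] mult.assoc)
  also have "x ^ (p + 1) = x ^ q / x ^ ?j" using x0 by (simp add: q power_add)
  also have "B * \<rho> ^ ?j * (x ^ q / x ^ ?j) * (4 ^ q * m q) = B * (\<rho> / x) ^ ?j * (m q * (4 * x) ^ q)"
    by (simp add: power_divide power_mult_distrib)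
  \<comment> \<open>The base is enlarged to \<open>8 * x\<close>, which becomes the parameter
    \<open>t k\<close> of the coarser scale; the truncation estimate uses \<open>4 * x\<close>, that
    of the next scale.\<close>
  also have "\<dots> \<le> B * (\<rho> / x) ^ ?j * (m q * (8 * x) ^ q)"
    using B \<rho> x0 m_pos[of q] by (intro mult_left_mono power_mono) auto
  finally show ?thesis by (simp add: g)
qed

text \<open>Of the base \<open>4 * x\<close> in \<open>dec\<close> one factor 2 pays for the
  factorials and the other leaves \<open>(1 / 2) ^ i\<close>, so the removed terms are dominated by
  a geometric series of sum at most 2.\<close>

lemma taylor_truncation_bound:
  assumes a: "a \<in> U" and z: "real CARD('n) * norm (z - cemb a) * \<rho> \<le> x" and x: "x > 0"
    and P: "P \<le> P'" and j: "length is \<le> 1"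
    and dec: "\<And>i. P < i \<Longrightarrow> i \<le> P' \<Longrightarrow> m (i + length is) * (4 * x) ^ (i + length is) \<le> K" and K: "K \<ge> 0"
  shows "norm (taylor f a z P' is - taylor f a z P is) \<le> B * (\<rho> / x) ^ length is * (2 * K)"
proof -
  let ?n = "real CARD('n)" and ?j = "length is"
  have eq: "{..P'} = {..P} \<union> {P<..P'}" using P by auto
  have "(\<Sum>i\<le>P'. hom_taylor f a z i is / fact i) =
      (\<Sum>i\<le>P. hom_taylor f a z i is / fact i) + (\<Sum>i\<in>{P<..P'}. hom_taylor f a z i is / fact i)"
    unfolding eq by (rule sum.union_disjoint) auto
  then have "taylor f a z P' is - taylor f a z P is = (\<Sum>i\<in>{P<..P'}. hom_taylor f a z i is / fact i)"
    unfolding taylor_def by simp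
  also have "norm \<dots> \<le> (\<Sum>i\<in>{P<..P'}. B * (\<rho> / x) ^ ?j * K * (1 / 2) ^ i)"
  proof (rule sum_norm_le)
    fix i assume i: "i \<in> {P<..P'}"
    have "norm (hom_taylor f a z i is) \<le> (?n * norm (z - cemb a)) ^ i * (B * (\<rho> ^ (i + ?j) * M (i + ?j)))"
      using bd[OF a] by (intro hom_taylor_bound) metis
    then have "norm (hom_taylor f a z i is / fact i) \<le> (?n * norm (z - cemb a)) ^ i * (B * (\<rho> ^ (i + ?j) * M (i + ?j))) / fact i"
      by (simp add: norm_divide divide_right_mono)
    also have "\<dots> = B * \<rho> ^ ?j * (?n * norm (z - cemb a) * \<rho>) ^ i * (M (i + ?j) / fact i)"
      by (simp add: power_add power_mult_distrib mult_ac)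
    also have "\<dots> \<le> B * \<rho> ^ ?j * x ^ i * (2 ^ (i + ?j) * m (i + ?j))"
      using B \<rho> z M[of "i + ?j"] M_div_fact_le'[OF j, of i] x
      by (intro mult_mono power_mono) (auto intro!: mult_nonneg_nonneg simp: less_imp_le)
    also have "x ^ i = x ^ (i + ?j) / x ^ ?j" using x by (simp add: power_add)
    also have "B * \<rho> ^ ?j * (x ^ (i + ?j) / x ^ ?j) * (2 ^ (i + ?j) * m (i + ?j))
        = B * (\<rho> / x) ^ ?j * ((m (i + ?j) * (4 * x) ^ (i + ?j)) * (1 / 2) ^ (i + ?j))"
    proof -
      have "(4 * x) ^ (i + ?j) * (1 / 2) ^ (i + ?j) = 2 ^ (i + ?j) * x ^ (i + ?j)"
        by (simp only: power_mult_distrib[symmetric]) simp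
      then have "(m (i + ?j) * (4 * x) ^ (i + ?j)) * (1 / 2) ^ (i + ?j) = m (i + ?j) * (2 ^ (i + ?j) * x ^ (i + ?j))"
        by (simp only: mult.assoc)
      then show ?thesis by (simp add: power_divide mult_ac)
    qed
    also have "\<dots> \<le> B * (\<rho> / x) ^ ?j * (K * (1 / 2) ^ i)"
    proof (intro mult_left_mono mult_mono)
      show "m (i + ?j) * (4 * x) ^ (i + ?j) \<le> K" using dec i by auto
      show "(1 / 2) ^ (i + ?j) \<le> (1 / 2 :: real) ^ i" by (intro power_decreasing) auto
    qed (use B \<rho> x K in auto)
    finally show "norm (hom_taylor f a z i is / fact i) \<le> B * (\<rho> / x) ^ ?j * K * (1 / 2) ^ i" by (simp only: mult.assoc)
  qed
  also have "\<dots> = B * (\<rho> / x) ^ ?j * K * (\<Sum>i\<in>{P<..P'}. (1 / 2) ^ i)" by (rule sum_distrib_left[symmetric])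
  also have "\<dots> \<le> B * (\<rho> / x) ^ ?j * K * 2"
  proof (rule mult_left_mono)
    have "(\<Sum>i\<in>{P<..P'}. (1 / 2) ^ i) \<le> (\<Sum>i. (1 / 2 :: real) ^ i)"
      by (intro sum_le_suminf summable_geometric) auto
    also have "\<dots> = 2" by (subst suminf_geometric) auto
    finally show "(\<Sum>i\<in>{P<..P'}. (1 / 2) ^ i) \<le> (2::real)" .
  qed (use B \<rho> x K in auto)
  finally show ?thesis by (simp add: mult_ac)
qed

end

lemma B_roumieu_imp_almost_analytic_extendable:
  fixes f :: "real^'n \<Rightarrow> real"
  assumes R: "R_regular \<MM>" and U: "quasiconvex_domain U" and fB: "f \<in> B_roumieu \<MM> U"
  shows "almost_analytic_extendable \<MM> U f"
proof -
  have U0: "U \<noteq> {}" "bounded U" "open U" using U by (auto simp: quasiconvex_domain_def)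
  obtain Q0 where Q0: "\<And>x y. x \<in> U \<Longrightarrow> y \<in> U \<Longrightarrow> \<exists>g. path g \<and> path_image g \<subseteq> U \<and>
         pathstart g = x \<and> pathfinish g = y \<and> length_le g (Q0 * dist x y)"
    using U unfolding quasiconvex_domain_def by blast
  define Q where "Q = max Q0 0"
  have Q: "Q \<ge> 0" by (simp add: Q_def)
  have qc: "\<exists>g. path g \<and> path_image g \<subseteq> U \<and> pathstart g = x \<and> pathfinish g = y \<and> length_le g (Q * dist x y)"
    if xy: "x \<in> U" "y \<in> U" for x y
  proof -
    have le: "Q0 * dist x y \<le> Q * dist x y" by (intro mult_right_mono) (auto simp: Q_def)
    from Q0[OF xy] show ?thesis using length_le_mono[OF _ le] by blast
  qed
  obtain M \<rho> B0 where M: "M \<in> \<MM>" and \<rho>: "\<rho> > 0" and sm: "smooth_on U f"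
    and B0: "\<And>x is. x \<in> U \<Longrightarrow> \<bar>dpart is f x\<bar> / (\<rho> ^ length is * M (length is)) \<le> B0"
    using fB unfolding B_roumieu_def by blast
  have Mpos: "M k > 0" for k
    using R M by (auto simp: R_regular_def weight_matrix_def weight_sequence_def)
  define B where "B = max B0 0"
  have bd: "\<bar>dpart is f x\<bar> \<le> B * (\<rho> ^ length is * M (length is))" if "x \<in> U" for x "is"
  proof -
    have p: "\<rho> ^ length is * M (length is) > 0" using \<rho> Mpos by simp
    have "\<bar>dpart is f x\<bar> \<le> B0 * (\<rho> ^ length is * M (length is))"
      using B0[OF that, of "is"] unfolding pos_divide_le_eq[OF p] .
    also have "\<dots> \<le> B * (\<rho> ^ length is * M (length is))"
      using p by (intro mult_right_mono) (auto simp: B_def)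
    finally show ?thesis .
  qed
  interpret sb: smooth_bounds U f M B \<rho> Q
    by unfold_locales (use U0 sm \<rho> Q Mpos bd qc in \<open>auto simp: B_def\<close>)
  define m where "m = small_seq M"
  have m: "root_divergent m" unfolding m_def by (rule R_regular_root_divergent[OF R M])
  note mpos = root_divergentD(1)[OF m]
  obtain N1 C1 where N1: "N1 \<in> \<MM>" "C1 \<ge> 1"
    and Gam: "\<And>t. t > 0 \<Longrightarrow> Gamma_upper (small_seq N1) (C1 * t) \<le> Gamma_lower m t"
    using R M unfolding R_regular_def m_def by blast
  obtain N2 C2 where N2: "N2 \<in> \<MM>" "C2 \<ge> 1" and N12: "\<And>j. N1 (Suc j) \<le> C2 ^ Suc j * N2 j"
    using R N1(1) unfolding R_regular_def by blast
  note n1 = R_regular_root_divergent[OF R N1(1)] and n2 = R_regular_root_divergent[OF R N2(1)]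
  have n12: "small_seq N1 (Suc j) \<le> C2 ^ Suc j * small_seq N2 j" for j
  proof -
    have N1p: "N1 (Suc j) > 0" using R N1(1) by (auto simp: R_regular_def weight_matrix_def weight_sequence_def)
    have "small_seq N1 (Suc j) \<le> N1 (Suc j) / fact j"
      unfolding small_seq_def using N1p by (intro divide_left_mono fact_mono) auto
    also have "\<dots> \<le> C2 ^ Suc j * N2 j / fact j" using N12[of j] by (intro divide_right_mono) auto
    finally show ?thesis by (simp add: small_seq_def)
  qed
  let ?n = "real CARD('n)"
  define S where "S = cemb ` closure U"
  define s where "s = 3 * real DIM(complex^'n)"
  have s0: "s > 0" by (simp add: s_def)
  have S: "compact S" "S \<noteq> {}"
  proof -
    have "continuous_on (closure U) cemb"
      by (rule continuous_onI) (auto simp: dist_cemb)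
    then show "compact S" unfolding S_def using U0 by (intro compact_continuous_image) (auto simp: compact_closure)
    show "S \<noteq> {}" unfolding S_def using U0 by auto
  qed
  \<comment> \<open>With \<open>r = s * \<delta> k\<close>, the parameter \<open>x\<close> of
    \<open>taylor_near_bound\<close> is \<open>c * \<delta> k\<close>.\<close>
  define c where "c = ?n * (7 + 12 * Q) * s * \<rho>"
  have c0: "c > 0" unfolding c_def using Q s0 \<rho> by (intro mult_pos_pos) auto
  obtain t0 where t0: "t0 > 0" "\<And>t. 0 < t \<Longrightarrow> t \<le> t0 \<Longrightarrow> 3 \<le> Gamma_lower m t"
    using Gamma_lower_large[OF m, of 3] by blast
  \<comment> \<open>Makes \<open>t 0\<close> equal to \<open>t0\<close>, so that
    \<open>Gamma_lower m (t k)\<close> is at least 3 at every scale.\<close>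
  define \<delta>0 where "\<delta>0 = t0 / (8 * c)"
  define \<delta> where "\<delta> k = \<delta>0 / 2 ^ k" for k
  have \<delta>0: "\<delta>0 > 0" using t0 c0 by (simp add: \<delta>0_def)
  have \<delta>p: "\<delta> k > 0" for k using \<delta>0 by (simp add: \<delta>_def)
  \<comment> \<open>Halving the scale turns the factor 8 into 4: a change of base point at scale
    \<open>k\<close> is estimated with \<open>t k\<close>, a change of degree with
    \<open>t (Suc k)\<close>.\<close>
  define t where "t k = 8 * (c * \<delta> k)" for k
  have tp: "t k > 0" for k using c0 \<delta>p by (simp add: t_def)
  have t_Suc: "t (Suc k) = 4 * (c * \<delta> k)" for k by (simp add: t_def \<delta>_def)
  have t_dec: "t (Suc k) \<le> t k" for k
    using mult_pos_pos[OF c0 \<delta>p, of k] unfolding t_Suc by (simp add: t_def)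
  have tle: "t k \<le> t0" for k
  proof -
    have "t k = t0 / 2 ^ k" using c0 by (simp add: t_def \<delta>_def \<delta>0_def)
    also have "\<dots> \<le> t0" using t0(1) by (simp add: divide_le_eq mult_le_cancel_left1)
    finally show ?thesis .
  qed
  define q where "q k = Gamma_lower m (t k)" for k
  have q3: "q k \<ge> 3" for k unfolding q_def using t0(2) tp tle by blast
  have q_mono: "q k \<le> q (Suc k)" for k
    unfolding q_def by (rule Gamma_lower_antimono[OF m tp t_dec])
  define H0 where "H0 k = m (q k) * t k ^ q k" for k
  have H0p: "H0 k > 0" for k using mpos tp by (simp add: H0_def)
  have H0_h: "H0 k \<le> h_fun (small_seq N1) (C1 * t k)" for k
    unfolding H0_def q_def by (rule Gamma_domination[OF m n1 N1(2) Gam tp])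
  \<comment> \<open>Order 2 makes \<open>H0 k / \<delta> k\<close> of size
    \<open>\<delta> k\<close>, hence summable.\<close>
  have H0_sq: "H0 k \<le> m 2 * t k ^ 2" for k
    unfolding H0_def using q3[of k] by (intro Gamma_lower_terms_antimono[OF m tp]) (auto simp: q_def)
  have dec: "m i * (4 * (c * \<delta> k)) ^ i \<le> H0 k" if "q k \<le> i" "i \<le> q (Suc k)" for i k
  proof -
    have "m i * t (Suc k) ^ i \<le> m (q k) * t (Suc k) ^ q k"
      using that by (intro Gamma_lower_terms_antimono[OF m tp]) (auto simp: q_def)
    also have "\<dots> \<le> m (q k) * t k ^ q k"
      using mpos[of "q k"] tp[of "Suc k"] t_dec[of k] by (intro mult_left_mono power_mono) auto
    finally show ?thesis by (simp add: t_Suc H0_def)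
  qed
  \<comment> \<open>The derivatives of \<open>f\<close> live on \<open>U\<close>, whereas the
    nearest point of \<open>S\<close> comes from its closure. Moving into \<open>U\<close> costs one
    more \<open>s * \<delta> k\<close>: 5 from the node, and 6 from a point near the node.\<close>
  have ex_a: "\<exists>a. a \<in> U \<and> norm (lattice_node (\<delta> k) l - cemb a) < 5 * s * \<delta> k" if "l \<in> patch_index S s (\<delta> k)" for k l
  proof -
    have less: "infdist (lattice_node (\<delta> k) l) S < 4 * s * \<delta> k" using that by (simp add: patch_index_def)
    obtain y where y: "y \<in> S" "infdist (lattice_node (\<delta> k) l) S = dist (lattice_node (\<delta> k) l) y"
      using infdist_attains_inf[OF compact_imp_closed[OF S(1)] S(2)] by metis
    obtain b where b: "b \<in> closure U" "y = cemb b" using y(1) by (auto simp: S_def)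
    have "s * \<delta> k > 0" using s0 \<delta>p by simp
    then obtain a where a: "a \<in> U" "dist a b < s * \<delta> k"
      using b(1) unfolding closure_approachable by blast
    have "dist (lattice_node (\<delta> k) l) (cemb a) \<le> dist (lattice_node (\<delta> k) l) y + dist y (cemb a)"
      by (rule dist_triangle)
    also have "\<dots> < 4 * s * \<delta> k + s * \<delta> k"
      using less y a b by (intro add_strict_mono) (auto simp: dist_cemb dist_commute)
    finally show ?thesis using a(1) by (intro exI[of _ a]) (simp add: dist_norm)
  qed
  define a where "a k l = (SOME a. a \<in> U \<and> norm (lattice_node (\<delta> k) l - cemb a) < 5 * s * \<delta> k)" for k l
  have a: "a k l \<in> U" "norm (lattice_node (\<delta> k) l - cemb (a k l)) < 5 * s * \<delta> k"
    if "l \<in> patch_index S s (\<delta> k)" for k l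
    using someI_ex[OF ex_a[OF that]] unfolding a_def by auto
  have za: "norm (z - cemb (a k l)) \<le> 6 * (s * \<delta> k)"
    if "l \<in> patch_index S s (\<delta> k)" "norm (z - lattice_node (\<delta> k) l) \<le> s * \<delta> k" for k l z
    using norm_triangle_ineq[of "z - lattice_node (\<delta> k) l" "lattice_node (\<delta> k) l - cemb (a k l)"] a(2)[OF that(1)] that(2)
    by simp
  \<comment> \<open>With this degree a change of base point involves derivatives of order exactly
    \<open>q k\<close>.\<close>
  define P where "P k = q k - 1" for k
  have P_Suc: "P k = Suc (P k - 1)" and Pq: "q k = P k + 1" and Pq': "q k = P k - 1 + 2" for k
    using q3[of k] by (simp_all add: P_def)
  define T where "T k l z = taylor f (a k l) z (P k) []" for k l z
  define T' where "T' k l z v = (\<Sum>i\<in>UNIV. v $ i * taylor f (a k l) z (P k - 1) [i])" for k l z v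
  have same: "norm (taylor f b' z p is - taylor f a' z p is) \<le> B * (\<rho> / (c * \<delta> k)) ^ length is * H0 k"
    if "a' \<in> U" "b' \<in> U" "norm (z - cemb a') \<le> 6 * (s * \<delta> k)" "norm (z - cemb b') \<le> 6 * (s * \<delta> k)"
      "length is \<le> 1" "q k = p + 1 + length is" for a' b' z p "is" k
  proof -
    have x: "c * \<delta> k = ?n * (7 + 12 * Q) * (s * \<delta> k) * \<rho>" by (simp add: c_def)
    have "s * \<delta> k > 0" using s0 \<delta>p by simp
    from sb.taylor_near_bound[OF that(1-4) this x that(5,6)]
    show ?thesis by (simp add: H0_def t_def m_def)
  qed
  have trunc: "norm (taylor f a' z p' is - taylor f a' z p is) \<le> B * (\<rho> / (c * \<delta> k)) ^ length is * (2 * H0 k)"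
    if "a' \<in> U" "norm (z - cemb a') \<le> 6 * (s * \<delta> k)" "length is \<le> 1" "q k = p + 1 + length is" "q (Suc k) = p' + 1 + length is"
    for a' z p p' "is" k
  proof (rule sb.taylor_truncation_bound[OF that(1) _ _ _ that(3)])
    have "?n * norm (z - cemb a') * \<rho> \<le> ?n * ((7 + 12 * Q) * (s * \<delta> k)) * \<rho>"
    proof (intro mult_right_mono mult_left_mono)
      have "6 * (s * \<delta> k) \<le> (7 + 12 * Q) * (s * \<delta> k)" using Q s0 \<delta>p[of k] by (intro mult_right_mono) auto
      then show "norm (z - cemb a') \<le> (7 + 12 * Q) * (s * \<delta> k)" using that(2) by linarith
    qed (use \<rho> in auto)
    then show "?n * norm (z - cemb a') * \<rho> \<le> c * \<delta> k" by (simp add: c_def mult_ac)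
    show "c * \<delta> k > 0" using c0 \<delta>p by simp
    show "p \<le> p'" using q_mono[of k] that by simp
    show "0 \<le> H0 k" using H0p less_imp_le by blast
    fix i assume i: "p < i" "i \<le> p'"
    have "m (i + length is) * (4 * (c * \<delta> k)) ^ (i + length is) \<le> H0 k"
      using i that by (intro dec) auto
    then show "small_seq M (i + length is) * (4 * (c * \<delta> k)) ^ (i + length is) \<le> H0 k" by (simp only: m_def)
  qed
  \<comment> \<open>At the base point of the finer patch the degree is first lowered to that of the
    coarser one, then the base point is moved: \<open>2 * H0 k\<close> for the truncation and
    \<open>H0 k\<close> for the move.\<close>
  have cross: "norm (taylor f (a (Suc k) l) z p' is - taylor f (a k l') z p is) \<le> B * (\<rho> / (c * \<delta> k)) ^ length is * (3 * H0 k)"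
    if l: "l \<in> patch_index S s (\<delta> (Suc k))" "l' \<in> patch_index S s (\<delta> k)"
      and z: "norm (z - lattice_node (\<delta> (Suc k)) l) \<le> s * \<delta> (Suc k)" "norm (z - lattice_node (\<delta> k) l') \<le> s * \<delta> k"
      and p: "length is \<le> 1" "q k = p + 1 + length is" "q (Suc k) = p' + 1 + length is"
    for k l l' z p p' "is"
  proof -
    have "6 * (s * \<delta> (Suc k)) \<le> 6 * (s * \<delta> k)" using s0 \<delta>0 by (simp add: \<delta>_def divide_le_eq)
    then have z1: "norm (z - cemb (a (Suc k) l)) \<le> 6 * (s * \<delta> k)" using za[OF l(1) z(1)] by linarith
    note z2 = za[OF l(2) z(2)]
    have "norm (taylor f (a (Suc k) l) z p' is - taylor f (a k l') z p is)
       = norm ((taylor f (a (Suc k) l) z p' is - taylor f (a (Suc k) l) z p is) + (taylor f (a (Suc k) l) z p is - taylor f (a k l') z p is))"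
      by simp
    also have "\<dots> \<le> B * (\<rho> / (c * \<delta> k)) ^ length is * (2 * H0 k) + B * (\<rho> / (c * \<delta> k)) ^ length is * H0 k"
      by (rule order_trans[OF norm_triangle_ineq add_mono[OF trunc[OF a(1)[OF l(1)] z1 p] same[OF a(1)[OF l(2)] a(1)[OF l(1)] z2 z1 p(1,2)]]])
    finally show ?thesis by (simp add: algebra_simps)
  qed
  define H where "H k = 3 * B * H0 k" for k
  \<comment> \<open>Gradients of patches are estimated with lists of length 1, which costs the
    factor \<open>\<rho> / (c * \<delta> k)\<close> for each of the coordinates.\<close>
  define G where "G k = ?n * (3 * B * \<rho> / c * (H0 k / \<delta> k))" for k
  have Bn: "B \<ge> 0" by (simp add: B_def)
  have sH0: "summable (\<lambda>k. H0 k / \<delta> k)"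
  proof (rule summable_comparison_test)
    have "H0 k / \<delta> k \<le> (m 2 * (8 * c)\<^sup>2 * \<delta>0) * (1 / 2) ^ k" for k
    proof -
      have "H0 k / \<delta> k \<le> m 2 * t k ^ 2 / \<delta> k" using H0_sq[of k] \<delta>p[of k] by (intro divide_right_mono) auto
      also have "\<dots> = m 2 * (8 * c)\<^sup>2 * \<delta> k" using \<delta>p[of k] by (simp add: t_def power2_eq_square)
      finally show ?thesis by (simp add: \<delta>_def power_one_over)
    qed
    then show "\<exists>N. \<forall>k\<ge>N. norm (H0 k / \<delta> k) \<le> (m 2 * (8 * c)\<^sup>2 * \<delta>0) * (1 / 2) ^ k"
      using H0p \<delta>p by (auto simp: abs_of_pos)
    show "summable (\<lambda>k. (m 2 * (8 * c)\<^sup>2 * \<delta>0) * (1 / 2) ^ k)"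
      by (intro summable_mult summable_geometric) auto
  qed
  interpret pa: patches S s \<delta>0 \<delta> T T' H G
  proof unfold_locales
    fix k l assume l: "l \<in> patch_index S s (\<delta> k)"
    show "(T k l has_derivative T' k l z) (at z)" for z
      unfolding T_def[abs_def] T'_def[abs_def]
      by (rule taylor_has_derivative[OF U0(3) sm a(1)[OF l], where p = "P k - 1", folded P_Suc[of k]])
    show "continuous_on UNIV (\<lambda>z. T' k l z v)" for v
    proof -
      have "continuous_on UNIV (\<lambda>z. taylor f (a k l) z (P k - 1) [i])" for i
      proof -
        \<comment> \<open>\<open>q k \<ge> 3\<close> leaves degree at least 1 here, so
          \<open>taylor_has_derivative\<close> applies once more.\<close>
        have 2: "P k - 1 = Suc (P k - 2)" using q3[of k] by (simp add: P_def)
        show ?thesis unfolding 2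
          using has_derivative_continuous[OF taylor_has_derivative[OF U0(3) sm a(1)[OF l]]]
          by (auto simp: continuous_on_eq_continuous_at)
      qed
      then show ?thesis unfolding T'_def by (intro continuous_intros)
    qed
    show "T' k l z (axis j \<i>) = \<i> * T' k l z (axis j 1)" for z j
      by (simp add: T'_def axis_def if_distrib if_distribR cong: if_cong)
    fix l' z assume l': "l' \<in> patch_index S s (\<delta> k)" and z: "norm (z - lattice_node (\<delta> k) l) \<le> s * \<delta> k"
      "norm (z - lattice_node (\<delta> k) l') \<le> s * \<delta> k"
    have "norm (T k l z - T k l' z) \<le> B * H0 k"
      using same[OF a(1)[OF l'] a(1)[OF l] za[OF l' z(2)] za[OF l z(1)], of "[]" "P k"] by (simp add: T_def Pq)
    also have "\<dots> \<le> H k" using Bn H0p[of k] by (simp add: H_def mult_right_mono)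
    finally show "norm (T k l z - T k l' z) \<le> H k" .
  next
    fix k l l' z assume l: "l \<in> patch_index S s (\<delta> (Suc k))" "l' \<in> patch_index S s (\<delta> k)"
      and z: "norm (z - lattice_node (\<delta> (Suc k)) l) \<le> s * \<delta> (Suc k)" "norm (z - lattice_node (\<delta> k) l') \<le> s * \<delta> k"
    show "norm (T (Suc k) l z - T k l' z) \<le> H k"
      using cross[OF l z, of "[]" "P k" "P (Suc k)"] by (simp add: T_def H_def Pq mult_ac)
    show "norm (T' (Suc k) l z v - T' k l' z v) \<le> G k * norm v" for v
    proof -
      have "norm (v $ i * (taylor f (a (Suc k) l) z (P (Suc k) - 1) [i] - taylor f (a k l') z (P k - 1) [i]))
         \<le> norm v * (3 * B * \<rho> / c * (H0 k / \<delta> k))" for i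
      proof -
        have "norm (taylor f (a (Suc k) l) z (P (Suc k) - 1) [i] - taylor f (a k l') z (P k - 1) [i])
            \<le> B * (\<rho> / (c * \<delta> k)) ^ 1 * (3 * H0 k)"
          using cross[OF l z, of "[i]" "P k - 1" "P (Suc k) - 1"] by (simp add: Pq'[of k] Pq'[of "Suc k"])
        also have "\<dots> = 3 * B * \<rho> / c * (H0 k / \<delta> k)" by simp
        finally show ?thesis unfolding norm_mult
          by (intro mult_mono Finite_Cartesian_Product.norm_nth_le) auto
      qed
      then have "norm (\<Sum>i\<in>UNIV. v $ i * (taylor f (a (Suc k) l) z (P (Suc k) - 1) [i] - taylor f (a k l') z (P k - 1) [i]))
         \<le> (\<Sum>i\<in>(UNIV::'n set). norm v * (3 * B * \<rho> / c * (H0 k / \<delta> k)))"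
        by (intro sum_norm_le) auto
      moreover have "T' (Suc k) l z v - T' k l' z v =
          (\<Sum>i\<in>UNIV. v $ i * (taylor f (a (Suc k) l) z (P (Suc k) - 1) [i] - taylor f (a k l') z (P k - 1) [i]))"
        by (simp only: T'_def right_diff_distrib sum_subtractf)
      ultimately show ?thesis by (simp add: G_def mult_ac)
    qed
  next
    show "summable (\<lambda>k. H k / \<delta> k)"
      using summable_mult[OF sH0, of "3 * B"] by (simp add: H_def)
    show "summable G" unfolding G_def by (intro summable_mult sH0)
    show "0 \<le> H k" for k using Bn H0p[of k] by (simp add: H_def)
    show "0 \<le> G k" for k using Bn H0p[of k] \<delta>p[of k] c0 \<rho> by (simp add: G_def)
  qed (use S s_def \<delta>0 \<delta>_def in auto)
  have ext_f: "pa.ext (cemb x) = complex_of_real (f x)" if x: "x \<in> U" for x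
  proof (rule pa.ext_on_S[where K = "\<lambda>k. B * H0 k"])
    show "cemb x \<in> S" using x closure_subset by (auto simp: S_def)
    have "summable (\<lambda>k. B * H0 k)" using summable_mult[OF pa.summable_H, of "1 / 3"] by (simp add: H_def)
    then show "(\<lambda>k. B * H0 k) \<longlonglongrightarrow> 0" by (rule summable_LIMSEQ_zero)
    show "0 \<le> B * H0 k" for k using Bn H0p[of k] by simp
    fix k l assume l: "l \<in> patch_index S s (\<delta> k)" and z: "norm (cemb x - lattice_node (\<delta> k) l) \<le> s * \<delta> k"
    \<comment> \<open>The Taylor polynomial based at \<open>x\<close> has the value
      \<open>f x\<close> there, so each patch near \<open>x\<close> differs from it by a change of
      base point.\<close>
    have "norm (cemb x - cemb x) \<le> 6 * (s * \<delta> k)" using s0 \<delta>p[of k] by simp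
    from same[OF x a(1)[OF l] this za[OF l z], of "[]" "P k"]
    show "norm (T k l (cemb x) - complex_of_real (f x)) \<le> B * H0 k" by (simp add: T_def Pq taylor_self)
  qed
  obtain Cs where Cs: "Cs \<ge> 0" "\<And>k z. infdist z S < 3 * s * \<delta> k \<Longrightarrow> 5 / 4 * s * \<delta> k < infdist z S \<Longrightarrow>
      norm (dbar pa.ext z) \<le> Cs * (H k / \<delta> k)"
    using pa.ext_dbar_shell by blast
  obtain Cb where Cb: "Cb \<ge> 0" "\<And>z. norm (dbar pa.ext z) \<le> Cb" using pa.ext_dbar_bounded by blast
  let ?h = "h_fun (small_seq N2)"
  \<comment> \<open>On shell \<open>k\<close> the scale \<open>\<delta> k\<close> is less than
    \<open>4 / (5 * s)\<close> times the distance to \<open>S\<close>; inserting this into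
    \<open>C2 * (C1 * t k)\<close> gives \<open>\<sigma>\<close>.\<close>
  define \<sigma> where "\<sigma> = C2 * C1 * (8 * c) * (4 / (5 * s))"
  have \<sigma>: "\<sigma> > 0" using N1 N2 c0 s0 by (simp add: \<sigma>_def)
  define K1 where "K1 = Cs * (3 * B) * (8 * c * C1) * C2"
  \<comment> \<open>Far from \<open>S\<close> boundedness of \<open>dbar\<close> suffices, because
    \<open>?h\<close> is monotone and positive there.\<close>
  define K2 where "K2 = Cb / ?h (\<sigma> * (3 * s * \<delta>0))"
  define K where "K = K1 + K2 + 1"
  have hp: "?h (\<sigma> * (3 * s * \<delta>0)) > 0" using \<sigma> s0 \<delta>0 by (intro h_fun_pos[OF n2]) simp
  have K1: "K1 \<ge> 0" using Cs Bn c0 N1 N2 by (simp add: K1_def)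
  have K2: "K2 \<ge> 0" using Cb hp by (simp add: K2_def)
  have hnn: "?h (\<sigma> * infdist z S) \<ge> 0" for z
    using \<sigma> infdist_nonneg[of z S] by (intro h_fun_nonneg[OF n2]) simp
  have off: "norm (dbar pa.ext z) \<le> K * ?h (\<sigma> * infdist z S)" if pos: "infdist z S > 0" for z
  proof (cases "infdist z S \<ge> 3 * s * \<delta>0")
    case True
    have "norm (dbar pa.ext z) \<le> Cb" by (rule Cb)
    also have "\<dots> = K2 * ?h (\<sigma> * (3 * s * \<delta>0))" using hp by (simp add: K2_def)
    also have "\<dots> \<le> K2 * ?h (\<sigma> * infdist z S)"
      using True \<sigma> s0 \<delta>0 K2 by (intro mult_left_mono h_fun_mono[OF n2]) auto
    also have "\<dots> \<le> K * ?h (\<sigma> * infdist z S)" using K1 hnn by (intro mult_right_mono) (auto simp: K_def)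
    finally show ?thesis .
  next
    case False
    have "\<exists>k. 3 * s * \<delta> k \<le> infdist z S"
    proof -
      have "(\<lambda>k. 3 * s * \<delta>0 * (1 / 2) ^ k) \<longlonglongrightarrow> 0" by (intro tendsto_mult_right_zero LIMSEQ_power_zero) simp
      then have "eventually (\<lambda>k. 3 * s * \<delta>0 * (1 / 2) ^ k < infdist z S) sequentially"
        using pos by (simp add: order_tendsto_iff)
      then obtain k where "3 * s * \<delta>0 * (1 / 2) ^ k < infdist z S" using eventually_happens by force
      then show ?thesis by (intro exI[of _ k]) (simp add: \<delta>_def power_one_over)
    qed
    \<comment> \<open>The first scale whose threshold does not exceed the distance. The preceding
      scale \<open>k\<close> is a shell containing \<open>z\<close>, because
      \<open>3 * s * \<delta> (Suc k)\<close> is \<open>3 / 2 * s * \<delta> k\<close> and exceeds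
      \<open>5 / 4 * s * \<delta> k\<close>.\<close>
    define k' where "k' = (LEAST k. 3 * s * \<delta> k \<le> infdist z S)"
    have k': "3 * s * \<delta> k' \<le> infdist z S" unfolding k'_def by (rule LeastI_ex) fact
    have "k' \<noteq> 0"
    proof
      assume "k' = 0"
      then have "\<delta> k' = \<delta>0" by (simp add: \<delta>_def)
      then show False using k' False by simp
    qed
    then obtain k where k: "k' = Suc k" by (cases k') auto
    have lt: "infdist z S < 3 * s * \<delta> k"
      using not_less_Least[of k "\<lambda>k. 3 * s * \<delta> k \<le> infdist z S"] k unfolding k'_def by (simp add: not_le)
    have half: "\<delta> (Suc k) = \<delta> k / 2" by (simp add: \<delta>_def)
    have "s * \<delta> k > 0" using s0 \<delta>p by simp
    then have gt: "5 / 4 * s * \<delta> k < infdist z S" using k' unfolding k half by linarith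
    have "norm (dbar pa.ext z) \<le> Cs * (H k / \<delta> k)" by (rule Cs(2)[OF lt gt])
    also have "\<dots> = Cs * (3 * B) * (H0 k / \<delta> k)" by (simp add: H_def)
    also have "\<dots> \<le> Cs * (3 * B) * (h_fun (small_seq N1) (C1 * t k) / \<delta> k)"
      using Cs Bn H0_h[of k] \<delta>p[of k] by (intro mult_left_mono divide_right_mono) auto
    \<comment> \<open>Dividing by the argument of \<open>h_fun\<close>, up to a constant, brings the
      expression into the form of \<open>h_fun_divide_le\<close>.\<close>
    also have "h_fun (small_seq N1) (C1 * t k) / \<delta> k = (8 * c * C1) * (h_fun (small_seq N1) (C1 * t k) / (C1 * t k))"
      using N1 c0 \<delta>p[of k] by (simp add: t_def)
    also have "Cs * (3 * B) * \<dots> \<le> Cs * (3 * B) * ((8 * c * C1) * (C2 * ?h (C2 * (C1 * t k))))"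
      using Cs Bn c0 N1 tp[of k] by (intro mult_left_mono h_fun_divide_le[OF n1 n2 N2(2) n12]) auto
    also have "\<dots> = K1 * ?h (C2 * (C1 * t k))" by (simp add: K1_def)
    also have "\<dots> \<le> K1 * ?h (\<sigma> * infdist z S)"
    proof (intro mult_left_mono K1 h_fun_mono[OF n2])
      show "0 \<le> C2 * (C1 * t k)" using N1 N2 tp[of k] by simp
      have "\<delta> k \<le> 4 / (5 * s) * infdist z S" using gt s0 by (simp add: field_simps)
      then have "(C2 * C1 * (8 * c)) * \<delta> k \<le> (C2 * C1 * (8 * c)) * (4 / (5 * s) * infdist z S)"
        using N1 N2 c0 by (intro mult_left_mono) auto
      then show "C2 * (C1 * t k) \<le> \<sigma> * infdist z S" by (simp add: t_def \<sigma>_def mult_ac)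
    qed
    also have "\<dots> \<le> K * ?h (\<sigma> * infdist z S)" using K2 hnn by (intro mult_right_mono) (auto simp: K_def)
    finally show ?thesis .
  qed
  \<comment> \<open>On \<open>S\<close> the associated function is 0, so \<open>dbar\<close> must
    vanish there. As \<open>S\<close> lies in the real subspace, moving one coordinate by
    \<open>\<i> * r\<close> leaves it; the bound \<open>off\<close> with the first-order term of
    \<open>?h\<close> tends to 0 with \<open>r\<close>, and continuity of \<open>dbar\<close>
    concludes.\<close>
  have on: "norm (dbar pa.ext z) \<le> 0" if z: "z \<in> S" for z
  proof -
    define w where "w r = z + axis undefined (\<i> * complex_of_real r)" for r
    have wd: "norm (w r - z) = \<bar>r\<bar>" for r by (simp add: w_def pa.norm_axis_complex norm_mult)
    have wS: "infdist (w r) S > 0" if "r > 0" for r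
    proof -
      have "w r \<notin> S"
      proof
        assume "w r \<in> S"
        then obtain x where "w r = cemb x" by (auto simp: S_def)
        moreover obtain y where "z = cemb y" using z by (auto simp: S_def)
        ultimately have "Im (w r $ undefined) = Im (z $ undefined)" by (simp add: cemb_def)
        then show False using that by (simp add: w_def axis_def)
      qed
      then show ?thesis using S(2) compact_imp_closed[OF S(1)] in_closed_iff_infdist_zero[of S "w r"] infdist_nonneg[of "w r" S]
        by (simp add: less_le)
    qed
    have tl: "((\<lambda>r. norm (dbar pa.ext (w r))) \<longlongrightarrow> norm (dbar pa.ext z)) (at_right 0)"
    proof -
      have "((\<lambda>r. w r - z) \<longlongrightarrow> 0) (at_right 0)"
        by (rule tendsto_norm_zero_cancel, simp only: wd) (auto intro!: tendsto_eq_intros)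
      then have "(w \<longlongrightarrow> z) (at_right 0)" by (simp add: LIM_zero_iff)
      moreover have "isCont (\<lambda>z. norm (dbar pa.ext z)) z"
        using pa.ext_dbar_continuous by (simp add: continuous_on_eq_continuous_at)
      ultimately show ?thesis by (rule isCont_tendsto_compose[rotated])
    qed
    have "((\<lambda>r. K * (small_seq N2 1 * (\<sigma> * r))) \<longlongrightarrow> K * (small_seq N2 1 * (\<sigma> * 0))) (at_right 0)"
      by (intro tendsto_intros)
    moreover have "\<forall>\<^sub>F r in at_right 0. norm (dbar pa.ext (w r)) \<le> K * (small_seq N2 1 * (\<sigma> * r))"
      using eventually_at_right_less[of "0::real"]
    proof eventually_elim
      case (elim r)
      have "infdist (w r) S \<le> r" using infdist_le[OF z, of "w r"] wd[of r] elim by (simp add: dist_norm)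
      then have le: "\<sigma> * infdist (w r) S \<le> \<sigma> * r" using \<sigma> by (intro mult_left_mono) auto
      have "norm (dbar pa.ext (w r)) \<le> K * ?h (\<sigma> * infdist (w r) S)" by (rule off[OF wS[OF elim]])
      also have "\<dots> \<le> K * (small_seq N2 1 * (\<sigma> * infdist (w r) S) ^ 1)"
        using K1 K2 \<sigma> infdist_nonneg[of "w r" S] by (intro mult_left_mono h_fun_le[OF n2]) (auto simp: K_def)
      also have "\<dots> \<le> K * (small_seq N2 1 * (\<sigma> * r))"
        using K1 K2 le root_divergentD(1)[OF n2, of 1] by (intro mult_left_mono) (auto simp: K_def)
      finally show ?case .
    qed
    ultimately have "norm (dbar pa.ext z) \<le> K * (small_seq N2 1 * (\<sigma> * 0))"
      by (intro tendsto_le[OF _ _ tl]) auto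
    then show ?thesis by simp
  qed
  have "norm (dbar pa.ext z) \<le> K * ?h (\<sigma> * infdist z S)" for z
  proof (cases "z \<in> S")
    case True
    then show ?thesis using on[OF True] by (simp add: h_fun_def)
  next
    case False
    then have "infdist z S > 0"
      using S(2) compact_imp_closed[OF S(1)] in_closed_iff_infdist_zero[of S z] infdist_nonneg[of z S] by (simp add: less_le)
    then show ?thesis by (rule off)
  qed
  moreover have "K \<ge> 1" using K1 K2 by (simp add: K_def)
  ultimately have "almost_analytic_ext ?h \<sigma> U f"
    unfolding almost_analytic_ext_def S_def[symmetric]
    using pa.ext_C1c ext_f by blast
  then show ?thesis unfolding almost_analytic_extendable_def using N2(1) \<sigma> by blast
qed

theorem theorem3p2:
  fixes \<MM> :: "(nat \<Rightarrow> real) set" and U :: "(real^'n) set" and f :: "real^'n \<Rightarrow> real"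
  assumes "R_regular \<MM>" and "quasiconvex_domain U"
  shows "f \<in> B_roumieu \<MM> U \<longleftrightarrow> almost_analytic_extendable \<MM> U f"
  using B_roumieu_imp_almost_analytic_extendable[OF assms]
    almost_analytic_extendable_imp_B_roumieu[OF assms(1)] assms(2)
  by (auto simp: quasiconvex_domain_def)

end
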